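(* Let $X$ be a compact Hausdorff space equipped with a continuous right action of a compact Hausdorff group $G$. Then the action is free if and only if the canonical map $$\mathrm{can}\colon \mathcal{P}_G(X)\underset{C(X/G)}{\otimes}\mathcal{P}_G(X)\longrightarrow \mathcal{P}_G(X)\otimes\mathcal{O}(G),\qquad x\otimes y\longmapsto (x\otimes 1)\,\delta(y),$$ is bijective, where both tensor products are purely algebraic.
   Context: For a compact Hausdorff space $Y$, $C(Y)$ denotes the algebra of all continuous complex-valued functions on $Y$. The symbol $\otimes$ without subscript is the purely algebraic tensor product over $\mathbb{C}$ (no completion). $\mathcal{O}(G)\subseteq C(G)$ denotes the linear span of the matrix coefficients of irreducible representations of $G$ (irreducible continuous finite-dimensional complex representations); it is a dense Hopf $*$-subalgebra of $C(G)$. The action map $X\times G\to X$, $(x,g)\mapsto xg$, determines the $*$-homomorphism $\delta\colon C(X)\to C(X\times G)$, $\delta(a)(x,g)=a(xg)$. The algebra $C(X)\otimes\mathcal{O}(G)$ is regarded as a subalgebra of $C(X\times G)$ via $(a\otimes h)(x,g)=a(x)h(g)$. The Peter--Weyl subalgebra of $C(X)$ is $$\mathcal{P}_G(X):=\{a\in C(X)\mid \delta(a)\in C(X)\otimes\mathcal{O}(G)\}.$$ By coassociativity, $\delta$ restricts to a map $\mathcal{P}_G(X)\to\mathcal{P}_G(X)\otimes\mathcal{O}(G)$, making $\mathcal{P}_G(X)$ a right $\mathcal{O}(G)$-comodule algebra. The algebra $C(X/G)$ is regarded as the subalgebra of $G$-invariant functions in $\mathcal{P}_G(X)$, via pullback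 along the quotient map $X\to X/G$; this defines the $C(X/G)$-module structure used in the balanced algebraic tensor product $\mathcal{P}_G(X)\otimes_{C(X/G)}\mathcal{P}_G(X)$. The action is free if $xg=x$ for some $x\in X$ implies $g=e$, the identity element of $G$. *)

theory Defs
  imports
    "HOL-Analysis.Analysis"
    "HOL-Library.Function_Algebras"
    "HOL-Algebra.Free_Abelian_Groups"
    "Jordan_Normal_Form.Matrix"
begin

section \<open>Algebraic tensor products\<close>

text \<open>
  The tensor product of two modules over a commutative ring is the free abelian group on pairs
  modulo biadditivity and balancedness. The modules are subsets \<open>M\<close>, \<open>N\<close> of abelian groups, and
  the ring enters through the set \<open>R\<close> of scalars and its actions \<open>sm\<close>, \<open>sn\<close> on \<open>M\<close> and \<open>N\<close>.
  HOL-Algebra writes the group operation multiplicatively, although \<^const>\<open>free_Abelian_group\<close>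
  carries the addition of \<^typ>\<open>'a \<Rightarrow>\<^sub>0 int\<close>.
\<close>

definition tensor_relations ::
  "'r set \<Rightarrow> ('r \<Rightarrow> 'm \<Rightarrow> 'm) \<Rightarrow> ('r \<Rightarrow> 'n \<Rightarrow> 'n) \<Rightarrow>
    'm::ab_group_add set \<Rightarrow> 'n::ab_group_add set \<Rightarrow> ('m \<times> 'n \<Rightarrow>\<^sub>0 int) set"
  where "tensor_relations R sm sn M N =
    {frag_of (m + m', n) - frag_of (m, n) - frag_of (m', n) | m m' n. m \<in> M \<and> m' \<in> M \<and> n \<in> N} \<union>
    {frag_of (m, n + n') - frag_of (m, n) - frag_of (m, n') | m n n'. m \<in> M \<and> n \<in> N \<and> n' \<in> N} \<union>
    {frag_of (sm r m, n) - frag_of (m, sn r n) | r m n. r \<in> R \<and> m \<in> M \<and> n \<in> N}"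

definition tensor_null ::
  "'r set \<Rightarrow> ('r \<Rightarrow> 'm \<Rightarrow> 'm) \<Rightarrow> ('r \<Rightarrow> 'n \<Rightarrow> 'n) \<Rightarrow>
    'm::ab_group_add set \<Rightarrow> 'n::ab_group_add set \<Rightarrow> ('m \<times> 'n \<Rightarrow>\<^sub>0 int) set"
  where "tensor_null R sm sn M N =
    generate (free_Abelian_group (M \<times> N)) (tensor_relations R sm sn M N)"

definition tensor_product ::
  "'r set \<Rightarrow> ('r \<Rightarrow> 'm \<Rightarrow> 'm) \<Rightarrow> ('r \<Rightarrow> 'n \<Rightarrow> 'n) \<Rightarrow>
    'm::ab_group_add set \<Rightarrow> 'n::ab_group_add set \<Rightarrow> ('m \<times> 'n \<Rightarrow>\<^sub>0 int) set monoid"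
  where "tensor_product R sm sn M N =
    free_Abelian_group (M \<times> N) Mod tensor_null R sm sn M N"

definition elem_tensor ::
  "'r set \<Rightarrow> ('r \<Rightarrow> 'm \<Rightarrow> 'm) \<Rightarrow> ('r \<Rightarrow> 'n \<Rightarrow> 'n) \<Rightarrow>
    'm::ab_group_add set \<Rightarrow> 'n::ab_group_add set \<Rightarrow> 'm \<Rightarrow> 'n \<Rightarrow> ('m \<times> 'n \<Rightarrow>\<^sub>0 int) set"
  where "elem_tensor R sm sn M N m n =
    tensor_null R sm sn M N #>\<^bsub>free_Abelian_group (M \<times> N)\<^esub> frag_of (m, n)"

text \<open>
  \<open>tensor_lift \<phi>\<close> is the map on the tensor product induced by a balanced biadditive map \<open>\<phi>\<close>, see
  \<open>tensor_lift_elem\<close> and \<open>tensor_lift_add\<close> below; it takes the common value of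
  \<open>free_lift \<phi>\<close> on a coset.
\<close>

definition free_lift :: "('m \<Rightarrow> 'n \<Rightarrow> 'p::ring_1) \<Rightarrow> ('m \<times> 'n \<Rightarrow>\<^sub>0 int) \<Rightarrow> 'p"
  where "free_lift \<phi> t =
    (\<Sum>q\<in>Poly_Mapping.keys t. of_int (Poly_Mapping.lookup t q) * \<phi> (fst q) (snd q))"

definition tensor_lift :: "('m \<Rightarrow> 'n \<Rightarrow> 'p::ring_1) \<Rightarrow> ('m \<times> 'n \<Rightarrow>\<^sub>0 int) set \<Rightarrow> 'p"
  where "tensor_lift \<phi> c = the_elem (free_lift \<phi> ` c)"

definition balanced_on ::
  "'r set \<Rightarrow> ('r \<Rightarrow> 'm \<Rightarrow> 'm) \<Rightarrow> ('r \<Rightarrow> 'n \<Rightarrow> 'n) \<Rightarrow>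
    'm::ab_group_add set \<Rightarrow> 'n::ab_group_add set \<Rightarrow> ('m \<Rightarrow> 'n \<Rightarrow> 'p::ring_1) \<Rightarrow> bool"
  where "balanced_on R sm sn M N \<phi> \<longleftrightarrow>
    (\<forall>m\<in>M. \<forall>m'\<in>M. \<forall>n\<in>N. \<phi> (m + m') n = \<phi> m n + \<phi> m' n) \<and>
    (\<forall>m\<in>M. \<forall>n\<in>N. \<forall>n'\<in>N. \<phi> m (n + n') = \<phi> m n + \<phi> m n') \<and>
    (\<forall>r\<in>R. \<forall>m\<in>M. \<forall>n\<in>N. \<phi> (sm r m) n = \<phi> m (sn r n))"

definition module_closed :: "'r set \<Rightarrow> ('r \<Rightarrow> 'm \<Rightarrow> 'm) \<Rightarrow> 'm::ab_group_add set \<Rightarrow> bool"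
  where "module_closed R sm M \<longleftrightarrow>
    (\<forall>m\<in>M. \<forall>m'\<in>M. m + m' \<in> M) \<and> (\<forall>r\<in>R. \<forall>m\<in>M. sm r m \<in> M)"

lemma free_lift_superset:
  assumes "finite S" "Poly_Mapping.keys t \<subseteq> S"
  shows "free_lift \<phi> t = (\<Sum>q\<in>S. of_int (Poly_Mapping.lookup t q) * \<phi> (fst q) (snd q))"
  unfolding free_lift_def using assms
  by (intro sum.mono_neutral_left) (auto simp: in_keys_iff)

lemma free_lift_diff: "free_lift \<phi> (s - t) = free_lift \<phi> s - free_lift \<phi> t"
proof -
  let ?S = "Poly_Mapping.keys s \<union> Poly_Mapping.keys t"
  have "free_lift \<phi> u = (\<Sum>q\<in>?S. of_int (Poly_Mapping.lookup u q) * \<phi> (fst q) (snd q))"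
    if "Poly_Mapping.keys u \<subseteq> ?S" for u
    using that by (intro free_lift_superset) auto
  from this[of s] this[of t] this[of "s - t"] show ?thesis
    using keys_diff[of s t]
    by (simp add: lookup_minus left_diff_distrib sum_subtractf)
qed

lemma free_lift_0 [simp]: "free_lift \<phi> 0 = 0"
  by (simp add: free_lift_def)

lemma free_lift_minus: "free_lift \<phi> (- t) = - free_lift \<phi> t"
  using free_lift_diff[of \<phi> 0 t] by simp

lemma free_lift_add: "free_lift \<phi> (s + t) = free_lift \<phi> s + free_lift \<phi> t"
  using free_lift_diff[of \<phi> s "- t"] by (simp add: free_lift_minus)

lemma free_lift_of [simp]: "free_lift \<phi> (frag_of (m, n)) = \<phi> m n"
  by (simp add: free_lift_def)

lemma tensor_relations_subset:
  assumes "module_closed R sm M" "module_closed R sn N"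
  shows "tensor_relations R sm sn M N \<subseteq> carrier (free_Abelian_group (M \<times> N))"
  using assms unfolding tensor_relations_def module_closed_def
  by (auto dest!: subsetD[OF keys_diff])

lemma tensor_null_normal:
  assumes "module_closed R sm M" "module_closed R sn N"
  shows "tensor_null R sm sn M N \<lhd> free_Abelian_group (M \<times> N)"
proof -
  interpret F: comm_group "free_Abelian_group (M \<times> N)"
    by (rule abelian_free_Abelian_group)
  show ?thesis unfolding tensor_null_def
    by (intro F.normal_iff_subgroup[THEN iffD2] F.generate_is_subgroup
        tensor_relations_subset assms)
qed

lemma free_lift_tensor_null:
  assumes "module_closed R sm M" "module_closed R sn N" "balanced_on R sm sn M N \<phi>"
    and "t \<in> tensor_null R sm sn M N"
  shows "free_lift \<phi> t = 0"
  using assms(4) unfolding tensor_null_def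
proof (induction rule: generate.induct)
  have 0: "free_lift \<phi> h = 0" if "h \<in> tensor_relations R sm sn M N" for h
    using that assms(3) unfolding tensor_relations_def balanced_on_def
    by (auto simp: free_lift_diff)
  case (incl h) show ?case using incl by (rule 0)
  case (inv h) then show ?case
    using 0[OF inv] tensor_relations_subset[OF assms(1,2)]
    by (auto simp: free_lift_minus subset_iff)
qed (auto simp: free_lift_add)

lemma tensor_lift_coset:
  assumes "module_closed R sm M" "module_closed R sn N" "balanced_on R sm sn M N \<phi>"
  shows "tensor_lift \<phi> (tensor_null R sm sn M N #>\<^bsub>free_Abelian_group (M \<times> N)\<^esub> t) = free_lift \<phi> t"
proof -
  have "0 \<in> tensor_null R sm sn M N"
    unfolding tensor_null_def using generate.one[of "free_Abelian_group (M \<times> N)"] by simp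
  then have "free_lift \<phi> ` (tensor_null R sm sn M N #>\<^bsub>free_Abelian_group (M \<times> N)\<^esub> t) = {free_lift \<phi> t}"
    unfolding r_coset_def using free_lift_tensor_null[OF assms]
    by (force simp: free_lift_add)
  then show ?thesis by (simp add: tensor_lift_def)
qed

lemma tensor_lift_elem:
  assumes "module_closed R sm M" "module_closed R sn N" "balanced_on R sm sn M N \<phi>"
  shows "tensor_lift \<phi> (elem_tensor R sm sn M N m n) = \<phi> m n"
  unfolding elem_tensor_def tensor_lift_coset[OF assms] by simp

lemma tensor_lift_add:
  assumes "module_closed R sm M" "module_closed R sn N" "balanced_on R sm sn M N \<phi>"
    and "c \<in> carrier (tensor_product R sm sn M N)" "d \<in> carrier (tensor_product R sm sn M N)"
  shows "tensor_lift \<phi> (c \<otimes>\<^bsub>tensor_product R sm sn M N\<^esub> d) = tensor_lift \<phi> c + tensor_lift \<phi> d"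
proof -
  interpret N: normal "tensor_null R sm sn M N" "free_Abelian_group (M \<times> N)"
    by (rule tensor_null_normal[OF assms(1,2)])
  obtain s t where "s \<in> carrier (free_Abelian_group (M \<times> N))" "t \<in> carrier (free_Abelian_group (M \<times> N))"
    "c = tensor_null R sm sn M N #>\<^bsub>free_Abelian_group (M \<times> N)\<^esub> s"
    "d = tensor_null R sm sn M N #>\<^bsub>free_Abelian_group (M \<times> N)\<^esub> t"
    using assms(4,5) unfolding tensor_product_def FactGroup_def RCOSETS_def by auto
  then show ?thesis
    unfolding tensor_product_def FactGroup_def
    by (simp add: N.rcos_sum tensor_lift_coset[OF assms(1-3)] free_lift_add)
qed


section \<open>Complex-valued functions\<close>

definition fscale :: "complex \<Rightarrow> ('a \<Rightarrow> complex) \<Rightarrow> 'a \<Rightarrow> complex"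
  where "fscale c f = (\<lambda>x. c * f x)"

global_interpretation cfun: vector_space "fscale :: complex \<Rightarrow> ('a \<Rightarrow> complex) \<Rightarrow> 'a \<Rightarrow> complex"
  by standard (auto simp: fscale_def fun_eq_iff algebra_simps)

text \<open>
  A function on a subset \<open>S\<close> of a type is represented by its extension by \<open>0\<close>, so that equality of
  functions on \<open>S\<close> is equality in HOL and the algebra operations are the pointwise ones of
  \<open>HOL-Library.Function_Algebras\<close>. The constant function \<open>1\<close> is thus the unit only for
  \<^term>\<open>S = UNIV\<close>.
\<close>

definition cont_funs :: "'a::topological_space set \<Rightarrow> ('a \<Rightarrow> complex) set"
  where "cont_funs S = {f. continuous_on S f \<and> (\<forall>x. x \<notin> S \<longrightarrow> f x = 0)}"

definition simple_tensor :: "('x \<Rightarrow> complex) \<Rightarrow> ('g \<Rightarrow> complex) \<Rightarrow> 'x \<times> 'g \<Rightarrow> complex"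
  where "simple_tensor a h = (\<lambda>(x, g). a x * h g)"

text \<open>
  The tensor product over the complex numbers of two spaces of functions, regarded as a space of
  functions on the product; \<open>tensor_funs_bij\<close> below shows that it is canonically isomorphic to
  the abstract one.
\<close>

definition tensor_funs ::
  "('x \<Rightarrow> complex) set \<Rightarrow> ('g \<Rightarrow> complex) set \<Rightarrow> ('x \<times> 'g \<Rightarrow> complex) set"
  where "tensor_funs A H = cfun.span {simple_tensor a h | a h. a \<in> A \<and> h \<in> H}"

lemma simple_tensor_add:
  "simple_tensor (a + b) h = simple_tensor a h + simple_tensor b h"
  "simple_tensor a (h + k) = simple_tensor a h + simple_tensor a k"
  by (auto simp: simple_tensor_def fun_eq_iff algebra_simps)

lemma simple_tensor_scale:
  "simple_tensor (fscale c a) h = fscale c (simple_tensor a h)"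
  "simple_tensor a (fscale c h) = fscale c (simple_tensor a h)"
  by (auto simp: simple_tensor_def fscale_def fun_eq_iff)

lemma simple_tensor_0 [simp]: "simple_tensor 0 h = 0" "simple_tensor a 0 = 0"
  by (auto simp: simple_tensor_def fun_eq_iff)

lemma balanced_simple_tensor: "balanced_on UNIV fscale fscale A H simple_tensor"
  by (auto simp: balanced_on_def simple_tensor_add simple_tensor_scale)

lemma module_closed_subspace: "cfun.subspace A \<Longrightarrow> module_closed UNIV fscale A"
  by (auto simp: module_closed_def cfun.subspace_def)

context
  fixes A :: "('x \<Rightarrow> complex) set" and H :: "('g \<Rightarrow> complex) set"
  assumes A: "cfun.subspace A" and H: "cfun.subspace H"
  notes [simp del] = plus_fun_apply zero_fun_apply minus_apply uminus_apply
begin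

private abbreviation "F \<equiv> free_Abelian_group (A \<times> H)"
private abbreviation "N \<equiv> tensor_null UNIV fscale fscale A H"

private lemma N_subgroup: "subgroup N F"
  by (intro normal_imp_subgroup tensor_null_normal module_closed_subspace A H)

private lemma N_subset: "t \<in> N \<Longrightarrow> Poly_Mapping.keys t \<subseteq> A \<times> H"
  using subsetD[OF subgroup.subset[OF N_subgroup], of t]
  by (simp only: carrier_free_Abelian_group_iff)

private lemma N_add: "s \<in> N \<Longrightarrow> t \<in> N \<Longrightarrow> s + t \<in> N"
  using subgroup.m_closed[OF N_subgroup, of s t] by simp

private lemma N_minus: "t \<in> N \<Longrightarrow> - t \<in> N"
  using subgroup.m_inv_closed[OF N_subgroup, of t] by (simp add: N_subset)

private lemma N_diff: "s \<in> N \<Longrightarrow> t \<in> N \<Longrightarrow> s - t \<in> N"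
  using N_add[of s "- t"] N_minus[of t] by simp

private lemma N_0: "0 \<in> N"
  unfolding tensor_null_def using generate.one[of F] by simp

private lemma N_rel: "t \<in> tensor_relations UNIV fscale fscale A H \<Longrightarrow> t \<in> N"
  unfolding tensor_null_def by (rule generate.incl)

private lemma N_rels:
  "a \<in> A \<Longrightarrow> b \<in> A \<Longrightarrow> h \<in> H \<Longrightarrow> frag_of (a + b, h) - frag_of (a, h) - frag_of (b, h) \<in> N"
  "a \<in> A \<Longrightarrow> h \<in> H \<Longrightarrow> k \<in> H \<Longrightarrow> frag_of (a, h + k) - frag_of (a, h) - frag_of (a, k) \<in> N"
  "a \<in> A \<Longrightarrow> h \<in> H \<Longrightarrow> frag_of (fscale c a, h) - frag_of (a, fscale c h) \<in> N"
  by (rule N_rel; unfold tensor_relations_def; blast)+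

private lemma N_zero_left: "h \<in> H \<Longrightarrow> frag_of (0, h) \<in> N"
  using N_minus[OF N_rels(1)[of 0 0 h]] A by (simp add: cfun.subspace_0)

private lemma N_zero_right: "a \<in> A \<Longrightarrow> frag_of (a, 0) \<in> N"
  using N_minus[OF N_rels(2)[of a 0 0]] H by (simp add: cfun.subspace_0)

private lemma list_representation:
  assumes "Poly_Mapping.keys t \<subseteq> A \<times> H"
  shows "\<exists>ps. set ps \<subseteq> A \<times> H \<and> t - sum_list (map frag_of ps) \<in> N"
  using assms
proof (induction t rule: frag_induction)
  case zero
  show ?case by (rule exI[of _ "[]"]) (simp add: N_0)
next
  case (one p)
  then show ?case by (intro exI[of _ "[p]"]) (simp add: N_0)
next
  case (diff s t)
  then obtain ps qs where
    ps: "set ps \<subseteq> A \<times> H" "s - sum_list (map frag_of ps) \<in> N" and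
    qs: "set qs \<subseteq> A \<times> H" "t - sum_list (map frag_of qs) \<in> N"
    by blast
  let ?neg = "\<lambda>(a, h). (- a, h)"
  have "sum_list (map frag_of qs) + sum_list (map (frag_of \<circ> ?neg) qs) \<in> N"
    using qs(1)
  proof (induction qs)
    case Nil show ?case by (simp add: N_0)
  next
    case (Cons p qs)
    obtain a h where p: "p = (a, h)" by fastforce
    have "a \<in> A" "h \<in> H" "- a \<in> A"
      using Cons.prems A by (auto simp: p cfun.subspace_neg)
    then have "frag_of (a, h) + frag_of (- a, h) \<in> N"
      using N_diff[OF N_zero_left[of h] N_rels(1)[of a "- a" h]] by (simp add: algebra_simps)
    moreover have "sum_list (map frag_of qs) + sum_list (map (frag_of \<circ> ?neg) qs) \<in> N"
      using Cons by (simp add: o_def case_prod_unfold)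
    ultimately have "(frag_of (a, h) + frag_of (- a, h)) +
        (sum_list (map frag_of qs) + sum_list (map (frag_of \<circ> ?neg) qs)) \<in> N"
      by (rule N_add)
    then show ?case by (simp add: p o_def case_prod_unfold algebra_simps)
  qed
  from N_diff[OF N_diff[OF ps(2) qs(2)] this]
  have "s - t - sum_list (map frag_of (ps @ map ?neg qs)) \<in> N"
    by (simp add: algebra_simps)
  moreover have "set (ps @ map ?neg qs) \<subseteq> A \<times> H"
    using ps(1) qs(1) A by (auto simp: cfun.subspace_neg)
  ultimately show ?case by blast
qed

private lemma move_scalars:
  assumes "a \<in> A" "set qs \<subseteq> A \<times> H"
  shows "(\<Sum>(b, k)\<leftarrow>qs. fscale (f b) k) \<in> H \<and>
    frag_of (a, \<Sum>(b, k)\<leftarrow>qs. fscale (f b) k) + sum_list (map frag_of qs)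
      - (\<Sum>(b, k)\<leftarrow>qs. frag_of (b + fscale (f b) a, k)) \<in> N"
  using assms(2)
proof (induction qs)
  case Nil
  show ?case using N_zero_right[OF assms(1)] H by (simp add: cfun.subspace_0)
next
  case (Cons p qs)
  obtain b k where p: "p = (b, k)" by fastforce
  let ?S = "\<Sum>(b, k)\<leftarrow>qs. fscale (f b) k"
  have bk: "b \<in> A" "k \<in> H" "fscale (f b) a \<in> A" "fscale (f b) k \<in> H"
    using Cons.prems A H assms(1) by (auto simp: p cfun.subspace_scale)
  have IH: "?S \<in> H" "frag_of (a, ?S) + sum_list (map frag_of qs)
      - (\<Sum>(b, k)\<leftarrow>qs. frag_of (b + fscale (f b) a, k)) \<in> N"
    using Cons by auto
  have S: "fscale (f b) k + ?S \<in> H"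
    using H bk IH(1) by (simp add: cfun.subspace_add)
  have "frag_of (a, fscale (f b) k + ?S) - frag_of (a, fscale (f b) k) - frag_of (a, ?S) \<in> N"
    by (rule N_rels) (use bk IH assms(1) in auto)
  moreover have "frag_of (fscale (f b) a, k) - frag_of (a, fscale (f b) k) \<in> N"
    by (rule N_rels) (use bk assms(1) in auto)
  moreover have "frag_of (b + fscale (f b) a, k) - frag_of (b, k) - frag_of (fscale (f b) a, k) \<in> N"
    by (rule N_rels) (use bk in auto)
  ultimately have "(frag_of (a, fscale (f b) k + ?S) - frag_of (a, fscale (f b) k) - frag_of (a, ?S))
    - (frag_of (fscale (f b) a, k) - frag_of (a, fscale (f b) k))
    - (frag_of (b + fscale (f b) a, k) - frag_of (b, k) - frag_of (fscale (f b) a, k))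
    + (frag_of (a, ?S) + sum_list (map frag_of qs)
      - (\<Sum>(b, k)\<leftarrow>qs. frag_of (b + fscale (f b) a, k))) \<in> N"
    using IH(2) by (blast intro: N_add N_diff)
  then show ?case using S by (simp add: p algebra_simps)
qed

private lemma kernel_list:
  assumes "set ps \<subseteq> A \<times> H" "(\<Sum>(a, h)\<leftarrow>ps. simple_tensor a h) = 0"
  shows "sum_list (map frag_of ps) \<in> N"
  using assms
proof (induction "length ps" arbitrary: ps)
  case 0
  then show ?case by (simp add: N_0)
next
  case (Suc n)
  then obtain a h qs where ps: "ps = (a, h) # qs" and n: "n = length qs"
    by (metis length_Suc_conv surj_pair)
  have ah: "a \<in> A" "h \<in> H" and qs: "set qs \<subseteq> A \<times> H"
    using Suc.prems by (auto simp: ps)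
  show ?case
  proof (cases "a = 0")
    case True
    then have "(\<Sum>(a, h)\<leftarrow>qs. simple_tensor a h) = 0"
      using Suc.prems by (simp add: ps)
    then have "sum_list (map frag_of qs) \<in> N"
      using Suc.hyps(1) n qs by blast
    then show ?thesis using True N_add[OF N_zero_left[OF ah(2)]] by (simp add: ps)
  next
    case False
    then obtain x where x: "a x \<noteq> 0" by (auto simp: fun_eq_iff zero_fun_apply)
    define f where "f = (\<lambda>b. - (b x / a x))"
    let ?r = "\<lambda>(b, k). (b + fscale (f b) a, k)"
    have *: "(\<Sum>(b, k)\<leftarrow>rs. simple_tensor b k) (x, y) = - a x * (\<Sum>(b, k)\<leftarrow>rs. fscale (f b) k) y" for rs y
      by (induction rs) (use x in \<open>auto simp: simple_tensor_def fscale_def f_def plus_fun_apply zero_fun_apply algebra_simps\<close>)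
    have h: "h = (\<Sum>(b, k)\<leftarrow>qs. fscale (f b) k)"
    proof
      fix y
      have "simple_tensor a h (x, y) + (\<Sum>(b, k)\<leftarrow>qs. simple_tensor b k) (x, y) = 0"
        using fun_cong[OF Suc.prems(2), of "(x, y)"]
        by (simp add: ps plus_fun_apply zero_fun_apply)
      then show "h y = (\<Sum>(b, k)\<leftarrow>qs. fscale (f b) k) y"
        using x unfolding * by (simp add: simple_tensor_def)
    qed
    have "(\<Sum>(b, k)\<leftarrow>map ?r rs. simple_tensor b k) =
        (\<Sum>(b, k)\<leftarrow>rs. simple_tensor b k) + simple_tensor a (\<Sum>(b, k)\<leftarrow>rs. fscale (f b) k)" for rs
      by (induction rs) (auto simp: simple_tensor_add simple_tensor_scale)
    from this[of qs] have "(\<Sum>(b, k)\<leftarrow>map ?r qs. simple_tensor b k) =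
        (\<Sum>(b, k)\<leftarrow>qs. simple_tensor b k) + simple_tensor a h"
      unfolding h[symmetric] .
    moreover have "simple_tensor a h + (\<Sum>(b, k)\<leftarrow>qs. simple_tensor b k) = 0"
      using Suc.prems(2) by (simp add: ps)
    ultimately have "(\<Sum>(b, k)\<leftarrow>map ?r qs. simple_tensor b k) = 0"
      by (simp only: add.commute)
    moreover have "set (map ?r qs) \<subseteq> A \<times> H"
      using qs ah A by (auto intro!: cfun.subspace_add cfun.subspace_scale)
    ultimately have "sum_list (map frag_of (map ?r qs)) \<in> N"
      using Suc.hyps(1)[of "map ?r qs"] n by simp
    moreover have "frag_of (a, h) + sum_list (map frag_of qs) - sum_list (map frag_of (map ?r qs)) \<in> N"
      using move_scalars[OF ah(1) qs, of f] unfolding h[symmetric]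
      by (simp add: o_def case_prod_unfold)
    ultimately show ?thesis
      using N_add by (fastforce simp: ps)
  qed
qed

private lemma free_lift_kernel:
  assumes "Poly_Mapping.keys t \<subseteq> A \<times> H" "free_lift simple_tensor t = 0"
  shows "t \<in> N"
proof -
  obtain ps where ps: "set ps \<subseteq> A \<times> H" "t - sum_list (map frag_of ps) \<in> N"
    using list_representation[OF assms(1)] by blast
  have "free_lift simple_tensor (sum_list (map frag_of qs)) = (\<Sum>(a, h)\<leftarrow>qs. simple_tensor a h)"
    for qs :: "(('x \<Rightarrow> complex) \<times> ('g \<Rightarrow> complex)) list"
    by (induction qs) (auto simp: free_lift_add)
  then have "(\<Sum>(a, h)\<leftarrow>ps. simple_tensor a h) = 0"
    using free_lift_tensor_null[OF module_closed_subspace[OF A] module_closed_subspace[OF H]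
        balanced_simple_tensor ps(2)] assms(2)
    by (simp add: free_lift_diff)
  from N_add[OF ps(2) kernel_list[OF ps(1) this]] show ?thesis by simp
qed

private lemma free_lift_range:
  "free_lift simple_tensor ` carrier F = tensor_funs A H"
proof
  have "free_lift simple_tensor t \<in> tensor_funs A H" if "Poly_Mapping.keys t \<subseteq> A \<times> H" for t
    using that unfolding tensor_funs_def
  proof (induction t rule: frag_induction)
    case zero
    show ?case by (simp add: cfun.span_zero)
  next
    case (one p)
    then show ?case by (cases p) (auto intro!: cfun.span_base)
  next
    case (diff s t)
    then show ?case unfolding free_lift_diff by (rule cfun.span_diff)
  qed
  then show "free_lift simple_tensor ` carrier F \<subseteq> tensor_funs A H" by auto
next
  show "tensor_funs A H \<subseteq> free_lift simple_tensor ` carrier F"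
  proof
    fix u assume "u \<in> tensor_funs A H"
    then show "u \<in> free_lift simple_tensor ` carrier F"
      unfolding tensor_funs_def
    proof (induction rule: cfun.span_induct_alt)
      case base
      show ?case by (rule image_eqI[of _ _ 0]) auto
    next
      case (step c v w)
      then obtain a h t where v: "v = simple_tensor a h" "a \<in> A" "h \<in> H"
        and t: "w = free_lift simple_tensor t" "Poly_Mapping.keys t \<subseteq> A \<times> H"
        by auto
      have "Poly_Mapping.keys (frag_of (fscale c a, h) + t) \<subseteq> A \<times> H"
        using A v t keys_add[of "frag_of (fscale c a, h)" t] by (auto simp: cfun.subspace_scale)
      moreover have "fscale c v + w = free_lift simple_tensor (frag_of (fscale c a, h) + t)"
        by (simp add: v t free_lift_add simple_tensor_scale)
      ultimately show ?case by auto
    qed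
  qed
qed

lemma tensor_funs_bij:
  "bij_betw (tensor_lift simple_tensor) (carrier (tensor_product UNIV fscale fscale A H))
     (tensor_funs A H)"
proof -
  interpret N: normal N F
    by (rule tensor_null_normal[OF module_closed_subspace[OF A] module_closed_subspace[OF H]])
  have car: "carrier (tensor_product UNIV fscale fscale A H) = (\<lambda>t. N #>\<^bsub>F\<^esub> t) ` carrier F"
    unfolding tensor_product_def FactGroup_def RCOSETS_def by auto
  have lift: "tensor_lift simple_tensor (N #>\<^bsub>F\<^esub> t) = free_lift simple_tensor t" for t
    by (rule tensor_lift_coset[OF module_closed_subspace[OF A] module_closed_subspace[OF H]
          balanced_simple_tensor])
  have eq: "N #>\<^bsub>F\<^esub> s = N #>\<^bsub>F\<^esub> t"
    if st: "s \<in> carrier F" "t \<in> carrier F" "free_lift simple_tensor s = free_lift simple_tensor t" for s t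
  proof -
    have "s - t \<in> N"
      using st keys_diff[of s t] by (intro free_lift_kernel) (auto simp: free_lift_diff)
    then have "s \<in> N #>\<^bsub>F\<^esub> t"
      unfolding r_coset_def by (auto intro!: bexI[of _ "s - t"])
    then show ?thesis using st(2) by (metis N.repr_independence N.is_subgroup)
  qed
  have "inj_on (tensor_lift simple_tensor) (carrier (tensor_product UNIV fscale fscale A H))"
    unfolding car
  proof (rule inj_onI)
    fix c d
    assume "c \<in> (\<lambda>t. N #>\<^bsub>F\<^esub> t) ` carrier F" "d \<in> (\<lambda>t. N #>\<^bsub>F\<^esub> t) ` carrier F"
      and cd: "tensor_lift simple_tensor c = tensor_lift simple_tensor d"
    then obtain s t where "s \<in> carrier F" "t \<in> carrier F" "c = N #>\<^bsub>F\<^esub> s" "d = N #>\<^bsub>F\<^esub> t"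
      by blast
    with cd show "c = d" using eq[of s t] by (simp only: lift)
  qed
  moreover have "tensor_lift simple_tensor ` carrier (tensor_product UNIV fscale fscale A H) = tensor_funs A H"
    unfolding car by (simp add: image_image lift free_lift_range)
  ultimately show ?thesis by (simp add: bij_betw_def)
qed

end


section \<open>Representative functions of a topological group\<close>

text \<open>
  Groups are written additively, as elements of the class \<^class>\<open>topological_group_add\<close>;
  this class does not assume commutativity.
\<close>

definition continuous_rep :: "nat \<Rightarrow> ('g::topological_group_add \<Rightarrow> complex mat) \<Rightarrow> bool"
  where "continuous_rep n \<rho> \<longleftrightarrow>
    (\<forall>g. \<rho> g \<in> carrier_mat n n) \<and> \<rho> 0 = 1\<^sub>m n \<and> (\<forall>g h. \<rho> (g + h) = \<rho> g * \<rho> h) \<and>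
    (\<forall>i<n. \<forall>j<n. continuous_on UNIV (\<lambda>g. \<rho> g $$ (i, j)))"

definition vec_subspace :: "nat \<Rightarrow> complex vec set \<Rightarrow> bool"
  where "vec_subspace n W \<longleftrightarrow> W \<subseteq> carrier_vec n \<and> 0\<^sub>v n \<in> W \<and>
    (\<forall>v\<in>W. \<forall>w\<in>W. v + w \<in> W) \<and> (\<forall>c. \<forall>v\<in>W. c \<cdot>\<^sub>v v \<in> W)"

definition irreducible_rep :: "nat \<Rightarrow> ('g::topological_group_add \<Rightarrow> complex mat) \<Rightarrow> bool"
  where "irreducible_rep n \<rho> \<longleftrightarrow> continuous_rep n \<rho> \<and> n > 0 \<and>
    (\<forall>W. vec_subspace n W \<and> (\<forall>g. \<forall>w\<in>W. \<rho> g *\<^sub>v w \<in> W) \<longrightarrow> W = {0\<^sub>v n} \<or> W = carrier_vec n)"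

definition representative_funs :: "('g::topological_group_add \<Rightarrow> complex) set"
  where "representative_funs =
    cfun.span {\<lambda>g. \<rho> g $$ (i, j) | n \<rho> i j. irreducible_rep n \<rho> \<and> i < n \<and> j < n}"


section \<open>Actions, the Peter--Weyl subalgebra and the canonical map\<close>

text \<open>
  The space acted upon is a subset \<open>X\<close> of a topological type, with the subspace topology; this
  covers the empty space as well.
\<close>

definition continuous_right_action ::
  "'x::topological_space set \<Rightarrow> ('x \<Rightarrow> 'g::topological_group_add \<Rightarrow> 'x) \<Rightarrow> bool"
  where "continuous_right_action X act \<longleftrightarrow>
    (\<forall>x\<in>X. \<forall>g. act x g \<in> X) \<and>
    (\<forall>x\<in>X. act x 0 = x) \<and>
    (\<forall>x\<in>X. \<forall>g h. act (act x g) h = act x (g + h)) \<and>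
    continuous_on (X \<times> UNIV) (\<lambda>(x, g). act x g)"

definition free_action :: "'x set \<Rightarrow> ('x \<Rightarrow> 'g::zero \<Rightarrow> 'x) \<Rightarrow> bool"
  where "free_action X act \<longleftrightarrow> (\<forall>x\<in>X. \<forall>g. act x g = x \<longrightarrow> g = 0)"

definition coaction ::
  "'x set \<Rightarrow> ('x \<Rightarrow> 'g \<Rightarrow> 'x) \<Rightarrow> ('x \<Rightarrow> complex) \<Rightarrow> 'x \<times> 'g \<Rightarrow> complex"
  where "coaction X act a = (\<lambda>(x, g). if x \<in> X then a (act x g) else 0)"

definition peter_weyl ::
  "'x::topological_space set \<Rightarrow> ('x \<Rightarrow> 'g::topological_group_add \<Rightarrow> 'x) \<Rightarrow> ('x \<Rightarrow> complex) set"
  where "peter_weyl X act =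
    {a \<in> cont_funs X. coaction X act a \<in> tensor_funs (cont_funs X) representative_funs}"

text \<open>
  The copy of \<open>C(X/G)\<close> inside the Peter--Weyl subalgebra; \<open>invariant_funs_eq_pullback\<close> below
  identifies it with the pullbacks of the continuous functions on the orbit space.
\<close>

definition invariant_funs ::
  "'x::topological_space set \<Rightarrow> ('x \<Rightarrow> 'g::topological_group_add \<Rightarrow> 'x) \<Rightarrow> ('x \<Rightarrow> complex) set"
  where "invariant_funs X act = {a \<in> peter_weyl X act. \<forall>x\<in>X. \<forall>g. a (act x g) = a x}"

definition peter_weyl_tensor ::
  "'x::topological_space set \<Rightarrow> ('x \<Rightarrow> 'g::topological_group_add \<Rightarrow> 'x) \<Rightarrow>
    (('x \<Rightarrow> complex) \<times> ('x \<Rightarrow> complex) \<Rightarrow>\<^sub>0 int) set monoid"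
  where "peter_weyl_tensor X act =
    tensor_product (invariant_funs X act) (*) (*) (peter_weyl X act) (peter_weyl X act)"

text \<open>
  \<open>can_map_elem_tensor\<close> and \<open>can_map_add\<close> below show that this is the well-defined additive map
  sending the elementary tensor of \<open>x\<close> and \<open>y\<close> to \<open>(x \<otimes> 1) \<delta>(y)\<close>.
\<close>

definition can_map ::
  "'x set \<Rightarrow> ('x \<Rightarrow> 'g \<Rightarrow> 'x) \<Rightarrow>
    (('x \<Rightarrow> complex) \<times> ('x \<Rightarrow> complex) \<Rightarrow>\<^sub>0 int) set \<Rightarrow> 'x \<times> 'g \<Rightarrow> complex"
  where "can_map X act = tensor_lift (\<lambda>x y. simple_tensor x 1 * coaction X act y)"

lemma one_in_representative_funs: "1 \<in> representative_funs"
proof -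
  have "W = {0\<^sub>v 1} \<or> W = carrier_vec 1" if W: "vec_subspace 1 W" for W
  proof (rule disjCI)
    assume "W \<noteq> carrier_vec 1"
    have "w = 0\<^sub>v 1" if "w \<in> W" for w
    proof (rule ccontr)
      assume "w \<noteq> 0\<^sub>v 1"
      moreover have w: "w \<in> carrier_vec 1" using W that by (auto simp: vec_subspace_def)
      ultimately have "vec_index w 0 \<noteq> 0" by (auto simp: Matrix.vec_eq_iff)
      then have "v = (vec_index v 0 / vec_index w 0) \<cdot>\<^sub>v w" if "v \<in> carrier_vec 1" for v
        using that w by (auto simp: Matrix.vec_eq_iff)
      moreover have "c \<cdot>\<^sub>v w \<in> W" for c using W \<open>w \<in> W\<close> by (auto simp: vec_subspace_def)
      ultimately have "v \<in> W" if "v \<in> carrier_vec 1" for v using that by metis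
      then have "carrier_vec 1 \<subseteq> W" by blast
      with W \<open>W \<noteq> carrier_vec 1\<close> show False by (auto simp: vec_subspace_def)
    qed
    then show "W = {0\<^sub>v 1}" using W by (auto simp: vec_subspace_def)
  qed
  then have "irreducible_rep 1 (\<lambda>g::'a. 1\<^sub>m 1)"
    by (simp add: irreducible_rep_def continuous_rep_def)
  then have "(\<lambda>g::'a. 1\<^sub>m 1 $$ (0, 0)) \<in> representative_funs"
    unfolding representative_funs_def by (intro cfun.span_base) (auto intro!: exI)
  moreover have "(\<lambda>g::'a. 1\<^sub>m 1 $$ (0, 0)) = (1 :: 'a \<Rightarrow> complex)" by (auto simp: fun_eq_iff)
  ultimately show ?thesis by simp
qed

lemma subspace_cont_funs: "cfun.subspace (cont_funs S)"
  by (auto simp: cfun.subspace_def cont_funs_def fscale_def plus_fun_def zero_fun_def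
      intro!: continuous_intros)

lemma cont_funs_mult: "a \<in> cont_funs S \<Longrightarrow> b \<in> cont_funs S \<Longrightarrow> a * b \<in> cont_funs S"
  by (auto simp: cont_funs_def times_fun_def intro!: continuous_intros)

lemma subspace_peter_weyl: "cfun.subspace (peter_weyl X act)"
proof -
  have "coaction X act 0 = 0" "coaction X act (a + b) = coaction X act a + coaction X act b"
    "coaction X act (fscale c a) = fscale c (coaction X act a)" for a b c
    by (auto simp: coaction_def fscale_def fun_eq_iff)
  then show ?thesis
    using subspace_cont_funs[of X]
    by (simp add: cfun.subspace_def peter_weyl_def tensor_funs_def cfun.span_zero cfun.span_add
        cfun.span_scale)
qed

lemma invariant_funs_iff:
  fixes a :: "'x::topological_space \<Rightarrow> complex"
  shows "a \<in> invariant_funs X act \<longleftrightarrow> a \<in> cont_funs X \<and> (\<forall>x\<in>X. \<forall>g. a (act x g) = a x)"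
proof -
  have "a \<in> peter_weyl X act" if a: "a \<in> cont_funs X" "\<forall>x\<in>X. \<forall>g. a (act x g) = a x"
  proof -
    have "coaction X act a = simple_tensor a 1"
      using a by (auto simp: coaction_def simple_tensor_def cont_funs_def fun_eq_iff)
    then show ?thesis
      using a one_in_representative_funs
      by (auto simp: peter_weyl_def tensor_funs_def intro!: cfun.span_base)
  qed
  then show ?thesis by (auto simp: invariant_funs_def peter_weyl_def)
qed

lemma invariant_funs_eq_pullback:
  fixes X :: "'x::topological_space set"
  assumes q: "quotient_map (top_of_set X) Y q"
    and orbits: "\<And>x y. x \<in> X \<Longrightarrow> y \<in> X \<Longrightarrow> q x = q y \<longleftrightarrow> (\<exists>g. y = act x g)"
    and act: "continuous_right_action X act"
  shows "invariant_funs X act =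
    {\<lambda>x. if x \<in> X then h (q x) else 0 | h. continuous_map Y euclidean h}"
proof (intro equalityI subsetI)
  fix a assume "a \<in> invariant_funs X act"
  then have a: "continuous_on X a" "\<And>x. x \<notin> X \<Longrightarrow> a x = 0" "\<And>x g. x \<in> X \<Longrightarrow> a (act x g) = a x"
    by (auto simp: invariant_funs_iff cont_funs_def)
  obtain h where h: "continuous_map Y euclidean h" "\<And>x. x \<in> X \<Longrightarrow> h (q x) = a x"
  proof (rule quotient_map_lift_exists[OF q, of euclidean a])
    show "continuous_map (top_of_set X) euclidean a" using a(1) by simp
    show "a x = a y" if "x \<in> topspace (top_of_set X)" "y \<in> topspace (top_of_set X)" "q x = q y" for x y
      using that orbits[of x y] a(3)[of x] by auto
  qed auto
  then have "a = (\<lambda>x. if x \<in> X then h (q x) else 0)" using a(2) by (auto simp: fun_eq_iff)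
  with h(1) show "a \<in> {\<lambda>x. if x \<in> X then h (q x) else 0 | h. continuous_map Y euclidean h}" by blast
next
  fix a :: "'x \<Rightarrow> complex"
  assume "a \<in> {\<lambda>x. if x \<in> X then h (q x) else 0 | h. continuous_map Y euclidean h}"
  then obtain h where h: "continuous_map Y euclidean h" "a = (\<lambda>x. if x \<in> X then h (q x) else 0)"
    by blast
  have "continuous_map (top_of_set X) euclidean (h \<circ> q)"
    using continuous_map_compose[OF quotient_imp_continuous_map[OF q] h(1)] .
  then have "continuous_on X a"
    unfolding h(2) by (auto cong: continuous_on_cong simp: o_def)
  moreover have "q (act x g) = q x" "act x g \<in> X" if "x \<in> X" for x g
    using that act orbits[of x "act x g"] by (auto simp: continuous_right_action_def)
  ultimately show "a \<in> invariant_funs X act"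
    by (auto simp: invariant_funs_iff cont_funs_def h(2))
qed

lemma peter_weyl_invariant_mult:
  assumes "b \<in> invariant_funs X act" "y \<in> peter_weyl X act"
  shows "b * y \<in> peter_weyl X act"
proof -
  have b: "b \<in> cont_funs X" "\<And>x g. x \<in> X \<Longrightarrow> b (act x g) = b x"
    using assms(1) by (auto simp: invariant_funs_iff)
  have "simple_tensor b 1 * u \<in> tensor_funs (cont_funs X) representative_funs"
    if "u \<in> tensor_funs (cont_funs X) representative_funs" for u :: "'a \<times> 'b \<Rightarrow> complex"
    using that unfolding tensor_funs_def
  proof (induction rule: cfun.span_induct_alt)
    case base
    show ?case by (simp add: cfun.span_zero del: zero_fun_apply times_fun_apply)
  next
    case (step c v w)
    then obtain a h where v: "v = simple_tensor a h" "a \<in> cont_funs X" "h \<in> representative_funs"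
      by blast
    have eq: "simple_tensor b 1 * (fscale c v + w) =
        fscale c (simple_tensor (b * a) h) + simple_tensor b 1 * w"
      by (auto simp: v simple_tensor_def fscale_def fun_eq_iff algebra_simps)
    have "simple_tensor (b * a) h \<in>
        {simple_tensor a h |a h. a \<in> cont_funs X \<and> h \<in> representative_funs}"
      using v b(1) cont_funs_mult by blast
    then show ?case
      unfolding eq by (intro cfun.span_add cfun.span_scale cfun.span_base step(2))
  qed
  moreover have "coaction X act (b * y) = simple_tensor b 1 * coaction X act y"
    using b by (auto simp: coaction_def simple_tensor_def fun_eq_iff)
  ultimately show ?thesis
    using assms(2) b(1) by (auto simp: peter_weyl_def cont_funs_mult)
qed

lemma module_closed_peter_weyl: "module_closed (invariant_funs X act) (*) (peter_weyl X act)"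
  using subspace_peter_weyl[of X act] peter_weyl_invariant_mult[of _ X act]
  by (auto simp: module_closed_def cfun.subspace_add)

lemma balanced_can:
  "balanced_on (invariant_funs X act) (*) (*) (peter_weyl X act) (peter_weyl X act)
    (\<lambda>x y. simple_tensor x 1 * coaction X act y)"
  by (auto simp: balanced_on_def simple_tensor_def coaction_def invariant_funs_def fun_eq_iff
      algebra_simps)

lemma can_map_elem_tensor:
  "can_map X act
     (elem_tensor (invariant_funs X act) (*) (*) (peter_weyl X act) (peter_weyl X act) x y) =
   simple_tensor x 1 * coaction X act y"
  unfolding can_map_def
  by (rule tensor_lift_elem[OF module_closed_peter_weyl module_closed_peter_weyl balanced_can])

lemma can_map_add:
  assumes "c \<in> carrier (peter_weyl_tensor X act)" "d \<in> carrier (peter_weyl_tensor X act)"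
  shows "can_map X act (c \<otimes>\<^bsub>peter_weyl_tensor X act\<^esub> d) = can_map X act c + can_map X act d"
  using tensor_lift_add[OF module_closed_peter_weyl module_closed_peter_weyl balanced_can] assms
  unfolding can_map_def peter_weyl_tensor_def by blast

end

theory Submission
  imports Defs "HOL-Complex_Analysis.Great_Picard" "Jordan_Normal_Form.Determinant"
begin

text \<open>
  If the canonical map is onto, every \<open>1 \<otimes> h\<close> lies in its image. At a point \<open>x\<close> fixed by
  \<open>g\<close> the functions in the image take the same value at \<open>(x, g)\<close> and \<open>(x, 0)\<close>, so
  \<open>h g = h 0\<close> for all representative functions \<open>h\<close>, and the Peter-Weyl theorem gives
  \<open>g = 0\<close>.

  If the action is free, then every matrix representation \<open>\<lambda>\<close> of \<open>G\<close> admits matrices \<open>\<Psi>\<close>, \<open>\<Phi>\<close> of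
  functions in the Peter-Weyl subalgebra with \<open>\<Psi>(x) \<Phi>(x g) = \<lambda>(g)\<close>,
  \<open>\<Phi>(x g) = \<Phi>(x) \<lambda>(g)\<close> and \<open>\<Psi>(x g) = \<lambda>(g)\<inverse> \<Psi>(x)\<close>. They come from the Stone-Weierstrass
  theorem, because \<open>(x, g) \<mapsto> (x, x g)\<close> is injective, and from averaging over the group. The first
  identity exhibits preimages. For injectivity, expand \<open>b\<close> as a row of functions \<open>b\<^sub>i\<close> times a basis
  \<open>r\<close> of a finite-dimensional left invariant space with matrix \<open>\<lambda>\<close>; then \<open>c = (b\<^sub>i) \<Psi>\<close> is invariant,
  \<open>b = c \<Phi> r(0)\<close>, and \<open>a \<otimes> b\<close> equals a sum of the \<open>c\<^sub>k a \<otimes> (\<Phi> r(0))\<^sub>k\<close>.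

  The invariant mean is von Neumann's: the translates of a continuous function have convex
  combinations arbitrarily close to a constant.
\<close>

section \<open>The invariant mean on a compact group\<close>

text \<open>Integration is available only as a mean of continuous functions, so the inner product
  \<open>ip\<close> lives on an incomplete space. The Peter-Weyl theorem is therefore extracted from
  a single convolution operator with a symmetric kernel: power iteration produces approximate
  eigenvectors, and equicontinuity of the image of the unit ball replaces the completeness behind a
  spectral theorem. Representative functions are defined through irreducible representations, while
  the constructions yield finite-dimensional translation invariant spaces; complete reducibility,
  \<open>RF_eq_representative_funs\<close>, joins the two. The expansion of
  \<open>b (act x g)\<close> uses a space invariant under left translations because
  \<open>r i (g + h)\<close> must be expanded in the variable \<open>h\<close>: comparing
  coefficients in \<open>b (act x (g + h))\<close> then shows that the row of coefficients
  transforms by the same matrix as \<open>\<Phi>\<close>, and this makes its product with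
  \<open>\<Psi>\<close> invariant.\<close>

definition avg :: "'a list \<Rightarrow> ('a \<Rightarrow> 'b::real_normed_field) \<Rightarrow> 'b"
  where "avg gs F = (\<Sum>g\<leftarrow>gs. F g) / of_nat (length gs)"

lemma avg_const: "gs \<noteq> [] \<Longrightarrow> avg gs (\<lambda>_. c) = c"
  by (simp add: avg_def sum_list_triv)

lemma avg_add: "avg gs (\<lambda>g. F g + H g) = avg gs F + avg gs H"
  by (simp add: avg_def sum_list_addf add_divide_distrib)

lemma avg_mult_left: "avg gs (\<lambda>g. c * F g) = c * avg gs F"
  by (simp add: avg_def sum_list_const_mult)

lemma avg_diff: "avg gs (\<lambda>g. F g - H g) = avg gs F - avg gs H"
  using avg_add[of gs "\<lambda>g. F g - H g" H] by (simp add: algebra_simps)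

lemma avg_map: "avg (map k gs) F = avg gs (\<lambda>g. F (k g))"
  by (simp add: avg_def o_def)

lemma norm_avg_le:
  assumes "gs \<noteq> []" "\<And>g. g \<in> set gs \<Longrightarrow> norm (F g) \<le> e"
  shows "norm (avg gs F) \<le> e"
proof -
  have "norm (\<Sum>g\<leftarrow>gs. F g) \<le> length gs * e"
    using assms(2)
  proof (induction gs)
    case (Cons a gs)
    have "norm (F a + (\<Sum>g\<leftarrow>gs. F g)) \<le> norm (F a) + norm (\<Sum>g\<leftarrow>gs. F g)"
      by (rule norm_triangle_ineq)
    also have "\<dots> \<le> e + length gs * e" using Cons by (intro add_mono) auto
    finally show ?case by (simp add: algebra_simps)
  qed simp
  then show ?thesis using assms(1)
    by (simp add: avg_def norm_divide divide_simps mult.commute)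
qed

lemma avg_near:
  assumes "gs \<noteq> []" "\<And>g. g \<in> set gs \<Longrightarrow> norm (F g - c) \<le> e"
  shows "norm (avg gs F - c) \<le> e"
  using norm_avg_le[OF assms(1), of "\<lambda>g. F g - c"] assms by (simp add: avg_diff avg_const)

lemma product_ne: "List.product gs hs = [] \<longleftrightarrow> gs = [] \<or> hs = []"
proof -
  have "length (List.product gs hs) = 0 \<longleftrightarrow> gs = [] \<or> hs = []" by simp
  then show ?thesis by (simp only: length_0_conv)
qed

text \<open>Iterated averages are again averages over one list. Repetitions in the list act as
  weights, so no general convex combinations are needed.\<close>

lemma avg_product: "avg gs (\<lambda>g. avg hs (F g)) = avg (List.product gs hs) (\<lambda>p. F (fst p) (snd p))"
proof -
  have "(\<Sum>g\<leftarrow>gs. avg hs (F g)) = (\<Sum>p\<leftarrow>List.product gs hs. F (fst p) (snd p)) / of_nat (length hs)"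
    by (induction gs) (auto simp: avg_def o_def add_divide_distrib)
  then show ?thesis by (simp add: avg_def mult.commute)
qed

text \<open>Fubini for finite averages. Empty lists are harmless, as the average over
  \<open>[]\<close> is 0.\<close>

lemma avg_swap: "avg gs (\<lambda>g. avg hs (\<lambda>h. F g h)) = avg hs (\<lambda>h. avg gs (\<lambda>g. F g h))"
proof (induction gs)
  case Nil show ?case by (simp add: avg_def)
next
  case (Cons a gs)
  have "(\<Sum>g\<leftarrow>gs. \<Sum>h\<leftarrow>hs. F g h) = (\<Sum>h\<leftarrow>hs. \<Sum>g\<leftarrow>gs. F g h)" for gs
    by (induction gs) (auto simp: sum_list_addf)
  then show ?case
    by (simp add: avg_def divide_inverse sum_list_mult_const sum_list_const_mult sum_list_addf
        algebra_simps)
qed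

text \<open>A single entry lying \<open>d\<close> below the bound lowers the whole average by
  \<open>d / length gs\<close>. This quantitative drop drives both the existence of the mean and its
  strict positivity.\<close>

lemma avg_le_drop:
  fixes F :: "'a \<Rightarrow> real"
  assumes "\<And>g. g \<in> set gs \<Longrightarrow> F g \<le> b" "h \<in> set gs" "F h \<le> b - d"
  shows "avg gs F \<le> b - d / length gs"
proof -
  have "(\<Sum>g\<leftarrow>gs. F g) \<le> length gs * b - d"
    using assms
  proof (induction gs)
    case (Cons a gs)
    have le: "(\<Sum>g\<leftarrow>gs. F g) \<le> length gs * b"
      using sum_list_mono[of gs F "\<lambda>_. b"] Cons.prems(1) by (simp add: sum_list_triv)
    show ?case
    proof (cases "h = a")
      case True then show ?thesis using le Cons.prems by (simp add: algebra_simps)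
    next
      case False
      then have "(\<Sum>g\<leftarrow>gs. F g) \<le> length gs * b - d" using Cons by auto
      moreover have "F a \<le> b" using Cons.prems by simp
      ultimately show ?thesis by (simp add: algebra_simps)
    qed
  qed simp
  moreover have "length gs > 0" using assms(2) by (cases gs) auto
  ultimately show ?thesis by (simp add: avg_def field_simps)
qed

lemma avg_ge:
  fixes F :: "'a \<Rightarrow> real"
  assumes "gs \<noteq> []" "\<And>g. g \<in> set gs \<Longrightarrow> b \<le> F g"
  shows "b \<le> avg gs F"
  using sum_list_mono[of gs "\<lambda>_. b" F] assms by (simp add: avg_def sum_list_triv field_simps)

lemma continuous_on_avg:
  "(\<And>g. g \<in> set gs \<Longrightarrow> continuous_on S (\<lambda>x. F x g)) \<Longrightarrow> continuous_on S (\<lambda>x. avg gs (F x))"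
  unfolding avg_def divide_inverse
proof (intro continuous_on_mult continuous_on_const)
  show "continuous_on S (\<lambda>x. \<Sum>g\<leftarrow>gs. F x g)" if "\<And>g. g \<in> set gs \<Longrightarrow> continuous_on S (\<lambda>x. F x g)"
    using that by (induction gs) (auto intro!: continuous_intros)
qed

lemma continuous_on_parts:
  "continuous_on UNIV (f :: _ \<Rightarrow> 'b::topological_space) \<Longrightarrow> continuous_on S k \<Longrightarrow> continuous_on S (\<lambda>x. f (k x))"
  by (rule continuous_on_compose2) auto

text \<open>
  All right averages of \<open>f\<close> inherit from \<open>f\<close> one modulus of continuity \<open>V\<close> for left
  translations. If the infimum \<open>s\<close> of their oscillations were positive, averaging once more over
  the \<open>N\<close> translates of \<open>V\<close> that cover the group would lower an oscillation close to \<open>s\<close> by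
  \<open>s / (2 * N)\<close>.
\<close>

lemma real_averages_almost_constant:
  fixes f :: "'g::{topological_group_add,t2_space} \<Rightarrow> real"
  assumes comp: "compact (UNIV :: 'g set)" and f: "continuous_on UNIV f" and e: "e > 0"
  shows "\<exists>gs c. gs \<noteq> [] \<and> (\<forall>x. \<bar>avg gs (\<lambda>g. f (x + g)) - c\<bar> \<le> e)"
proof -
  \<comment> \<open>Upper bounds for the oscillation of some right average, instead of the
    oscillations themselves: no supremum has to be computed.\<close>
  define W where "W = {w. \<exists>gs m. gs \<noteq> [] \<and> (\<forall>x. m \<le> avg gs (\<lambda>g. f (x + g)) \<and> avg gs (\<lambda>g. f (x + g)) \<le> m + w)}"
  have W0: "w \<ge> 0" if "w \<in> W" for w
    using that unfolding W_def by (auto dest: order_trans)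
  have "bounded (f ` UNIV)" by (rule compact_imp_bounded[OF compact_continuous_image[OF f comp]])
  then obtain B where B: "\<And>x. \<bar>f x\<bar> \<le> B" by (auto simp: bounded_iff)
  have "2 * B \<in> W"
    unfolding W_def by (rule CollectI, rule exI[of _ "[0]"], rule exI[of _ "- B"])
      (use abs_le_D1[OF B] abs_le_D2[OF B] in \<open>auto simp: avg_def minus_le_iff\<close>)
  then have ne: "W \<noteq> {}" by blast
  have bdd: "bdd_below W" using W0 by (intro bdd_belowI[of _ 0])
  define s where "s = Inf W"
  have s_le: "s \<le> w" if "w \<in> W" for w unfolding s_def using that bdd by (rule cInf_lower)
  have "s \<le> 0"
  proof (rule ccontr)
    assume "\<not> s \<le> 0"
    then have s: "s > 0" by simp
    have c: "continuous_on (UNIV \<times> UNIV) (\<lambda>(v, x). f (v + x))"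
      unfolding split_beta by (intro continuous_on_parts[OF f] continuous_intros)
    obtain V where V: "0 \<in> V" "open V" "\<And>v x. v \<in> V \<Longrightarrow> \<bar>f (v + x) - f x\<bar> \<le> s / 2"
      by (rule continuous_on_prod_compactE[OF c comp, of 0 "s/2"]) (use s in \<open>auto simp: dist_real_def\<close>)
    define U where "U = (\<lambda>g. {x. x - g \<in> V})"
    have "open (U g)" for g
    proof -
      have "open ((\<lambda>x. x - g) -` V)"
        by (intro open_vimage V continuous_intros)
      then show ?thesis by (simp add: U_def vimage_def)
    qed
    moreover have "UNIV \<subseteq> (\<Union>g. U g)" using V(1) by (auto simp: U_def)
    ultimately obtain D where D: "finite D" "UNIV \<subseteq> (\<Union>g\<in>D. U g)"
      using compactE_image[OF comp, of UNIV U] by (metis (no_types, lifting))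
    obtain ds where ds: "set ds = D" using finite_list[OF D(1)] by blast
    have dne: "ds \<noteq> []" using D ds by auto
    define N where "N = real (length ds)"
    have N: "N > 0" using dne by (simp add: N_def)
    obtain w where w: "w \<in> W" "w < s + s / (2 * N)"
      using cInf_lessD[OF ne, of "s + s / (2 * N)"] s N unfolding s_def[symmetric] by auto
    obtain gs m where gs: "gs \<noteq> []" "\<And>x. m \<le> avg gs (\<lambda>g. f (x + g))" "\<And>x. avg gs (\<lambda>g. f (x + g)) \<le> m + w"
      using w(1) unfolding W_def by blast
    define \<phi> where "\<phi> = (\<lambda>x. avg gs (\<lambda>g. f (x + g)))"
    have "continuous_on UNIV \<phi>" unfolding \<phi>_def
      by (intro continuous_on_avg continuous_on_parts[OF f] continuous_intros)
    then obtain x0 where x0: "\<And>x. \<phi> x0 \<le> \<phi> x"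
      using continuous_attains_inf[OF comp] by auto
    have up: "\<phi> x \<le> \<phi> x0 + w" for x using gs(2)[of x0] gs(3)[of x] by (simp add: \<phi>_def)
    have near: "\<phi> (v + x0) \<le> \<phi> x0 + s / 2" if "v \<in> V" for v
    proof -
      have "norm (avg gs (\<lambda>g. f (v + x0 + g) - f (x0 + g))) \<le> s / 2"
        using V(3)[OF that] by (intro norm_avg_le gs(1)) (simp add: add.assoc)
      then have "\<bar>\<phi> (v + x0) - \<phi> x0\<bar> \<le> s / 2" by (simp add: \<phi>_def avg_diff)
      then show ?thesis by linarith
    qed
    \<comment> \<open>Every \<open>x\<close> lies in some \<open>U d\<close>; then
      \<open>x + (- d + x0)\<close> is in \<open>V + x0\<close>, where \<open>\<phi>\<close> exceeds
      its minimum by at most \<open>s / 2\<close>. So each \<open>x\<close> has at least one low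
      entry in the average over \<open>hs\<close>.\<close>
    define hs where "hs = map (\<lambda>d. - d + x0) ds"
    have hsne: "hs \<noteq> []" using dne by (simp add: hs_def)
    have lower: "\<phi> x0 \<le> avg hs (\<lambda>h. \<phi> (x + h))" for x
      using x0 dne by (intro avg_ge) (auto simp: hs_def)
    have upper: "avg hs (\<lambda>h. \<phi> (x + h)) \<le> \<phi> x0 + (w - s / (2 * N))" for x
    proof -
      obtain d where d: "d \<in> D" "x - d \<in> V" using D(2) by (auto simp: U_def)
      have "\<phi> (x + (- d + x0)) \<le> \<phi> x0 + s / 2" using near[OF d(2)] by (simp flip: add.assoc)
      also have "\<dots> \<le> \<phi> x0 + w - (w - s/2)" by simp
      finally have "avg hs (\<lambda>h. \<phi> (x + h)) \<le> \<phi> x0 + w - (w - s/2) / length hs"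
        by (intro avg_le_drop[where h = "- d + x0"] up) (use d ds in \<open>auto simp: hs_def\<close>)
      \<comment> \<open>Here \<open>s \<le> w\<close> is used: the drop \<open>w - s/2\<close> is at
        least \<open>s/2\<close>.\<close>
      moreover have "(w - s/2) / length hs \<ge> s / (2 * N)"
        using s_le[OF w(1)] N by (simp add: hs_def N_def field_simps)
      ultimately show ?thesis by linarith
    qed
    have eq: "avg hs (\<lambda>h. \<phi> (x + h)) = avg (map (\<lambda>p. fst p + snd p) (List.product hs gs)) (\<lambda>g. f (x + g))" for x
      unfolding \<phi>_def avg_product avg_map by (simp add: add.assoc)
    have "w - s / (2 * N) \<in> W"
      unfolding W_def
      by (rule CollectI, rule exI[of _ "map (\<lambda>p. fst p + snd p) (List.product hs gs)"], rule exI[of _ "\<phi> x0"])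
        (use lower upper gs(1) hsne in \<open>simp add: eq[symmetric] product_ne\<close>)
    then show False using s_le w(2) by fastforce
  qed
  then obtain w where "w \<in> W" "w < e"
    using cInf_lessD[OF ne, of e] e unfolding s_def[symmetric] by auto
  then obtain gs m where "gs \<noteq> []" "\<And>x. m \<le> avg gs (\<lambda>g. f (x + g))" "\<And>x. avg gs (\<lambda>g. f (x + g)) \<le> m + w"
    unfolding W_def by blast
  moreover from this have "avg gs (\<lambda>g. f (x + g)) \<le> m + e" for x
    using \<open>w < e\<close> by (meson add_left_mono less_imp_le order_trans)
  ultimately show ?thesis using e by (intro exI[of _ gs] exI[of _ m]) (auto simp: abs_le_iff algebra_simps intro: order_trans[of _ m])
qed


lemma Re_avg: "Re (avg gs F) = avg gs (\<lambda>g. Re (F g))"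
proof -
  have "Re (\<Sum>g\<leftarrow>gs. F g) = (\<Sum>g\<leftarrow>gs. Re (F g))" by (induction gs) auto
  then show ?thesis by (simp add: avg_def)
qed

lemma Im_avg: "Im (avg gs F) = avg gs (\<lambda>g. Im (F g))"
proof -
  have "Im (\<Sum>g\<leftarrow>gs. F g) = (\<Sum>g\<leftarrow>gs. Im (F g))" by (induction gs) auto
  then show ?thesis by (simp add: avg_def)
qed

lemma cnj_avg: "cnj (avg gs F) = avg gs (\<lambda>g. cnj (F g))"
  by (simp add: complex_eq_iff Re_avg Im_avg avg_mult_left[of _ "-1", simplified])

lemma avg_translates:
  fixes f :: "'g::semigroup_add \<Rightarrow> 'b::real_normed_field"
  shows "avg hs (\<lambda>h. avg gs (\<lambda>g. f (x + h + g))) =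
    avg (map (\<lambda>p. fst p + snd p) (List.product hs gs)) (\<lambda>g. f (x + g))"
  unfolding avg_product avg_map by (simp add: add.assoc)

section \<open>Left and right means of a function on a group\<close>

definition right_mean :: "('g::group_add \<Rightarrow> complex) \<Rightarrow> complex \<Rightarrow> bool"
  where "right_mean f c \<longleftrightarrow>
    (\<forall>e>0. \<exists>gs. gs \<noteq> [] \<and> (\<forall>x. norm (avg gs (\<lambda>g. f (x + g)) - c) \<le> e))"

definition left_mean :: "('g::group_add \<Rightarrow> complex) \<Rightarrow> complex \<Rightarrow> bool"
  where "left_mean f c \<longleftrightarrow>
    (\<forall>e>0. \<exists>gs. gs \<noteq> [] \<and> (\<forall>x. norm (avg gs (\<lambda>g. f (g + x)) - c) \<le> e))"

text \<open>
  On a compact group every continuous \<open>f\<close> has exactly one right mean, which is also its only left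
  mean; the value of \<open>haar\<close> at a discontinuous function is junk.
\<close>

definition haar :: "('g::group_add \<Rightarrow> complex) \<Rightarrow> complex"
  where "haar f = (THE c. right_mean f c)"

text \<open>The double average of \<open>f (h + g)\<close> over \<open>hs\<close> and
  \<open>gs\<close> is near \<open>c\<close> when the inner average is over \<open>gs\<close>, and
  near \<open>d\<close> when it is over \<open>hs\<close>.\<close>

lemma averages_close:
  assumes "gs \<noteq> []" "\<And>x. norm (avg gs (\<lambda>g. f (x + g)) - c) \<le> e"
    and "hs \<noteq> []" "\<And>x. norm (avg hs (\<lambda>h. f (h + x)) - d) \<le> e'"
  shows "norm (c - d) \<le> e + e'"
proof -
  have "norm (avg hs (\<lambda>h. avg gs (\<lambda>g. f (h + g))) - c) \<le> e"
    by (intro avg_near assms)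
  moreover have "norm (avg gs (\<lambda>g. avg hs (\<lambda>h. f (h + g))) - d) \<le> e'"
    by (intro avg_near assms)
  ultimately show ?thesis
    using norm_triangle_ineq4[of "avg hs (\<lambda>h. avg gs (\<lambda>g. f (h + g))) - d"
        "avg hs (\<lambda>h. avg gs (\<lambda>g. f (h + g))) - c"]
    by (simp add: avg_swap[of hs gs])
qed

text \<open>Comparing the two sides gives uniqueness on each of them, as soon as a mean exists on
  the other.\<close>

lemma right_mean_eq_left_mean:
  assumes "right_mean f c" "left_mean f d"
  shows "c = d"
proof (rule ccontr)
  assume "c \<noteq> d"
  then have e: "norm (c - d) / 3 > 0" by simp
  from assms obtain gs hs where
    "gs \<noteq> []" "\<And>x. norm (avg gs (\<lambda>g. f (x + g)) - c) \<le> norm (c - d) / 3"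
    "hs \<noteq> []" "\<And>x. norm (avg hs (\<lambda>h. f (h + x)) - d) \<le> norm (c - d) / 3"
    unfolding right_mean_def left_mean_def using e by meson
  from averages_close[OF this] e show False by simp
qed

lemma left_mean_reflect: "right_mean f c \<Longrightarrow> left_mean (\<lambda>x. f (- x)) c"
  unfolding right_mean_def left_mean_def
proof (intro allI impI)
  fix e :: real assume *: "\<forall>e>0. \<exists>gs. gs \<noteq> [] \<and> (\<forall>x. cmod (avg gs (\<lambda>g. f (x + g)) - c) \<le> e)" "e > 0"
  then obtain gs where "gs \<noteq> []" "\<And>x. cmod (avg gs (\<lambda>g. f (x + g)) - c) \<le> e" by blast
  then show "\<exists>gs. gs \<noteq> [] \<and> (\<forall>x. cmod (avg gs (\<lambda>g. f (- (g + x))) - c) \<le> e)"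
    by (intro exI[of _ "map uminus gs"]) (simp add: avg_map minus_add)
qed

section \<open>Existence, invariance and linearity of the mean on a compact group\<close>

locale compact_group =
  fixes G :: "'g::{topological_group_add,t2_space} itself"
  assumes compact_UNIV: "compact (UNIV :: 'g set)"
begin

abbreviation C :: "('g \<Rightarrow> complex) set" where "C \<equiv> cont_funs UNIV"

lemma C_iff: "f \<in> C \<longleftrightarrow> continuous_on UNIV f"
  by (simp add: cont_funs_def)

lemmas CI = C_iff[THEN iffD2] and CD = C_iff[THEN iffD1]

lemma C_parts: "f \<in> C \<Longrightarrow> continuous_on S k \<Longrightarrow> continuous_on S (\<lambda>x. f (k x))"
  by (auto intro: continuous_on_parts simp: C_iff)

text \<open>Real and imaginary parts are flattened one after the other: the second averaging, over
  \<open>hs\<close>, cannot spoil a real part that is already nearly constant.\<close>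

lemma averages_almost_constant:
  fixes f :: "'g \<Rightarrow> complex"
  assumes f: "continuous_on UNIV f" and e: "e > 0"
  shows "\<exists>gs c. gs \<noteq> [] \<and> (\<forall>x. norm (avg gs (\<lambda>g. f (x + g)) - c) \<le> e)"
proof -
  have "continuous_on UNIV (\<lambda>x. Re (f x))" by (intro continuous_intros f)
  then obtain gs a where a: "gs \<noteq> []" "\<And>x. \<bar>avg gs (\<lambda>g. Re (f (x + g))) - a\<bar> \<le> e / 2"
    using real_averages_almost_constant[OF compact_UNIV, of _ "e/2"] e half_gt_zero by blast
  have "continuous_on UNIV (\<lambda>x. avg gs (\<lambda>g. Im (f (x + g))))"
    by (intro continuous_on_avg continuous_on_Im continuous_on_parts[OF f] continuous_intros)
  then obtain hs b where b: "hs \<noteq> []" "\<And>x. \<bar>avg hs (\<lambda>h. avg gs (\<lambda>g. Im (f (x + h + g)))) - b\<bar> \<le> e / 2"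
    using real_averages_almost_constant[OF compact_UNIV, of _ "e/2"] e half_gt_zero by blast
  have a': "\<bar>avg hs (\<lambda>h. avg gs (\<lambda>g. Re (f (x + h + g)))) - a\<bar> \<le> e / 2" for x
    using avg_near[OF b(1), of "\<lambda>h. avg gs (\<lambda>g. Re (f (x + h + g)))" a "e/2"] a(2)
    unfolding real_norm_def by blast
  have "norm (avg hs (\<lambda>h. avg gs (\<lambda>g. f (x + h + g))) - Complex a b) \<le> e" for x
    by (rule order_trans[OF cmod_le]) (use a'[of x] b(2)[of x] in \<open>simp add: Re_avg Im_avg\<close>)
  then show ?thesis
    unfolding avg_translates using a(1) b(1)
    by (intro exI[of _ "map (\<lambda>p. fst p + snd p) (List.product hs gs)"] exI[of _ "Complex a b"])
      (simp add: product_ne)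
qed

text \<open>Left averages mediate between right averages: each constant \<open>c n\<close> from the
  right is close to each constant \<open>d m\<close> from the left, so the \<open>c n\<close> form a
  Cauchy sequence. The left averages come from applying the almost-constancy to the reflected
  function.\<close>

lemma ex_right_mean:
  fixes f :: "'g \<Rightarrow> complex"
  assumes f: "continuous_on UNIV f"
  shows "\<exists>c. right_mean f c"
proof -
  have "\<forall>n. \<exists>gs c. gs \<noteq> [] \<and> (\<forall>x. norm (avg gs (\<lambda>g. f (x + g)) - c) \<le> inverse (real (Suc n)))"
    using averages_almost_constant[OF f] by (simp del: of_nat_Suc)
  then obtain gs c where gs: "\<And>n. gs n \<noteq> []"
    "\<And>n x. norm (avg (gs n) (\<lambda>g. f (x + g)) - c n) \<le> inverse (real (Suc n))" by metis
  have "continuous_on UNIV (\<lambda>x. f (- x))" by (intro continuous_on_parts[OF f] continuous_intros)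
  then have "\<forall>n. \<exists>hs d. hs \<noteq> [] \<and> (\<forall>x. norm (avg hs (\<lambda>g. f (- (x + g))) - d) \<le> inverse (real (Suc n)))"
    using averages_almost_constant[of "\<lambda>x. f (- x)"] by (simp del: of_nat_Suc)
  then obtain hs d where hs: "\<And>n. hs n \<noteq> []"
    "\<And>n x. norm (avg (hs n) (\<lambda>g. f (- (x + g))) - d n) \<le> inverse (real (Suc n))" by metis
  have hs': "norm (avg (map uminus (hs n)) (\<lambda>g. f (g + x)) - d n) \<le> inverse (real (Suc n))" for n x
    using hs(2)[of n "- x"] by (simp add: avg_map minus_add)
  have cd: "norm (c n - d m) \<le> inverse (real (Suc n)) + inverse (real (Suc m))" for n m
    using averages_close[OF gs(1)[of n] gs(2) _ hs'] hs(1) by simp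
  have cc: "norm (c n - c m) \<le> 3 * inverse (real (Suc n)) + inverse (real (Suc m))" for n m
    using norm_triangle_ineq4[of "c n - d n" "c m - d n"] cd[of n n] cd[of m n] by simp
  have "Cauchy c"
  proof (rule CauchyI)
    fix e :: real assume "e > 0"
    \<comment> \<open>A quarter, because \<open>cc\<close> adds up four terms of this size.\<close>
    then obtain N where N: "inverse (real (Suc N)) < e / 4" using reals_Archimedean[of "e/4"] by auto
    have "inverse (real (Suc n)) < e / 4" if "n \<ge> N" for n
      using N that le_imp_inverse_le[of "real (Suc N)" "real (Suc n)"] by linarith
    note small = this
    have "norm (c m - c n) < e" if "m \<ge> N" "n \<ge> N" for m n
      using cc[of m n] small[of m] small[of n] that by linarith
    then show "\<exists>M. \<forall>m\<ge>M. \<forall>n\<ge>M. norm (c m - c n) < e" by blast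
  qed
  then obtain l where l: "c \<longlonglongrightarrow> l" using Cauchy_convergent convergent_def by blast
  have "right_mean f l"
    unfolding right_mean_def
  proof (intro allI impI)
    fix e :: real assume e: "e > 0"
    have "(\<lambda>n. inverse (real (Suc n))) \<longlonglongrightarrow> 0" by (rule LIMSEQ_inverse_real_of_nat)
    then have "eventually (\<lambda>n. inverse (real (Suc n)) < e / 2) sequentially"
      using e by (intro order_tendstoD) auto
    moreover have "eventually (\<lambda>n. dist (c n) l < e / 2) sequentially"
      using l e by (intro tendstoD) auto
    ultimately have "eventually (\<lambda>n. inverse (real (Suc n)) < e / 2 \<and> dist (c n) l < e / 2) sequentially"
      by (rule eventually_conj)
    then obtain n where n: "inverse (real (Suc n)) < e / 2" "dist (c n) l < e / 2"
      by (auto dest: eventually_happens)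
    have "norm (avg (gs n) (\<lambda>g. f (x + g)) - l) \<le> e" for x
      using norm_triangle_ineq[of "avg (gs n) (\<lambda>g. f (x + g)) - c n" "c n - l"] gs(2)[of n x] n
      by (simp add: dist_norm)
    then show "\<exists>gs. gs \<noteq> [] \<and> (\<forall>x. norm (avg gs (\<lambda>g. f (x + g)) - l) \<le> e)" using gs(1) by blast
  qed
  then show ?thesis ..
qed

lemma ex_left_mean: "f \<in> C \<Longrightarrow> \<exists>c. left_mean f c"
proof -
  assume "f \<in> C"
  then have "continuous_on UNIV (\<lambda>x. f (- x))"
    by (intro C_parts continuous_intros)
  then obtain c where "right_mean (\<lambda>x. f (- x)) c" using ex_right_mean by blast
  from left_mean_reflect[OF this] show ?thesis by auto
qed

lemma right_mean_haar: "f \<in> C \<Longrightarrow> right_mean f (haar f)"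
  unfolding haar_def
  by (rule theI') (metis CD ex_right_mean ex_left_mean right_mean_eq_left_mean)

lemma haar_eqI: "f \<in> C \<Longrightarrow> right_mean f c \<Longrightarrow> haar f = c"
  using right_mean_haar[of f] ex_left_mean[of f] right_mean_eq_left_mean[of f] by metis

lemma left_mean_haar: "f \<in> C \<Longrightarrow> left_mean f (haar f)"
  using right_mean_haar[of f] ex_left_mean[of f] right_mean_eq_left_mean[of f] by metis

lemma haar_eqI': "f \<in> C \<Longrightarrow> left_mean f c \<Longrightarrow> haar f = c"
  using right_mean_haar[of f] right_mean_eq_left_mean[of f] by metis

lemma haar_const [simp]: "haar (\<lambda>_::'g. c) = c"
  by (rule haar_eqI) (auto simp: C_iff right_mean_def avg_const intro!: exI[of _ "[0]"])

lemma haar_cmult: "f \<in> C \<Longrightarrow> haar (\<lambda>x. c * f x) = c * haar f"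
proof (rule haar_eqI)
  assume f: "f \<in> C"
  show "(\<lambda>x. c * f x) \<in> C" using f by (auto intro!: continuous_intros simp: C_iff)
  show "right_mean (\<lambda>x. c * f x) (c * haar f)"
    unfolding right_mean_def
  proof (intro allI impI)
    fix e :: real assume e: "e > 0"
    \<comment> \<open>The \<open>+ 1\<close> covers \<open>c = 0\<close>.\<close>
    then have "e / (norm c + 1) > 0" by (intro divide_pos_pos) (auto intro: add_nonneg_pos)
    then obtain gs where gs: "gs \<noteq> []" "\<And>x. norm (avg gs (\<lambda>g. f (x + g)) - haar f) \<le> e / (norm c + 1)"
      using right_mean_haar[OF f] unfolding right_mean_def by blast
    have "norm (avg gs (\<lambda>g. c * f (x + g)) - c * haar f) \<le> e" for x
    proof -
      have "norm (avg gs (\<lambda>g. c * f (x + g)) - c * haar f) = norm c * norm (avg gs (\<lambda>g. f (x + g)) - haar f)"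
        by (simp add: avg_mult_left norm_mult flip: right_diff_distrib)
      also have "\<dots> \<le> norm c * (e / (norm c + 1))" by (intro mult_left_mono gs) auto
      also have "\<dots> = e * (norm c / (norm c + 1))" by simp
      also have "\<dots> \<le> e * 1" using e by (intro mult_left_mono) (auto simp: divide_le_eq add_nonneg_pos)
      also have "\<dots> = e" by simp
      finally show ?thesis .
    qed
    with gs(1) show "\<exists>gs. gs \<noteq> [] \<and> (\<forall>x. norm (avg gs (\<lambda>g. c * f (x + g)) - c * haar f) \<le> e)" by blast
  qed
qed

text \<open>A left average of the right translate is a left average of \<open>f\<close> at a shifted
  point, so right invariance comes from the left mean. Dually, left invariance below comes from the
  right mean.\<close>

lemma haar_right_translate:
  assumes f: "f \<in> C" shows "haar (\<lambda>x. f (x + h)) = haar f"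
proof (rule haar_eqI')
  show "(\<lambda>x. f (x + h)) \<in> C" by (intro CI C_parts[OF f] continuous_intros)
  show "left_mean (\<lambda>x. f (x + h)) (haar f)"
    using left_mean_haar[OF f] unfolding left_mean_def add.assoc by meson
qed

lemma haar_left_translate:
  assumes f: "f \<in> C" shows "haar (\<lambda>x. f (h + x)) = haar f"
proof (rule haar_eqI)
  show "(\<lambda>x. f (h + x)) \<in> C" by (intro CI C_parts[OF f] continuous_intros)
  show "right_mean (\<lambda>x. f (h + x)) (haar f)"
    using right_mean_haar[OF f] unfolding right_mean_def add.assoc[symmetric] by meson
qed

lemma haar_reflect:
  assumes f: "f \<in> C" shows "haar (\<lambda>x. f (- x)) = haar f"
proof (rule haar_eqI')
  show "(\<lambda>x. f (- x)) \<in> C" by (intro CI C_parts[OF f] continuous_intros)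
  show "left_mean (\<lambda>x. f (- x)) (haar f)" by (intro left_mean_reflect right_mean_haar f)
qed

lemma haar_cnj: "f \<in> C \<Longrightarrow> haar (\<lambda>x. cnj (f x)) = cnj (haar f)"
proof (rule haar_eqI)
  assume f: "f \<in> C"
  then show "(\<lambda>x. cnj (f x)) \<in> C" by (auto intro!: continuous_intros simp: C_iff)
  have "norm (avg gs (\<lambda>g. cnj (f (x + g))) - cnj (haar f)) = norm (avg gs (\<lambda>g. f (x + g)) - haar f)" for gs x
    by (metis cnj_avg complex_cnj_diff complex_mod_cnj)
  then show "right_mean (\<lambda>x. cnj (f x)) (cnj (haar f))"
    using right_mean_haar[OF f] by (simp add: right_mean_def)
qed

text \<open>Left averages commute with the right average over \<open>gs\<close>, so the left mean
  passes through it.\<close>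

lemma avg_haar: "F \<in> C \<Longrightarrow> haar (\<lambda>x. avg gs (\<lambda>g. F (x + g))) = haar F" if "gs \<noteq> []"
proof (rule haar_eqI')
  assume F: "F \<in> C"
  show "(\<lambda>x. avg gs (\<lambda>g. F (x + g))) \<in> C"
    by (intro CI continuous_on_avg C_parts[OF F] continuous_intros)
  show "left_mean (\<lambda>x. avg gs (\<lambda>g. F (x + g))) (haar F)"
    unfolding left_mean_def
  proof (intro allI impI)
    fix e :: real assume "e > 0"
    then obtain hs where hs: "hs \<noteq> []" "\<And>x. norm (avg hs (\<lambda>g. F (g + x)) - haar F) \<le> e"
      using left_mean_haar[OF F] unfolding left_mean_def by blast
    have "norm (avg hs (\<lambda>h. avg gs (\<lambda>g. F (h + x + g))) - haar F) \<le> e" for x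
      unfolding avg_swap[of hs gs] using hs(2)[of "x + _"] by (intro avg_near[OF that]) (simp add: add.assoc)
    with hs(1) show "\<exists>hs. hs \<noteq> [] \<and> (\<forall>x. norm (avg hs (\<lambda>h. avg gs (\<lambda>g. F (h + x + g))) - haar F) \<le> e)"
      by blast
  qed
qed

text \<open>The definition gives each function its own list of translates, and additivity needs a
  common one. A list \<open>gs\<close> that flattens \<open>f\<close> is refined by a list
  \<open>hs\<close> that flattens the \<open>gs\<close>-average of \<open>k\<close>, whose mean is
  still \<open>haar k\<close> by \<open>avg_haar\<close>; the refinement leaves \<open>f\<close>
  flat.\<close>

lemma haar_add:
  assumes f: "f \<in> C" and k: "k \<in> C"
  shows "haar (\<lambda>x. f x + k x) = haar f + haar k"
proof (rule haar_eqI)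
  show "(\<lambda>x. f x + k x) \<in> C" using f k by (auto intro!: continuous_intros simp: C_iff)
  show "right_mean (\<lambda>x. f x + k x) (haar f + haar k)"
    unfolding right_mean_def
  proof (intro allI impI)
    fix e :: real assume "e > 0"
    then have e: "e / 2 > 0" by simp
    obtain gs where gs: "gs \<noteq> []" "\<And>x. norm (avg gs (\<lambda>g. f (x + g)) - haar f) \<le> e / 2"
      using right_mean_haar[OF f] e unfolding right_mean_def by blast
    have "(\<lambda>x. avg gs (\<lambda>g. k (x + g))) \<in> C"
      by (intro CI continuous_on_avg C_parts[OF k] continuous_intros)
    from right_mean_haar[OF this] avg_haar[OF gs(1) k] obtain hs where
      hs: "hs \<noteq> []" "\<And>x. norm (avg hs (\<lambda>h. avg gs (\<lambda>g. k (x + h + g))) - haar k) \<le> e / 2"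
      using e unfolding right_mean_def by metis
    have "norm (avg hs (\<lambda>h. avg gs (\<lambda>g. f (x + h + g))) - haar f) \<le> e / 2" for x
      by (rule avg_near[OF hs(1) gs(2)])
    with hs(2) have "norm (avg hs (\<lambda>h. avg gs (\<lambda>g. f (x + h + g) + k (x + h + g))) - (haar f + haar k)) \<le> e" for x
      using norm_triangle_mono[of "avg hs (\<lambda>h. avg gs (\<lambda>g. f (x + h + g))) - haar f" "e/2"
          "avg hs (\<lambda>h. avg gs (\<lambda>g. k (x + h + g))) - haar k" "e/2"]
      by (simp add: avg_add algebra_simps)
    then show "\<exists>gs. gs \<noteq> [] \<and> (\<forall>x. norm (avg gs (\<lambda>g. f (x + g) + k (x + g)) - (haar f + haar k)) \<le> e)"
      unfolding avg_translates[of hs gs "\<lambda>x. f x + k x"] using gs(1) hs(1)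
      by (intro exI[of _ "map (\<lambda>p. fst p + snd p) (List.product hs gs)"]) (simp add: product_ne)
  qed
qed

lemma haar_le:
  assumes f: "f \<in> C" and B: "\<And>x. norm (f x) \<le> B"
  shows "norm (haar f) \<le> B"
proof (rule field_le_epsilon)
  fix e :: real assume "e > 0"
  then obtain gs where gs: "gs \<noteq> []" "\<And>x. norm (avg gs (\<lambda>g. f (x + g)) - haar f) \<le> e"
    using right_mean_haar[OF f] unfolding right_mean_def by blast
  have "norm (avg gs (\<lambda>g. f (0 + g))) \<le> B" by (intro norm_avg_le gs B)
  then show "norm (haar f) \<le> B + e"
    using gs(2)[of 0] norm_triangle_ineq4[of "avg gs (\<lambda>g. f (0 + g))" "avg gs (\<lambda>g. f (0 + g)) - haar f"]
    by simp
qed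

lemma haar_ge:
  assumes f: "f \<in> C" and B: "\<And>x. Re (f x) \<ge> b"
  shows "Re (haar f) \<ge> b"
proof (rule field_le_epsilon)
  fix e :: real assume "e > 0"
  then obtain gs where gs: "gs \<noteq> []" "\<And>x. norm (avg gs (\<lambda>g. f (x + g)) - haar f) \<le> e"
    using right_mean_haar[OF f] unfolding right_mean_def by blast
  have "b \<le> Re (avg gs (\<lambda>g. f (0 + g)))" unfolding Re_avg by (intro avg_ge gs B)
  also have "\<dots> \<le> Re (haar f) + e"
    using gs(2)[of 0] abs_Re_le_cmod[of "avg gs (\<lambda>g. f (0 + g)) - haar f"] by simp
  finally show "b \<le> Re (haar f) + e" .
qed

text \<open>By compactness finitely many translates of the open set where \<open>Re f\<close>
  exceeds half of its value at \<open>x0\<close> cover the group. The corresponding average of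
  \<open>f\<close> has the same mean and its real part is bounded below by a positive
  constant.\<close>

lemma haar_pos:
  assumes f: "f \<in> C" and pos: "\<And>x. Re (f x) \<ge> 0" and x0: "Re (f x0) > 0"
  shows "Re (haar f) > 0"
proof -
  define U where "U = (\<lambda>g. {x. Re (f (x + g)) > Re (f x0) / 2})"
  have "open (U g)" for g
    unfolding U_def
    by (intro open_Collect_less continuous_on_const continuous_on_Re C_parts[OF f] continuous_intros)
  moreover have "x \<in> U (- x + x0)" for x using x0 by (simp add: U_def)
  then have "UNIV \<subseteq> (\<Union>g. U g)" by blast
  ultimately obtain D where D: "finite D" "UNIV \<subseteq> (\<Union>g\<in>D. U g)"
    using compactE_image[OF compact_UNIV, of UNIV U] by (metis (no_types, lifting))
  obtain ds where ds: "set ds = D" using finite_list[OF D(1)] by blast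
  have dne: "ds \<noteq> []" using D ds by auto
  have "Re (f x0) / 2 / length ds \<le> avg ds (\<lambda>g. Re (f (x + g)))" for x
  proof -
    obtain d where "d \<in> set ds" "x \<in> U d" using D(2) ds by auto
    then have "avg ds (\<lambda>g. - Re (f (x + g))) \<le> 0 - (Re (f x0) / 2) / length ds"
      by (intro avg_le_drop[where h = d]) (auto simp: U_def pos)
    then show ?thesis using avg_mult_left[of ds "-1" "\<lambda>g. Re (f (x + g))"] by simp
  qed
  moreover have "(\<lambda>x. avg ds (\<lambda>g. f (x + g))) \<in> C"
    by (intro CI continuous_on_avg C_parts[OF f] continuous_intros)
  ultimately have "Re (f x0) / 2 / length ds \<le> Re (haar (\<lambda>x. avg ds (\<lambda>g. f (x + g))))"
    by (intro haar_ge) (auto simp: Re_avg)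
  moreover have "Re (f x0) / 2 / length ds > 0" using x0 dne by simp
  ultimately show ?thesis unfolding avg_haar[OF dne f] by linarith
qed

end

section \<open>Approximation by sums of products, and Fubini\<close>

lemma sum_list_times_sum_list:
  fixes f g :: "'a \<Rightarrow> 'b::semiring_0"
  shows "(\<Sum>x\<leftarrow>xs. f x) * (\<Sum>y\<leftarrow>ys. g y) = (\<Sum>p\<leftarrow>List.product xs ys. f (fst p) * g (snd p))"
  by (induction xs) (auto simp: algebra_simps sum_list_const_mult o_def)

lemma continuous_on_sum_list:
  fixes F :: "'i \<Rightarrow> 'a::topological_space \<Rightarrow> 'b::topological_monoid_add"
  shows "(\<And>p. p \<in> set ps \<Longrightarrow> continuous_on S (F p)) \<Longrightarrow> continuous_on S (\<lambda>x. \<Sum>p\<leftarrow>ps. F p x)"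
  by (induction ps) (auto intro!: continuous_intros)

lemma normal_space_compact:
  fixes X :: "'x::t2_space set"
  assumes "compact X" shows "normal_space (top_of_set X)"
proof -
  have "Hausdorff_space (euclidean :: 'x topology)"
    using hausdorff[where 'a = 'x] by (fastforce simp: Hausdorff_space_def disjnt_def)
  then show ?thesis
    using assms by (intro compact_Hausdorff_or_regular_imp_normal_space disjI1 Hausdorff_space_subtopology)
      (auto simp: compact_space_subtopology)
qed

lemma continuous_functions_separate_points:
  fixes X :: "'x::t2_space set"
  assumes X: "compact X" "x \<in> X" "y \<in> X" "x \<noteq> y"
  obtains h :: "'x \<Rightarrow> real" where "continuous_on X h" "h x \<noteq> h y"
proof -
  have "closedin (top_of_set X) {x}" "closedin (top_of_set X) {y}"
    using X by (auto intro: closed_subset)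
  moreover have "disjnt {x} {y}" using X by auto
  ultimately obtain h where "continuous_map (top_of_set X) (top_of_set {0..1::real}) h" "h ` {x} \<subseteq> {0}" "h ` {y} \<subseteq> {1}"
    using Urysohn_lemma[OF normal_space_compact[OF X(1)], of "{x}" "{y}" 0 1] by auto
  then show thesis using that[of h] by (auto simp: continuous_map_in_subtopology)
qed

text \<open>Stone-Weierstrass for functions pulled back along \<open>p\<close> and \<open>q\<close>,
  which separate points jointly. The two maps on \<open>K\<close> are kept general: they become the
  projections of a product for Fubini, and \<open>x\<close> and \<open>act x g\<close> for a free
  action.\<close>

lemma product_functions_dense_real:
  fixes F :: "'k::t2_space \<Rightarrow> real"
    and p :: "'k \<Rightarrow> 'x::t2_space" and q :: "'k \<Rightarrow> 'y::t2_space"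
  assumes K: "compact K" and X: "compact X" and Y: "compact Y"
    and p: "continuous_on K p" "p ` K \<subseteq> X" and q: "continuous_on K q" "q ` K \<subseteq> Y"
    and inj: "\<And>z w. z \<in> K \<Longrightarrow> w \<in> K \<Longrightarrow> p z = p w \<Longrightarrow> q z = q w \<Longrightarrow> z = w"
    and F: "continuous_on K F" and e: "e > 0"
  shows "\<exists>ps. (\<forall>(a, b)\<in>set ps. continuous_on X a \<and> continuous_on Y b) \<and>
    (\<forall>z\<in>K. \<bar>F z - (\<Sum>(a, b)\<leftarrow>ps. a (p z) * b (q z))\<bar> < e)"
proof -
  define R :: "('k \<Rightarrow> real) set" where "R = {f. \<exists>ps. (\<forall>(a, b)\<in>set ps. continuous_on X a \<and> continuous_on Y b) \<and>
    f = (\<lambda>z. \<Sum>(a, b)\<leftarrow>ps. a (p z) * b (q z))}"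
  have R: "(\<lambda>z. a (p z) * b (q z)) \<in> R" if "continuous_on X a" "continuous_on Y b" for a b
    unfolding R_def by (rule CollectI, rule exI[of _ "[(a, b)]"]) (use that in auto)
  interpret function_ring_on R K
  proof
    show "compact K" by fact
    show "continuous_on K f" if "f \<in> R" for f
    proof -
      obtain ps where ps: "\<forall>(a, b)\<in>set ps. continuous_on X a \<and> continuous_on Y b"
        "f = (\<lambda>z. \<Sum>(a, b)\<leftarrow>ps. a (p z) * b (q z))" using \<open>f \<in> R\<close> unfolding R_def by blast
      show ?thesis unfolding ps(2) split_beta
        by (intro continuous_on_sum_list continuous_on_mult)
          (use ps(1) p q in \<open>auto intro!: continuous_on_compose2[of X _ K p] continuous_on_compose2[of Y _ K q]\<close>)
    qed
    show "(\<lambda>_. c) \<in> R" for c using R[of "\<lambda>_. c" "\<lambda>_. 1"] by simp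
    show "(\<lambda>x. f x + g x) \<in> R" if fg: "f \<in> R" "g \<in> R" for f g
    proof -
      obtain ps qs where "\<forall>(a, b)\<in>set ps. continuous_on X a \<and> continuous_on Y b"
        "f = (\<lambda>z. \<Sum>(a, b)\<leftarrow>ps. a (p z) * b (q z))"
        "\<forall>(a, b)\<in>set qs. continuous_on X a \<and> continuous_on Y b"
        "g = (\<lambda>z. \<Sum>(a, b)\<leftarrow>qs. a (p z) * b (q z))" using fg unfolding R_def by blast
      then show ?thesis unfolding R_def by (intro CollectI exI[of _ "ps @ qs"]) auto
    qed
    show "(\<lambda>x. f x * g x) \<in> R" if fg: "f \<in> R" "g \<in> R" for f g
    proof -
      obtain ps qs where ps: "\<forall>(a, b)\<in>set ps. continuous_on X a \<and> continuous_on Y b"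
        "f = (\<lambda>z. \<Sum>(a, b)\<leftarrow>ps. a (p z) * b (q z))"
        "\<forall>(a, b)\<in>set qs. continuous_on X a \<and> continuous_on Y b"
        "g = (\<lambda>z. \<Sum>(a, b)\<leftarrow>qs. a (p z) * b (q z))" using fg unfolding R_def by blast
      let ?rs = "map (\<lambda>((a, b), (a', b')). (\<lambda>x. a x * a' x, \<lambda>y. b y * b' y)) (List.product ps qs)"
      have "\<forall>(a, b)\<in>set ?rs. continuous_on X a \<and> continuous_on Y b"
        using ps(1,3) by (fastforce intro!: continuous_intros)
      moreover have "(\<lambda>x. f x * g x) = (\<lambda>z. \<Sum>(a, b)\<leftarrow>?rs. a (p z) * b (q z))"
        unfolding ps(2,4) sum_list_times_sum_list
        by (simp add: o_def split_beta mult.commute mult.left_commute mult.assoc)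
      ultimately show ?thesis unfolding R_def by blast
    qed
    show "\<exists>f\<in>R. f x \<noteq> f y" if "x \<in> K" "y \<in> K" "x \<noteq> y" for x y
    proof (cases "p x = p y")
      case False
      have "p x \<in> X" "p y \<in> X" using that p(2) by auto
      from continuous_functions_separate_points[OF X this False]
      obtain h :: "'x \<Rightarrow> real" where "continuous_on X h" "h (p x) \<noteq> h (p y)" .
      then show ?thesis using R[of h "\<lambda>_. 1"] by (intro bexI[of _ "\<lambda>z. h (p z) * 1"]) auto
    next
      case True
      then have "q x \<noteq> q y" using inj that by blast
      moreover have "q x \<in> Y" "q y \<in> Y" using that q(2) by auto
      ultimately obtain h :: "'y \<Rightarrow> real" where "continuous_on Y h" "h (q x) \<noteq> h (q y)"
        using continuous_functions_separate_points[OF Y] by metis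
      then show ?thesis using R[of "\<lambda>_. 1" h] by (intro bexI[of _ "\<lambda>z. 1 * h (q z)"]) auto
    qed
  qed
  obtain f where "f \<in> R" "\<And>z. z \<in> K \<Longrightarrow> \<bar>F z - f z\<bar> < e"
    using Stone_Weierstrass_basic[OF F e] by blast
  then show ?thesis unfolding R_def by blast
qed

lemma product_functions_dense:
  fixes F :: "'k::t2_space \<Rightarrow> complex"
    and p :: "'k \<Rightarrow> 'x::t2_space" and q :: "'k \<Rightarrow> 'y::t2_space"
  assumes K: "compact K" and X: "compact X" and Y: "compact Y"
    and p: "continuous_on K p" "p ` K \<subseteq> X" and q: "continuous_on K q" "q ` K \<subseteq> Y"
    and inj: "\<And>z w. z \<in> K \<Longrightarrow> w \<in> K \<Longrightarrow> p z = p w \<Longrightarrow> q z = q w \<Longrightarrow> z = w"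
    and F: "continuous_on K F" and e: "e > 0"
  shows "\<exists>ps. (\<forall>(a, b)\<in>set ps. continuous_on X a \<and> continuous_on Y b) \<and>
    (\<forall>z\<in>K. norm (F z - (\<Sum>(a, b)\<leftarrow>ps. a (p z) * b (q z))) < e)"
proof -
  have e2: "e / 2 > 0" using e by simp
  obtain ps where ps: "\<forall>(a, b)\<in>set ps. continuous_on X a \<and> continuous_on Y b"
    "\<And>z. z \<in> K \<Longrightarrow> \<bar>Re (F z) - (\<Sum>(a, b)\<leftarrow>ps. a (p z) * b (q z))\<bar> < e / 2"
    using product_functions_dense_real[OF K X Y p q inj continuous_on_Re[OF F] e2] by blast
  obtain qs where qs: "\<forall>(a, b)\<in>set qs. continuous_on X a \<and> continuous_on Y b"
    "\<And>z. z \<in> K \<Longrightarrow> \<bar>Im (F z) - (\<Sum>(a, b)\<leftarrow>qs. a (p z) * b (q z))\<bar> < e / 2"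
    using product_functions_dense_real[OF K X Y p q inj continuous_on_Im[OF F] e2] by blast
  let ?c = "\<lambda>u. map (\<lambda>(a, b). (\<lambda>x. u * complex_of_real (a x), \<lambda>y. complex_of_real (b y)))"
  have sum: "(\<Sum>(a, b)\<leftarrow>?c u rs. a (p z) * b (q z)) = u * complex_of_real (\<Sum>(a, b)\<leftarrow>rs. a (p z) * b (q z))" for u rs z
    by (induction rs) (auto simp: algebra_simps)
  have "norm (F z - (\<Sum>(a, b)\<leftarrow>?c 1 ps @ ?c \<i> qs. a (p z) * b (q z))) < e" if "z \<in> K" for z
    unfolding map_append sum_list.append sum
    by (rule le_less_trans[OF cmod_le]) (use ps(2)[OF that] qs(2)[OF that] in simp)
  moreover have "\<forall>(a, b)\<in>set (?c 1 ps @ ?c \<i> qs). continuous_on X a \<and> continuous_on Y b"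
    using ps(1) qs(1) by (fastforce intro!: continuous_intros)
  ultimately show ?thesis by blast
qed

context compact_group
begin

named_theorems C_intros

lemma C_basic [C_intros]:
  "(\<lambda>_. c) \<in> C"
  "f \<in> C \<Longrightarrow> k \<in> C \<Longrightarrow> (\<lambda>x. f x + k x) \<in> C"
  "f \<in> C \<Longrightarrow> k \<in> C \<Longrightarrow> (\<lambda>x. f x - k x) \<in> C"
  "f \<in> C \<Longrightarrow> k \<in> C \<Longrightarrow> (\<lambda>x. f x * k x) \<in> C"
  "f \<in> C \<Longrightarrow> (\<lambda>x. cnj (f x)) \<in> C"
  "f \<in> C \<Longrightarrow> (\<lambda>x. - f x) \<in> C"
  "f \<in> C \<Longrightarrow> (\<lambda>x. f x / c) \<in> C"
  by (auto intro!: continuous_intros simp: divide_inverse C_iff)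

lemma C_sum [C_intros]: "(\<And>i. i \<in> I \<Longrightarrow> f i \<in> C) \<Longrightarrow> (\<lambda>x. \<Sum>i\<in>I. f i x) \<in> C"
  by (auto intro!: continuous_intros simp: C_iff)

lemma C_sum_list [C_intros]: "(\<And>i. i \<in> set I \<Longrightarrow> f i \<in> C) \<Longrightarrow> (\<lambda>x. \<Sum>i\<leftarrow>I. f i x) \<in> C"
  by (auto intro!: continuous_on_sum_list simp: C_iff)

lemma C_translate:
  assumes "f \<in> C"
  shows "(\<lambda>x. f (x + h)) \<in> C" "(\<lambda>x. f (h + x)) \<in> C" "(\<lambda>x. f (- x)) \<in> C" "(\<lambda>x. f (x - h)) \<in> C" "(\<lambda>x. f (h - x)) \<in> C"
  by (intro CI C_parts[OF assms] continuous_intros)+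

lemma C_bounded: assumes "f \<in> C" obtains B where "B > 0" "\<And>x. norm (f x) \<le> B"
proof -
  have "bounded (f ` UNIV)"
    using assms by (intro compact_imp_bounded compact_continuous_image compact_UNIV) (auto simp: C_iff)
  then show thesis using that by (auto simp: bounded_pos)
qed

lemma haar_diff: "f \<in> C \<Longrightarrow> k \<in> C \<Longrightarrow> haar (\<lambda>x. f x - k x) = haar f - haar k"
  using haar_add[of f "\<lambda>x. - 1 * k x"] haar_cmult[of k "-1"] by (simp add: C_intros)

lemma haar_sum: "(\<And>i. i \<in> I \<Longrightarrow> f i \<in> C) \<Longrightarrow> haar (\<lambda>x. \<Sum>i\<in>I. f i x) = (\<Sum>i\<in>I. haar (f i))"
proof (induction I rule: infinite_finite_induct)
  case (insert i I)
  then show ?case by (subst sum.insert) (auto simp: haar_add C_sum)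
qed auto

lemma haar_sum_list: "(\<And>i. i \<in> set I \<Longrightarrow> f i \<in> C) \<Longrightarrow> haar (\<lambda>x. \<Sum>i\<leftarrow>I. f i x) = (\<Sum>i\<leftarrow>I. haar (f i))"
  by (induction I) (auto simp: haar_add C_sum_list)

lemma haar_linear_combination:
  "(\<And>p. p \<in> set ps \<Longrightarrow> v p \<in> C) \<Longrightarrow> haar (\<lambda>y. \<Sum>p\<leftarrow>ps. c p * v p y) = (\<Sum>p\<leftarrow>ps. c p * haar (v p))"
  by (subst haar_sum_list) (auto intro!: C_intros arg_cong[of _ _ sum_list] haar_cmult)

lemma haar_diff_le:
  assumes "f \<in> C" "k \<in> C" "\<And>x. norm (f x - k x) \<le> e"
  shows "norm (haar f - haar k) \<le> e"
  using haar_le[of "\<lambda>x. f x - k x" e] assms by (simp add: haar_diff C_intros)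

lemma C_slice: "continuous_on (S \<times> UNIV) F \<Longrightarrow> x \<in> S \<Longrightarrow> (\<lambda>g. F (x, g)) \<in> C"
  by (auto intro!: continuous_on_compose2[of "S \<times> UNIV" F] continuous_intros simp: C_iff)

text \<open>Compactness of the group makes \<open>F (y, g)\<close> close to \<open>F (x, g)\<close>
  uniformly in \<open>g\<close>, and the mean does not enlarge uniform distances.\<close>

lemma continuous_on_haar:
  fixes F :: "'a::topological_space \<times> 'g \<Rightarrow> complex"
  assumes F: "continuous_on (S \<times> UNIV) F"
  shows "continuous_on S (\<lambda>x. haar (\<lambda>g. F (x, g)))"
  unfolding continuous_on_def
proof (intro ballI tendstoI)
  fix x and e :: real assume x: "x \<in> S" and e: "e > 0"
  obtain U where U: "x \<in> U" "open U" "\<forall>y\<in>U \<inter> S. \<forall>t\<in>UNIV. dist (F (y, t)) (F (x, t)) \<le> e / 2"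
    by (rule continuous_on_prod_compactE[OF F compact_UNIV x, of "e/2"]) (use e in auto)
  have "dist (haar (\<lambda>g. F (y, g))) (haar (\<lambda>g. F (x, g))) < e" if "y \<in> U" "y \<in> S" for y
    using haar_diff_le[OF C_slice[OF F that(2)] C_slice[OF F x], of "e/2"] U(3) that e
    by (auto simp: dist_norm)
  then show "\<forall>\<^sub>F y in at x within S. dist (haar (\<lambda>g. F (y, g))) (haar (\<lambda>g. F (x, g))) < e"
    unfolding eventually_at_topological using U by blast
qed

text \<open>Both iterated means are linear, do not enlarge uniform distances and agree on sums of
  products, which are uniformly dense.\<close>

lemma haar_Fubini:
  fixes F :: "'g \<times> 'g \<Rightarrow> complex"
  assumes F: "continuous_on UNIV F"
  shows "haar (\<lambda>x. haar (\<lambda>y. F (x, y))) = haar (\<lambda>y. haar (\<lambda>x. F (x, y)))"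
proof -
  have F': "continuous_on (UNIV \<times> UNIV) F" "continuous_on (UNIV \<times> UNIV) (\<lambda>p. F (snd p, fst p))"
    using F by (auto intro!: continuous_on_compose2[OF F] continuous_intros)
  have "norm (haar (\<lambda>x. haar (\<lambda>y. F (x, y))) - haar (\<lambda>y. haar (\<lambda>x. F (x, y)))) \<le> 0"
  proof (rule field_le_epsilon)
    fix e :: real assume e: "e > 0"
    have "\<exists>ps. (\<forall>(a, b)\<in>set ps. continuous_on UNIV a \<and> continuous_on UNIV b) \<and>
        (\<forall>z\<in>UNIV \<times> UNIV. norm (F z - (\<Sum>(a, b)\<leftarrow>ps. a (fst z) * b (snd z))) < e / 2)"
      by (rule product_functions_dense[OF compact_Times[OF compact_UNIV compact_UNIV] compact_UNIV compact_UNIV])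
        (use F e in \<open>auto intro: continuous_on_fst continuous_on_snd\<close>)
    then obtain ps where ps: "\<forall>(a, b)\<in>set ps. continuous_on UNIV a \<and> continuous_on UNIV b"
      "\<And>z. norm (F z - (\<Sum>(a, b)\<leftarrow>ps. a (fst z) * b (snd z))) < e / 2" by auto
    have ps': "fst p \<in> C" "snd p \<in> C" if "p \<in> set ps" for p using ps(1) that by (auto simp: C_iff)
    define P where "P = (\<lambda>x y. \<Sum>p\<leftarrow>ps. fst p x * snd p y)"
    have PC: "(\<lambda>y. P x y) \<in> C" "(\<lambda>y. P y x) \<in> C" for x
      unfolding P_def by (intro C_intros ps'; assumption)+
    have P1: "haar (\<lambda>y. P x y) = (\<Sum>p\<leftarrow>ps. haar (snd p) * fst p x)" for x
      unfolding P_def using haar_linear_combination[of ps snd "\<lambda>p. fst p x"] ps'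
      by (simp add: mult.commute)
    have P2: "haar (\<lambda>y. P y x) = (\<Sum>p\<leftarrow>ps. haar (fst p) * snd p x)" for x
      unfolding P_def using haar_linear_combination[of ps fst "\<lambda>p. snd p x"] ps'
      by (simp add: mult.commute)
    have P12: "haar (\<lambda>x. haar (\<lambda>y. P x y)) = (\<Sum>p\<leftarrow>ps. haar (fst p) * haar (snd p))"
      unfolding P1 using haar_linear_combination[of ps fst "\<lambda>p. haar (snd p)"] ps'
      by (simp add: mult.commute)
    have P21: "haar (\<lambda>x. haar (\<lambda>y. P y x)) = (\<Sum>p\<leftarrow>ps. haar (fst p) * haar (snd p))"
      unfolding P2 using haar_linear_combination[of ps snd "\<lambda>p. haar (fst p)"] ps' by simp
    have P12C: "(\<lambda>x. haar (\<lambda>y. P x y)) \<in> C" "(\<lambda>x. haar (\<lambda>y. P y x)) \<in> C"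
      unfolding P1 P2 by (intro C_intros ps'; assumption)+
    have near: "norm (F (x, y) - P x y) \<le> e / 2" for x y using ps(2)[of "(x, y)"] by (simp add: P_def case_prod_unfold)
    have "norm (haar (\<lambda>x. haar (\<lambda>y. F (x, y))) - haar (\<lambda>x. haar (\<lambda>y. P x y))) \<le> e / 2"
      using continuous_on_haar[OF F'(1)] C_slice[OF F'(1)]
      by (intro haar_diff_le P12C PC near) (auto simp: C_iff)
    moreover have "norm (haar (\<lambda>x. haar (\<lambda>y. F (y, x))) - haar (\<lambda>x. haar (\<lambda>y. P y x))) \<le> e / 2"
      using continuous_on_haar[OF F'(2)] C_slice[OF F'(2)]
      by (intro haar_diff_le P12C PC near) (auto simp: C_iff)
    ultimately show "norm (haar (\<lambda>x. haar (\<lambda>y. F (x, y))) - haar (\<lambda>y. haar (\<lambda>x. F (x, y)))) \<le> 0 + e"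
      unfolding P12 P21
      using norm_triangle_ineq4[of "haar (\<lambda>x. haar (\<lambda>y. F (x, y))) - (\<Sum>p\<leftarrow>ps. haar (fst p) * haar (snd p))"
         "haar (\<lambda>x. haar (\<lambda>y. F (y, x))) - (\<Sum>p\<leftarrow>ps. haar (fst p) * haar (snd p))"] by simp
  qed
  then show ?thesis by simp
qed

end

section \<open>Orthonormal families of continuous functions\<close>

context compact_group
begin

definition ip :: "('g \<Rightarrow> complex) \<Rightarrow> ('g \<Rightarrow> complex) \<Rightarrow> complex"
  where "ip f k = haar (\<lambda>x. f x * cnj (k x))"

definition sqnorm :: "('g \<Rightarrow> complex) \<Rightarrow> real"
  where "sqnorm f = Re (ip f f)"

lemma ip_add_left: "f \<in> C \<Longrightarrow> f' \<in> C \<Longrightarrow> k \<in> C \<Longrightarrow> ip (\<lambda>x. f x + f' x) k = ip f k + ip f' k"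
  by (simp add: ip_def distrib_right haar_add C_intros)

lemma ip_diff_left: "f \<in> C \<Longrightarrow> f' \<in> C \<Longrightarrow> k \<in> C \<Longrightarrow> ip (\<lambda>x. f x - f' x) k = ip f k - ip f' k"
  by (simp add: ip_def left_diff_distrib haar_diff C_intros)

lemma ip_cmult_left: "f \<in> C \<Longrightarrow> k \<in> C \<Longrightarrow> ip (\<lambda>x. c * f x) k = c * ip f k"
  by (simp add: ip_def mult.assoc haar_cmult C_intros)

lemma cnj_ip: "f \<in> C \<Longrightarrow> k \<in> C \<Longrightarrow> cnj (ip f k) = ip k f"
  by (simp add: ip_def mult.commute C_intros flip: haar_cnj)

lemma ip_cmult_right: "f \<in> C \<Longrightarrow> k \<in> C \<Longrightarrow> ip f (\<lambda>x. c * k x) = cnj c * ip f k"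
  unfolding ip_def using haar_cmult[of "\<lambda>x. f x * cnj (k x)" "cnj c"]
  by (simp add: C_intros mult.left_commute)

lemma ip_diff_right: "f \<in> C \<Longrightarrow> f' \<in> C \<Longrightarrow> k \<in> C \<Longrightarrow> ip k (\<lambda>x. f x - f' x) = ip k f - ip k f'"
  by (simp add: ip_def right_diff_distrib haar_diff C_intros)

lemma ip_sum_left: "(\<And>i. i \<in> I \<Longrightarrow> e i \<in> C) \<Longrightarrow> k \<in> C \<Longrightarrow> ip (\<lambda>x. \<Sum>i\<in>I. c i * e i x) k = (\<Sum>i\<in>I. c i * ip (e i) k)"
  unfolding ip_def sum_distrib_right
  by (subst haar_sum) (auto intro!: C_intros sum.cong simp: mult.assoc haar_cmult C_intros)

lemma ip_self: "f \<in> C \<Longrightarrow> ip f f = complex_of_real (sqnorm f)"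
  using cnj_ip[of f f] by (auto simp: sqnorm_def complex_eq_iff)

lemma sqnorm_nonneg: "f \<in> C \<Longrightarrow> sqnorm f \<ge> 0"
  unfolding sqnorm_def ip_def by (intro haar_ge C_intros) (auto simp: complex_mult_cnj)

lemma sqnorm_pos: "f \<in> C \<Longrightarrow> f x \<noteq> 0 \<Longrightarrow> sqnorm f > 0"
  unfolding sqnorm_def ip_def by (intro haar_pos[of _ x] C_intros) (auto simp: complex_mult_cnj complex_neq_0)

lemma sqnorm_le: "f \<in> C \<Longrightarrow> (\<And>x. norm (f x) \<le> B) \<Longrightarrow> sqnorm f \<le> B\<^sup>2"
proof -
  assume f: "f \<in> C" and B: "\<And>x. norm (f x) \<le> B"
  have "norm (haar (\<lambda>x. f x * cnj (f x))) \<le> B\<^sup>2"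
    using B power_mono[OF B] by (intro haar_le C_intros f) (auto simp: norm_mult power2_eq_square intro!: mult_mono intro: order_trans[OF norm_ge_zero B])
  then show ?thesis unfolding sqnorm_def ip_def
    using complex_Re_le_cmod order_trans by blast
qed

definition orthonormal :: "nat \<Rightarrow> (nat \<Rightarrow> 'g \<Rightarrow> complex) \<Rightarrow> bool"
  where "orthonormal n e \<longleftrightarrow> (\<forall>i<n. e i \<in> C) \<and> (\<forall>i<n. \<forall>j<n. ip (e i) (e j) = (if i = j then 1 else 0))"

lemma orthonormalD:
  "orthonormal n e \<Longrightarrow> i < n \<Longrightarrow> j < n \<Longrightarrow> ip (e i) (e j) = (if i = j then 1 else 0)"
  by (simp add: orthonormal_def)

lemma orthonormal_coeff:
  assumes "orthonormal n e" "j < n"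
  shows "ip (\<lambda>x. \<Sum>i<n. c i * e i x) (e j) = c j"
proof -
  have "ip (\<lambda>x. \<Sum>i<n. c i * e i x) (e j) = (\<Sum>i<n. c i * ip (e i) (e j))"
    using assms by (intro ip_sum_left) (auto simp: orthonormal_def)
  also have "\<dots> = (\<Sum>i<n. if i = j then c j else 0)"
    using assms by (intro sum.cong) (auto simp: orthonormal_def)
  finally show ?thesis using assms by simp
qed

lemma orthonormal_unique:
  assumes "orthonormal n e" "\<And>x. (\<Sum>i<n. c i * e i x) = (\<Sum>i<n. d i * e i x)" "j < n"
  shows "c j = d j"
  using orthonormal_coeff[OF assms(1,3), of c] orthonormal_coeff[OF assms(1,3), of d] assms(2) by simp

lemma Bessel:
  assumes e: "orthonormal n e" and f: "f \<in> C"
  shows "(\<Sum>i<n. (norm (ip f (e i)))\<^sup>2) \<le> sqnorm f"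
proof -
  define p where "p = (\<lambda>x. \<Sum>i<n. ip f (e i) * e i x)"
  define r where "r = (\<lambda>x. f x - p x)"
  have eC: "e i \<in> C" if "i < n" for i using e that by (auto simp: orthonormal_def)
  have p: "p \<in> C" unfolding p_def by (intro C_intros eC) auto
  have pe: "ip p (e i) = ip f (e i)" if "i < n" for i unfolding p_def by (rule orthonormal_coeff[OF e that])
  have pk: "ip p k = (\<Sum>i<n. ip f (e i) * cnj (ip k (e i)))" if "k \<in> C" for k
    unfolding p_def using that eC by (subst ip_sum_left) (auto simp: cnj_ip)
  define s where "s = (\<Sum>i<n. ip f (e i) * cnj (ip f (e i)))"
  have "s = complex_of_real (\<Sum>i<n. (norm (ip f (e i)))\<^sup>2)"
    unfolding s_def by (simp only: of_real_sum complex_norm_square)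
  moreover have pf: "ip p f = s" "ip p p = s" unfolding s_def by (auto simp: pk f p pe)
  moreover have "ip f p = cnj (ip p f)" using cnj_ip[OF p f] by simp
  ultimately have "ip r r = ip f f - complex_of_real (\<Sum>i<n. (norm (ip f (e i)))\<^sup>2)"
    unfolding r_def by (simp add: ip_diff_left ip_diff_right f p C_intros)
  moreover have "r \<in> C" unfolding r_def by (intro C_intros f p)
  ultimately show ?thesis using sqnorm_nonneg[of r] by (simp add: sqnorm_def)
qed

lemma normalize:
  assumes "f \<in> C" "f x \<noteq> 0"
  shows "ip (\<lambda>x. f x / complex_of_real (sqrt (sqnorm f))) (\<lambda>x. f x / complex_of_real (sqrt (sqnorm f))) = 1"
proof -
  have pos: "sqnorm f > 0" using assms sqnorm_pos by blast
  have s: "complex_of_real (sqrt (sqnorm f)) * complex_of_real (sqrt (sqnorm f)) = complex_of_real (sqnorm f)"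
    using pos by (simp flip: of_real_mult)
  let ?c = "inverse (complex_of_real (sqrt (sqnorm f)))"
  have "(\<lambda>x. ?c * f x) \<in> C" using assms by (intro C_intros)
  then have "ip (\<lambda>x. ?c * f x) (\<lambda>x. ?c * f x) = ?c * (cnj ?c * ip f f)"
    using assms by (simp add: ip_cmult_left ip_cmult_right)
  also have "\<dots> = inverse (complex_of_real (sqrt (sqnorm f)) * complex_of_real (sqrt (sqnorm f))) * ip f f"
    by (simp add: mult.assoc)
  also have "\<dots> = 1" unfolding s ip_self[OF assms(1)] using pos by simp
  finally show ?thesis by (simp only: divide_inverse mult.commute)
qed

text \<open>Bessel's inequality for the one-element family consisting of the normalised
  \<open>k\<close>.\<close>

lemma Cauchy_Schwarz:
  assumes f: "f \<in> C" and k: "k \<in> C"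
  shows "(norm (ip f k))\<^sup>2 \<le> sqnorm f * sqnorm k"
proof (cases "\<exists>x. k x \<noteq> 0")
  case False
  then have "ip f k = 0" by (simp add: ip_def)
  then show ?thesis using sqnorm_nonneg f k by simp
next
  case True
  then obtain x where x: "k x \<noteq> 0" by blast
  have pos: "sqnorm k > 0" using sqnorm_pos[OF k x] .
  let ?u = "\<lambda>x. k x / complex_of_real (sqrt (sqnorm k))"
  have "orthonormal 1 (\<lambda>_. ?u)"
    using normalize[OF k x] k by (auto simp: orthonormal_def C_intros)
  from Bessel[OF this f] have "(norm (ip f ?u))\<^sup>2 \<le> sqnorm f" by simp
  moreover have "ip f ?u = ip f k / complex_of_real (sqrt (sqnorm k))"
    using ip_cmult_right[OF f k, of "inverse (complex_of_real (sqrt (sqnorm k)))"]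
    by (simp add: divide_inverse mult.commute)
  ultimately show ?thesis using pos by (simp add: norm_divide power_divide field_simps)
qed

lemma subspace_intros:
  assumes "cfun.subspace S"
  shows "f \<in> S \<Longrightarrow> k \<in> S \<Longrightarrow> (\<lambda>x. f x + k x) \<in> S" "f \<in> S \<Longrightarrow> (\<lambda>x. c * f x) \<in> S"
    "f \<in> S \<Longrightarrow> k \<in> S \<Longrightarrow> (\<lambda>x. f x - k x) \<in> S" "f \<in> S \<Longrightarrow> (\<lambda>x. f x / c) \<in> S"
    "(\<And>i. i \<in> I \<Longrightarrow> e i \<in> S) \<Longrightarrow> (\<lambda>x. \<Sum>i\<in>I. b i * e i x) \<in> S"
proof -
  show "f \<in> S \<Longrightarrow> k \<in> S \<Longrightarrow> (\<lambda>x. f x + k x) \<in> S"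
    using cfun.subspace_add[OF assms, of f k] by (simp add: plus_fun_def)
  show sc: "f \<in> S \<Longrightarrow> (\<lambda>x. c * f x) \<in> S" for f c
    using cfun.subspace_scale[OF assms, of f c] by (simp add: fscale_def)
  show "f \<in> S \<Longrightarrow> k \<in> S \<Longrightarrow> (\<lambda>x. f x - k x) \<in> S"
    using cfun.subspace_diff[OF assms, of f k] by (simp add: fun_diff_def)
  show "f \<in> S \<Longrightarrow> (\<lambda>x. f x / c) \<in> S"
    using sc[of f "inverse c"] by (simp add: divide_inverse mult.commute)
  show "(\<And>i. i \<in> I \<Longrightarrow> e i \<in> S) \<Longrightarrow> (\<lambda>x. \<Sum>i\<in>I. b i * e i x) \<in> S"
  proof (induction I rule: infinite_finite_induct)
    case (insert i I)
    have "(\<lambda>x. b i * e i x) + (\<lambda>x. \<Sum>i\<in>I. b i * e i x) \<in> S"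
      using insert sc by (intro cfun.subspace_add[OF assms]) auto
    then show ?case using insert by (simp add: plus_fun_def)
  qed (use cfun.subspace_0[OF assms] in \<open>auto simp: zero_fun_def\<close>)
qed

text \<open>An orthonormal family of maximal length in \<open>S\<close> is a basis: the normalised
  remainder of a function outside its span would extend it. The bound \<open>N\<close> stands in for
  finite dimension, since for eigenspaces it comes from Bessel's inequality and not from a finite
  spanning set.\<close>

lemma orthonormal_basis:
  assumes S: "cfun.subspace S" "S \<subseteq> C"
    and bound: "\<And>n e. orthonormal n e \<Longrightarrow> (\<forall>i<n. e i \<in> S) \<Longrightarrow> n \<le> N"
  shows "\<exists>n\<le>N. \<exists>e. orthonormal n e \<and> (\<forall>i<n. e i \<in> S) \<and> (\<forall>f\<in>S. \<forall>x. f x = (\<Sum>i<n. ip f (e i) * e i x))"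
proof -
  define P where "P = (\<lambda>n. \<exists>e. orthonormal n e \<and> (\<forall>i<n. e i \<in> S))"
  define n where "n = Greatest P"
  have P0: "P 0" by (auto simp: P_def orthonormal_def)
  have le: "m \<le> N" if "P m" for m using bound that by (auto simp: P_def)
  have Pn: "P n" unfolding n_def by (rule GreatestI_nat[of P 0 N]) (use P0 le in auto)
  have max: "m \<le> n" if "P m" for m unfolding n_def by (rule Greatest_le_nat[of P m N]) (use that le in auto)
  obtain e where e: "orthonormal n e" "\<And>i. i < n \<Longrightarrow> e i \<in> S" using Pn by (auto simp: P_def)
  have "f x = (\<Sum>i<n. ip f (e i) * e i x)" if f: "f \<in> S" for f x
  proof (rule ccontr)
    assume neq: "f x \<noteq> (\<Sum>i<n. ip f (e i) * e i x)"
    define p where "p = (\<lambda>x. \<Sum>i<n. ip f (e i) * e i x)"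
    define r where "r = (\<lambda>x. f x - p x)"
    define u where "u = (\<lambda>x. r x / complex_of_real (sqrt (sqnorm r)))"
    have pS: "p \<in> S" unfolding p_def using e by (intro subspace_intros[OF S(1)]) auto
    have rS: "r \<in> S" unfolding r_def by (intro subspace_intros[OF S(1)] f pS)
    have uS: "u \<in> S" unfolding u_def by (intro subspace_intros[OF S(1)] rS)
    have CC: "p \<in> C" "r \<in> C" "u \<in> C" "f \<in> C" using pS rS uS f S(2) by auto
    have re: "ip r (e i) = 0" if "i < n" for i
      using orthonormal_coeff[OF e(1) that, of "\<lambda>i. ip f (e i)"] e(2)[OF that] S(2) CC
      unfolding r_def by (subst ip_diff_left) (auto simp: p_def)
    have ue: "ip u (e i) = 0" if "i < n" for i
      using ip_cmult_left[of r "e i" "inverse (complex_of_real (sqrt (sqnorm r)))"] re[OF that] e(2)[OF that] S(2) CC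
      by (auto simp: u_def divide_inverse mult.commute)
    have eu: "ip (e i) u = 0" if "i < n" for i
      using cnj_ip[of u "e i"] ue[OF that] e(2)[OF that] S(2) CC by auto
    have "r x \<noteq> 0" using neq by (simp add: r_def p_def)
    from normalize[OF CC(2) this] have uu: "ip u u = 1" by (simp add: u_def)
    have "orthonormal (Suc n) (e(n := u))"
      using e(1) uu ue eu CC unfolding orthonormal_def by (auto simp: less_Suc_eq)
    moreover have "\<forall>i<Suc n. (e(n := u)) i \<in> S" using e uS by (auto simp: less_Suc_eq)
    ultimately have "P (Suc n)" unfolding P_def by blast
    then show False using max[of "Suc n"] by simp
  qed
  then show ?thesis using e le[OF Pn] by blast
qed

lemma orthonormal_le_card:
  assumes T: "finite T" and e: "orthonormal n e" "\<And>i. i < n \<Longrightarrow> e i \<in> cfun.span T"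
  shows "n \<le> card T"
proof -
  have inj: "inj_on e {..<n}"
  proof (rule inj_onI, rule ccontr)
    fix i j assume ij: "i \<in> {..<n}" "j \<in> {..<n}" "e i = e j" "i \<noteq> j"
    then have "ip (e i) (e j) = 0" using orthonormalD[OF e(1), of i j] by simp
    moreover have "ip (e i) (e i) = 1" using ij(1) orthonormalD[OF e(1), of i i] by simp
    ultimately show False using ij(3) by simp
  qed
  have "cfun.independent (e ` {..<n})"
  proof
    assume "cfun.dependent (e ` {..<n})"
    then obtain u v where u: "v \<in> e ` {..<n}" "u v \<noteq> 0" "(\<Sum>w\<in>e ` {..<n}. fscale (u w) w) = 0"
      by (auto simp: cfun.dependent_finite)
    then obtain j where j: "j < n" "v = e j" by auto
    have "(\<Sum>i<n. u (e i) * e i x) = 0" for x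
    proof -
      have "(\<Sum>i<n. fscale (u (e i)) (e i)) x = 0"
        using u(3) by (simp add: sum.reindex[OF inj])
      moreover have "(\<Sum>i\<in>I. fscale (u (e i)) (e i)) x = (\<Sum>i\<in>I. u (e i) * e i x)" for I
        by (induction I rule: infinite_finite_induct) (auto simp: fscale_def)
      ultimately show ?thesis by simp
    qed
    then have "u (e j) = 0" using orthonormal_unique[OF e(1) _ j(1), of "\<lambda>i. u (e i)" "\<lambda>_. 0"] by simp
    then show False using u j by simp
  qed
  then have "card (e ` {..<n}) \<le> card T"
    using cfun.independent_span_bound[OF T, of "e ` {..<n}"] e(2) by auto
  then show ?thesis by (simp add: card_image[OF inj])
qed

lemma orthonormal_basis_span:
  assumes S: "cfun.subspace S" "S \<subseteq> C" and T: "finite T" "S \<subseteq> cfun.span T"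
  shows "\<exists>n\<le>card T. \<exists>e. orthonormal n e \<and> (\<forall>i<n. e i \<in> S) \<and> (\<forall>f\<in>S. \<forall>x. f x = (\<Sum>i<n. ip f (e i) * e i x))"
proof (rule orthonormal_basis[OF S])
  fix n e assume "orthonormal n e" "\<forall>i<n. e i \<in> S"
  then show "n \<le> card T" using T(2) by (intro orthonormal_le_card[OF T(1)]) auto
qed

lemma ip_right_translate: "f \<in> C \<Longrightarrow> k \<in> C \<Longrightarrow> ip (\<lambda>x. f (x + h)) (\<lambda>x. k (x + h)) = ip f k"
  unfolding ip_def by (rule haar_right_translate) (intro C_intros; assumption)

lemma C_ip_right_translate:
  assumes "f \<in> C" "k \<in> C" shows "(\<lambda>h. ip (\<lambda>x. f (x + h)) k) \<in> C"
proof -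
  have "continuous_on (UNIV \<times> UNIV) (\<lambda>p. f (snd p + fst p) * cnj (k (snd p)))"
    by (intro continuous_intros C_parts[OF assms(1)] C_parts[OF assms(2)])
  from continuous_on_haar[OF this] show ?thesis by (simp add: ip_def C_iff)
qed

end

section \<open>Representative functions\<close>

lemma span_closed_under_substitution:
  assumes "u \<in> cfun.span A" "\<And>a. a \<in> A \<Longrightarrow> (\<lambda>x. a (t x)) \<in> A"
  shows "(\<lambda>x. u (t x)) \<in> cfun.span A"
  using assms(1)
proof (induction rule: cfun.span_induct_alt)
  case base
  show ?case using cfun.span_zero[of A] by (simp add: zero_fun_def)
next
  case (step c v w)
  have "(\<lambda>x. (fscale c v + w) (t x)) = fscale c (\<lambda>x. v (t x)) + (\<lambda>x. w (t x))"
    by (simp add: fun_eq_iff fscale_def)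
  also have "\<dots> \<in> cfun.span A"
    by (intro cfun.span_add cfun.span_scale cfun.span_base assms(2) step)
  finally show ?case .
qed

lemma span_linear_combination:
  "(\<And>p. p \<in> set ps \<Longrightarrow> v p \<in> cfun.span A) \<Longrightarrow> (\<lambda>x. \<Sum>p\<leftarrow>ps. c p * v p x) \<in> cfun.span A"
proof (induction ps)
  case Nil
  show ?case using cfun.span_zero[of A] by (simp add: zero_fun_def)
next
  case (Cons p ps)
  have "(\<lambda>x. \<Sum>p\<leftarrow>p # ps. c p * v p x) = fscale (c p) (v p) + (\<lambda>x. \<Sum>p\<leftarrow>ps. c p * v p x)"
    by (simp add: fun_eq_iff fscale_def)
  also have "\<dots> \<in> cfun.span A"
    using Cons by (intro cfun.span_add cfun.span_scale) auto
  finally show ?case .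
qed

context compact_group
begin

text \<open>
  The continuous functions whose translates span a finite-dimensional space. Unlike for the span of
  the irreducible coefficients, closure under products and inversion is evident.
\<close>

definition RF :: "('g \<Rightarrow> complex) set"
  where "RF = {f \<in> C. \<exists>ps. (\<forall>p\<in>set ps. fst p \<in> C \<and> snd p \<in> C) \<and>
    (\<forall>g h. f (g + h) = (\<Sum>p\<leftarrow>ps. fst p g * snd p h))}"

lemma RFI:
  "f \<in> C \<Longrightarrow> (\<And>p. p \<in> set ps \<Longrightarrow> fst p \<in> C \<and> snd p \<in> C) \<Longrightarrow>
   (\<And>g h. f (g + h) = (\<Sum>p\<leftarrow>ps. fst p g * snd p h)) \<Longrightarrow> f \<in> RF"
  unfolding RF_def by blast

lemma RFE:
  assumes "f \<in> RF"
  obtains ps where "f \<in> C" "\<And>p. p \<in> set ps \<Longrightarrow> fst p \<in> C" "\<And>p. p \<in> set ps \<Longrightarrow> snd p \<in> C"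
    "\<And>g h. f (g + h) = (\<Sum>p\<leftarrow>ps. fst p g * snd p h)"
  using assms unfolding RF_def by blast

lemma RF_sumI:
  fixes n :: nat
  assumes "f \<in> C" "\<And>i. i < n \<Longrightarrow> a i \<in> C" "\<And>i. i < n \<Longrightarrow> b i \<in> C"
    "\<And>g h. f (g + h) = (\<Sum>i<n. a i g * b i h)"
  shows "f \<in> RF"
  by (rule RFI[where ps = "map (\<lambda>i. (a i, b i)) [0..<n]"])
    (use assms in \<open>auto simp: o_def sum_list_distinct_conv_sum_set atLeast0LessThan\<close>)

lemma RF_cmult: assumes "f \<in> RF" shows "(\<lambda>x. c * f x) \<in> RF"
proof -
  from assms obtain ps where ps: "f \<in> C" "\<And>p. p \<in> set ps \<Longrightarrow> fst p \<in> C" "\<And>p. p \<in> set ps \<Longrightarrow> snd p \<in> C"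
    "\<And>g h. f (g + h) = (\<Sum>p\<leftarrow>ps. fst p g * snd p h)" by (rule RFE) blast
  show ?thesis
    by (rule RFI[where ps = "map (\<lambda>p. (\<lambda>x. c * fst p x, snd p)) ps"])
      (use ps in \<open>auto intro!: C_intros simp: o_def mult.assoc sum_list_const_mult\<close>)
qed

lemma RF_add: assumes "f \<in> RF" "k \<in> RF" shows "(\<lambda>x. f x + k x) \<in> RF"
proof -
  from assms(1) obtain ps where ps: "f \<in> C" "\<And>p. p \<in> set ps \<Longrightarrow> fst p \<in> C" "\<And>p. p \<in> set ps \<Longrightarrow> snd p \<in> C"
    "\<And>g h. f (g + h) = (\<Sum>p\<leftarrow>ps. fst p g * snd p h)" by (rule RFE) blast
  from assms(2) obtain qs where qs: "k \<in> C" "\<And>p. p \<in> set qs \<Longrightarrow> fst p \<in> C" "\<And>p. p \<in> set qs \<Longrightarrow> snd p \<in> C"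
    "\<And>g h. k (g + h) = (\<Sum>p\<leftarrow>qs. fst p g * snd p h)" by (rule RFE) blast
  show ?thesis
    by (rule RFI[where ps = "ps @ qs"]) (use ps qs in \<open>auto intro!: C_intros\<close>)
qed

lemma RF_mult: assumes "f \<in> RF" "k \<in> RF" shows "(\<lambda>x. f x * k x) \<in> RF"
proof -
  from assms(1) obtain ps where ps: "f \<in> C" "\<And>p. p \<in> set ps \<Longrightarrow> fst p \<in> C" "\<And>p. p \<in> set ps \<Longrightarrow> snd p \<in> C"
    "\<And>g h. f (g + h) = (\<Sum>p\<leftarrow>ps. fst p g * snd p h)" by (rule RFE) blast
  from assms(2) obtain qs where qs: "k \<in> C" "\<And>p. p \<in> set qs \<Longrightarrow> fst p \<in> C" "\<And>p. p \<in> set qs \<Longrightarrow> snd p \<in> C"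
    "\<And>g h. k (g + h) = (\<Sum>p\<leftarrow>qs. fst p g * snd p h)" by (rule RFE) blast
  let ?rs = "map (\<lambda>p. (\<lambda>x. fst (fst p) x * fst (snd p) x, \<lambda>x. snd (fst p) x * snd (snd p) x)) (List.product ps qs)"
  show ?thesis
  proof (rule RFI[where ps = ?rs])
    show "(\<lambda>x. f x * k x) \<in> C" by (intro C_intros ps qs)
    show "fst p \<in> C \<and> snd p \<in> C" if "p \<in> set ?rs" for p
      using that ps qs by (auto intro!: C_intros)
    show "f (g + h) * k (g + h) = (\<Sum>p\<leftarrow>?rs. fst p g * snd p h)" for g h
      unfolding ps(4) qs(4) sum_list_times_sum_list by (simp add: o_def mult_ac)
  qed
qed

lemma RF_reflect: assumes "f \<in> RF" shows "(\<lambda>x. f (- x)) \<in> RF"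
proof -
  from assms obtain ps where ps: "f \<in> C" "\<And>p. p \<in> set ps \<Longrightarrow> fst p \<in> C" "\<And>p. p \<in> set ps \<Longrightarrow> snd p \<in> C"
    "\<And>g h. f (g + h) = (\<Sum>p\<leftarrow>ps. fst p g * snd p h)" by (rule RFE) blast
  show ?thesis
    \<comment> \<open>Inversion reverses the order of a sum, so the two factors trade
      places.\<close>
    by (rule RFI[where ps = "map (\<lambda>p. (\<lambda>x. snd p (- x), \<lambda>x. fst p (- x))) ps"])
      (use ps(1-3) ps(4)[of "- _" "- _"] in \<open>auto intro!: C_translate(3) simp: o_def minus_add mult.commute\<close>)
qed

lemma RF_left_translate: assumes "f \<in> RF" shows "(\<lambda>x. f (k + x)) \<in> RF"
proof -
  from assms obtain ps where ps: "f \<in> C" "\<And>p. p \<in> set ps \<Longrightarrow> fst p \<in> C" "\<And>p. p \<in> set ps \<Longrightarrow> snd p \<in> C"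
    "\<And>g h. f (g + h) = (\<Sum>p\<leftarrow>ps. fst p g * snd p h)" by (rule RFE) blast
  show ?thesis
    by (rule RFI[where ps = "map (\<lambda>p. (\<lambda>x. fst p (k + x), snd p)) ps"])
      (use ps(1-3) ps(4)[of "k + _"] in \<open>auto intro!: C_translate(2) simp: o_def simp flip: add.assoc\<close>)
qed

lemma RF_const: "(\<lambda>_. c) \<in> RF"
  by (rule RFI[where ps = "[(\<lambda>_. c, \<lambda>_. 1)]"]) (auto intro: C_intros)

lemma subspace_RF: "cfun.subspace RF"
  unfolding cfun.subspace_def
  using RF_const[of 0] RF_add RF_cmult by (auto simp: plus_fun_def zero_fun_def fscale_def)

lemma RF_sub_C: "f \<in> RF \<Longrightarrow> f \<in> C"
  by (simp add: RF_def)

section \<open>Matrix representations and complete reducibility\<close>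

definition matrix_rep :: "nat \<Rightarrow> (nat \<Rightarrow> nat \<Rightarrow> 'g \<Rightarrow> complex) \<Rightarrow> bool"
  where "matrix_rep n l \<longleftrightarrow> (\<forall>i<n. \<forall>j<n. l i j \<in> C) \<and>
    (\<forall>i<n. \<forall>j<n. l i j 0 = (if i = j then 1 else 0)) \<and>
    (\<forall>i<n. \<forall>j<n. \<forall>g h. l i j (g + h) = (\<Sum>k<n. l i k g * l k j h))"

lemma matrix_rep_RF: "matrix_rep n l \<Longrightarrow> i < n \<Longrightarrow> j < n \<Longrightarrow> l i j \<in> RF"
  by (rule RF_sumI[where n = n and a = "\<lambda>k. l i k" and b = "\<lambda>k. l k j"]) (auto simp: matrix_rep_def)

lemma matrix_rep_of_continuous_rep:
  assumes "continuous_rep n \<rho>"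
  shows "matrix_rep n (\<lambda>i j g. \<rho> g $$ (i, j))"
proof -
  have \<rho>: "\<And>g. \<rho> g \<in> carrier_mat n n" using assms by (auto simp: continuous_rep_def)
  have "\<rho> (g + h) $$ (i, j) = (\<Sum>k<n. \<rho> g $$ (i, k) * \<rho> h $$ (k, j))" if "i < n" "j < n" for g h i j
  proof -
    have "\<rho> (g + h) $$ (i, j) = (\<rho> g * \<rho> h) $$ (i, j)" using assms by (simp add: continuous_rep_def)
    also have "\<dots> = (\<Sum>k = 0..<n. \<rho> g $$ (i, k) * \<rho> h $$ (k, j))"
      using that \<rho>[of g] \<rho>[of h] by (simp add: scalar_prod_def)
    finally show ?thesis by (simp add: atLeast0LessThan)
  qed
  then show ?thesis using assms unfolding matrix_rep_def continuous_rep_def C_iff by simp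
qed

lemma representative_funs_sub_RF: "representative_funs \<subseteq> RF"
  unfolding representative_funs_def
proof (rule cfun.span_minimal[OF _ subspace_RF], safe)
  fix n i j and \<rho> :: "'g \<Rightarrow> complex mat"
  assume "irreducible_rep n \<rho>" and ij: "i < n" "j < n"
  then have "matrix_rep n (\<lambda>i j g. \<rho> g $$ (i, j))"
    by (intro matrix_rep_of_continuous_rep) (simp add: irreducible_rep_def)
  from matrix_rep_RF[OF this ij] show "(\<lambda>g. \<rho> g $$ (i, j)) \<in> RF" .
qed

lemma subspace_representative_funs: "cfun.subspace (representative_funs :: ('g \<Rightarrow> complex) set)"
  unfolding representative_funs_def by (rule cfun.subspace_span)

lemma continuous_rep_of_matrix_rep:
  assumes "matrix_rep n l"
  shows "continuous_rep n (\<lambda>g. mat n n (\<lambda>(i, j). l i j g))"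
proof -
  have "mat n n (\<lambda>(i, j). l i j (g + h)) = mat n n (\<lambda>(i, j). l i j g) * mat n n (\<lambda>(i, j). l i j h)" for g h
    using assms by (intro eq_matI) (auto simp: matrix_rep_def scalar_prod_def atLeast0LessThan)
  moreover have "mat n n (\<lambda>(i, j). l i j 0) = 1\<^sub>m n"
    using assms by (intro eq_matI) (auto simp: matrix_rep_def)
  ultimately show ?thesis using assms by (auto simp: continuous_rep_def matrix_rep_def C_iff)
qed

text \<open>Multiplicativity results from expanding \<open>e j (g + h + k)\<close> in two ways and
  comparing coefficients. Column \<open>j\<close> describes the translate of \<open>e j\<close>,
  which makes the matrices multiply in the order of the group elements.\<close>

lemma right_matrix_rep:
  assumes e: "orthonormal n e"
    and inv: "\<And>j g h. j < n \<Longrightarrow> e j (g + h) = (\<Sum>i<n. ip (\<lambda>x. e j (x + h)) (e i) * e i g)"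
  shows "matrix_rep n (\<lambda>i j h. ip (\<lambda>x. e j (x + h)) (e i))"
  unfolding matrix_rep_def
proof (intro conjI allI impI)
  have eC: "e i \<in> C" if "i < n" for i using e that by (auto simp: orthonormal_def)
  fix i j assume ij: "i < n" "j < n"
  show "(\<lambda>h. ip (\<lambda>x. e j (x + h)) (e i)) \<in> C" using ij by (intro C_ip_right_translate eC)
  show "ip (\<lambda>x. e j (x + 0)) (e i) = (if i = j then 1 else 0)" using e ij by (auto simp: orthonormal_def)
  fix h k
  let ?\<rho> = "\<lambda>i j h. ip (\<lambda>x. e j (x + h)) (e i)"
  have "(\<Sum>i<n. ?\<rho> i j (h + k) * e i g) = (\<Sum>i<n. (\<Sum>l<n. ?\<rho> i l h * ?\<rho> l j k) * e i g)" for g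
  proof -
    have "(\<Sum>i<n. ?\<rho> i j (h + k) * e i g) = e j (g + h + k)" using inv[OF ij(2), of g "h + k"] by (simp add: add.assoc)
    also have "\<dots> = (\<Sum>l<n. ?\<rho> l j k * e l (g + h))" by (rule inv[OF ij(2)])
    also have "\<dots> = (\<Sum>l<n. ?\<rho> l j k * (\<Sum>i<n. ?\<rho> i l h * e i g))" by (intro sum.cong refl arg_cong2[of _ _ _ _ "(*)"] inv) auto
    also have "\<dots> = (\<Sum>l<n. \<Sum>i<n. ?\<rho> i l h * ?\<rho> l j k * e i g)" by (simp add: sum_distrib_left mult_ac)
    also have "\<dots> = (\<Sum>i<n. \<Sum>l<n. ?\<rho> i l h * ?\<rho> l j k * e i g)" by (rule sum.swap)
    finally show ?thesis by (simp add: sum_distrib_right)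
  qed
  from orthonormal_unique[OF e this ij(1)]
  show "?\<rho> i j (h + k) = (\<Sum>l<n. ?\<rho> i l h * ?\<rho> l j k)" .
qed

text \<open>
  If the representation on the span of \<open>e\<close> is irreducible, its coefficients span the \<open>e j\<close>, as
  evaluation at \<open>0\<close> shows. Otherwise the span is the sum of an invariant subspace \<open>V1\<close> and its
  orthogonal complement \<open>V2\<close>, both of smaller dimension.
\<close>

lemma invariant_orthonormal_sub_representative_funs:
  assumes "orthonormal n e"
    and "\<And>j g h. j < n \<Longrightarrow> e j (g + h) = (\<Sum>i<n. ip (\<lambda>x. e j (x + h)) (e i) * e i g)"
    and "j < n"
  shows "e j \<in> representative_funs"
  using assms
proof (induction n arbitrary: e j rule: less_induct)
  case (less n)
  note e = less.prems(1) and inv = less.prems(2)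
  define \<rho> where "\<rho> = (\<lambda>i j h. ip (\<lambda>x. e j (x + h)) (e i))"
  have inv': "e j (g + h) = (\<Sum>i<n. \<rho> i j h * e i g)" if "j < n" for j g h
    unfolding \<rho>_def by (rule inv[OF that])
  have \<rho>: "matrix_rep n \<rho>" unfolding \<rho>_def by (rule right_matrix_rep[OF e inv])
  define R where "R = (\<lambda>g. mat n n (\<lambda>(i, j). \<rho> i j g))"
  have R: "continuous_rep n R" unfolding R_def by (rule continuous_rep_of_matrix_rep[OF \<rho>])
  have eC: "e i \<in> C" if "i < n" for i using e that by (auto simp: orthonormal_def)
  note sub = subspace_intros[OF subspace_representative_funs]
  show ?case
  proof (cases "irreducible_rep n R")
    case True
    have "\<rho> i j \<in> representative_funs" if "i < n" "j < n" for i j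
    proof -
      have "(\<lambda>g. R g $$ (i, j)) \<in> representative_funs"
        unfolding representative_funs_def using True that by (intro cfun.span_base) blast
      then show ?thesis using that by (simp add: R_def)
    qed
    then have "(\<lambda>g. \<Sum>i<n. e i 0 * \<rho> i j g) \<in> representative_funs"
      using less.prems(3) by (intro sub(5)) auto
    moreover have "e j = (\<lambda>g. \<Sum>i<n. e i 0 * \<rho> i j g)"
      using inv'[OF less.prems(3), of 0] by (auto simp: fun_eq_iff mult.commute)
    ultimately show ?thesis by simp
  next
    case False
    then obtain W where W: "vec_subspace n W" "\<And>g w. w \<in> W \<Longrightarrow> R g *\<^sub>v w \<in> W"
      "W \<noteq> {0\<^sub>v n}" "W \<noteq> carrier_vec n"
      using R less.prems(3) unfolding irreducible_rep_def by fastforce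
    have WC: "w \<in> carrier_vec n" if "w \<in> W" for w using W(1) that by (auto simp: vec_subspace_def)
    define comb where "comb = (\<lambda>w x. \<Sum>i<n. vec_index w i * e i x)"
    \<comment> \<open>The span of the \<open>e i\<close>, described by the expansion that its
      members satisfy, so that membership yields the coefficients at once.\<close>
    define V where "V = {f \<in> C. \<forall>x. f x = (\<Sum>i<n. ip f (e i) * e i x)}"
    define V1 where "V1 = comb ` W"
    define V2 where "V2 = {f \<in> V. \<forall>v\<in>V1. ip f v = 0}"
    have VI: "(\<lambda>x. \<Sum>i<n. c i * e i x) \<in> V" for c
      unfolding V_def using orthonormal_coeff[OF e, of _ c] by (auto intro!: C_intros eC)
    have VC: "f \<in> C" if "f \<in> V" for f using that by (simp add: V_def)
    have V1V: "V1 \<subseteq> V" unfolding V1_def comb_def using VI by blast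
    have comb_trans: "comb w (g + h) = comb (R h *\<^sub>v w) g" if "w \<in> W" for w g h
    proof -
      have "comb w (g + h) = (\<Sum>j<n. vec_index w j * (\<Sum>i<n. \<rho> i j h * e i g))"
        unfolding comb_def by (intro sum.cong refl arg_cong2[of _ _ _ _ "(*)"] inv') auto
      also have "\<dots> = (\<Sum>j<n. \<Sum>i<n. \<rho> i j h * vec_index w j * e i g)" by (simp add: sum_distrib_left mult_ac)
      also have "\<dots> = (\<Sum>i<n. \<Sum>j<n. \<rho> i j h * vec_index w j * e i g)" by (rule sum.swap)
      also have "\<dots> = comb (R h *\<^sub>v w) g"
        unfolding comb_def using WC[OF that]
        by (intro sum.cong refl) (auto simp: R_def scalar_prod_def atLeast0LessThan sum_distrib_right)
      finally show ?thesis .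
    qed
    have V1inv: "(\<lambda>x. f (x + h)) \<in> V1" if "f \<in> V1" for f h
      using that comb_trans W(2) unfolding V1_def by (auto simp: image_iff fun_eq_iff)
    have V1sub: "cfun.subspace V1"
    proof -
      have "comb (0\<^sub>v n) = 0" by (auto simp: comb_def fun_eq_iff)
      moreover have "comb v + comb w = comb (v + w)" if "v \<in> W" "w \<in> W" for v w
        using WC[OF that(1)] WC[OF that(2)]
        by (auto simp: comb_def fun_eq_iff sum.distrib[symmetric] distrib_right intro!: sum.cong)
      moreover have "fscale c (comb v) = comb (c \<cdot>\<^sub>v v)" if "v \<in> W" for c v
        using WC[OF that] by (auto simp: comb_def fscale_def fun_eq_iff sum_distrib_left intro!: sum.cong)
      ultimately show ?thesis
        using W(1) unfolding V1_def cfun.subspace_def vec_subspace_def by (auto simp: image_iff)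
    qed
    have Vsub: "cfun.subspace V"
    proof -
      have VE: "f x = (\<Sum>i<n. ip f (e i) * e i x)" if "f \<in> V" for f x
        using that unfolding V_def by blast
      have Vadd: "(\<lambda>x. f x + k x) \<in> V" if "f \<in> V" "k \<in> V" for f k
      proof -
        have "(\<lambda>x. f x + k x) = (\<lambda>x. \<Sum>i<n. (ip f (e i) + ip k (e i)) * e i x)"
          using VE[OF that(1)] VE[OF that(2)] by (simp only: distrib_right sum.distrib)
        then show ?thesis using VI by simp
      qed
      have Vmul: "(\<lambda>x. c * f x) \<in> V" if "f \<in> V" for c f
      proof -
        have "(\<lambda>x. c * f x) = (\<lambda>x. \<Sum>i<n. (c * ip f (e i)) * e i x)"
          using VE[OF that] by (simp only: sum_distrib_left mult.assoc)
        then show ?thesis using VI by simp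
      qed
      have "(\<lambda>x. 0) \<in> V" using VI[of "\<lambda>_. 0"] by simp
      then show ?thesis
        using Vadd Vmul unfolding cfun.subspace_def plus_fun_def zero_fun_def fscale_def by auto
    qed
    have V2sub: "cfun.subspace V2"
      unfolding cfun.subspace_def
    proof (intro conjI ballI allI)
      show "0 \<in> V2" using cfun.subspace_0[OF Vsub] by (auto simp: V2_def ip_def)
      fix f assume f: "f \<in> V2"
      show "f + k \<in> V2" if "k \<in> V2" for k
        using f that cfun.subspace_add[OF Vsub, of f k] VC V1V ip_add_left[of f k]
        by (auto simp: V2_def plus_fun_def subset_iff)
      show "fscale c f \<in> V2" for c
        using f cfun.subspace_scale[OF Vsub, of f c] VC V1V
        by (auto simp: V2_def fscale_def subset_iff ip_cmult_left)
    qed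
    have Vinv: "(\<lambda>x. f (x + h)) \<in> V" if "f \<in> V" for f h
    proof -
      have "f (g + h) = (\<Sum>i<n. (\<Sum>j<n. ip f (e j) * \<rho> i j h) * e i g)" for g
      proof -
        have "f (g + h) = (\<Sum>j<n. ip f (e j) * e j (g + h))" using that by (simp add: V_def)
        also have "\<dots> = (\<Sum>j<n. ip f (e j) * (\<Sum>i<n. \<rho> i j h * e i g))"
          by (intro sum.cong refl arg_cong2[of _ _ _ _ "(*)"] inv') auto
        also have "\<dots> = (\<Sum>j<n. \<Sum>i<n. ip f (e j) * \<rho> i j h * e i g)" by (simp add: sum_distrib_left mult_ac)
        also have "\<dots> = (\<Sum>i<n. \<Sum>j<n. ip f (e j) * \<rho> i j h * e i g)" by (rule sum.swap)
        finally show ?thesis by (simp add: sum_distrib_right)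
      qed
      then have "(\<lambda>x. f (x + h)) = (\<lambda>g. \<Sum>i<n. (\<Sum>j<n. ip f (e j) * \<rho> i j h) * e i g)" by (rule ext)
      also have "\<dots> \<in> V" by (rule VI)
      finally show ?thesis .
    qed
    have V2inv: "(\<lambda>x. f (x + h)) \<in> V2" if f: "f \<in> V2" for f h
    proof -
      have "ip (\<lambda>x. f (x + h)) v = 0" if v: "v \<in> V1" for v
      proof -
        \<comment> \<open>Right translation is unitary, so the translate of \<open>f\<close> can be
          traded for the inverse translate of \<open>v\<close>, which stays in
          \<open>V1\<close>.\<close>
        define u where "u = (\<lambda>x. v (x + - h))"
        have u: "u \<in> V1" unfolding u_def by (rule V1inv[OF v])
        have "v = (\<lambda>x. u (x + h))" by (simp add: u_def add.assoc)
        then have "ip (\<lambda>x. f (x + h)) v = ip f u"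
          using ip_right_translate[of f u h] f u V1V VC by (auto simp: V2_def)
        then show ?thesis using f u by (simp add: V2_def)
      qed
      then show ?thesis using f Vinv by (simp add: V2_def)
    qed
    have Vspan: "V \<subseteq> cfun.span (e ` {..<n})"
    proof
      fix f assume "f \<in> V"
      have "(\<lambda>x. \<Sum>i<n. ip f (e i) * e i x) \<in> cfun.span (e ` {..<n})"
        by (intro subspace_intros[OF cfun.subspace_span] cfun.span_base) auto
      then show "f \<in> cfun.span (e ` {..<n})" using \<open>f \<in> V\<close> by (simp add: V_def flip: fun_eq_iff)
    qed
    obtain n1 e1 where e1: "orthonormal n1 e1" "\<And>i. i < n1 \<Longrightarrow> e1 i \<in> V1"
      "\<And>f x. f \<in> V1 \<Longrightarrow> f x = (\<Sum>i<n1. ip f (e1 i) * e1 i x)"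
      using orthonormal_basis_span[OF V1sub _ _ order_trans[OF V1V Vspan]] V1V VC by blast
    obtain n2 e2 where e2: "orthonormal n2 e2" "\<And>i. i < n2 \<Longrightarrow> e2 i \<in> V2"
      "\<And>f x. f \<in> V2 \<Longrightarrow> f x = (\<Sum>i<n2. ip f (e2 i) * e2 i x)"
      using orthonormal_basis_span[OF V2sub _ _ order_trans[OF _ Vspan]] VC unfolding V2_def by blast
    have e1C: "e1 i \<in> C" if "i < n1" for i using e1(1) that by (auto simp: orthonormal_def)
    have e2C: "e2 i \<in> C" if "i < n2" for i using e2(1) that by (auto simp: orthonormal_def)
    have decomp: "(\<lambda>x. f x - (\<Sum>i<n1. ip f (e1 i) * e1 i x)) \<in> V2" if f: "f \<in> V" for f
    proof -
      define p where "p = (\<lambda>x. \<Sum>i<n1. ip f (e1 i) * e1 i x)"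
      define r where "r = (\<lambda>x. f x - p x)"
      have pV: "p \<in> V" unfolding p_def using e1(2) V1V by (intro subspace_intros[OF Vsub]) auto
      have rV: "r \<in> V" unfolding r_def by (intro subspace_intros[OF Vsub] f pV)
      have re: "ip r (e1 i) = 0" if "i < n1" for i
        unfolding r_def using orthonormal_coeff[OF e1(1) that, of "\<lambda>i. ip f (e1 i)"]
        by (subst ip_diff_left) (use f pV VC e1C[OF that] in \<open>auto simp: p_def\<close>)
      have er: "ip (e1 i) r = 0" if "i < n1" for i
        using cnj_ip[OF VC[OF rV] e1C[OF that]] re[OF that] by simp
      have "ip r v = 0" if v: "v \<in> V1" for v
      proof -
        have "v = (\<lambda>x. \<Sum>i<n1. ip v (e1 i) * e1 i x)" using e1(3)[OF v] by (rule ext)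
        then have "ip v r = ip (\<lambda>x. \<Sum>i<n1. ip v (e1 i) * e1 i x) r" by (rule arg_cong)
        also have "\<dots> = (\<Sum>i<n1. ip v (e1 i) * ip (e1 i) r)"
          using e1C VC[OF rV] by (intro ip_sum_left) auto
        also have "\<dots> = 0" by (intro sum.neutral) (simp add: er)
        finally have "ip v r = 0" .
        then show ?thesis using cnj_ip[of v r] V1V v VC[OF rV] VC by auto
      qed
      then have "r \<in> V2" using rV by (simp add: V2_def)
      then show ?thesis by (simp add: r_def p_def)
    qed
    \<comment> \<open>The two families are orthogonal to each other; joined, they form an
      orthonormal family in a span of at most \<open>n\<close> functions.\<close>
    have "n1 + n2 \<le> card (e ` {..<n})"
    proof (rule orthonormal_le_card)
      have perp: "ip (e2 i) (e1 j) = 0" "ip (e1 j) (e2 i) = 0" if "i < n2" "j < n1" for i j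
      proof -
        show "ip (e2 i) (e1 j) = 0" using e2(2)[OF that(1)] e1(2)[OF that(2)] by (simp add: V2_def)
        then show "ip (e1 j) (e2 i) = 0" using cnj_ip[OF e2C[OF that(1)] e1C[OF that(2)]] by simp
      qed
      show "orthonormal (n1 + n2) (\<lambda>i. if i < n1 then e1 i else e2 (i - n1))"
        unfolding orthonormal_def using e1C e2C perp orthonormalD[OF e1(1)] orthonormalD[OF e2(1)] by auto
      show "(if i < n1 then e1 i else e2 (i - n1)) \<in> cfun.span (e ` {..<n})" if "i < n1 + n2" for i
        using e1(2)[of i] e2(2)[of "i - n1"] that V1V Vspan by (auto simp: V2_def)
    qed auto
    also have "\<dots> \<le> n" using card_image_le[of "{..<n}" e] by simp
    finally have "n1 + n2 \<le> n" .
    have comb_inj: "v = w" if "v \<in> carrier_vec n" "w \<in> carrier_vec n" "comb v = comb w" for v w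
      using that orthonormal_unique[OF e, of "vec_index v" "vec_index w"]
      by (intro eq_vecI) (auto simp: comb_def fun_eq_iff)
    have "n1 > 0"
    proof (rule ccontr)
      assume "\<not> n1 > 0"
      then have *: "f x = 0" if "f \<in> V1" for f x using e1(3)[OF that] by simp
      have z: "0\<^sub>v n \<in> W" using W(1) by (simp add: vec_subspace_def)
      have "w = 0\<^sub>v n" if "w \<in> W" for w
        using *[of "comb w"] *[of "comb (0\<^sub>v n)"] that z WC by (intro comb_inj) (auto simp: V1_def)
      then show False using W(3) z by blast
    qed
    \<comment> \<open>If \<open>V2\<close> were zero, \<open>decomp\<close> would place every
      combination of the \<open>e i\<close> in \<open>V1\<close>, and \<open>W\<close> would be the
      whole space. With \<open>n1\<close> and \<open>n2\<close> both positive, both are smaller than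
      \<open>n\<close>.\<close>
    have "n2 > 0"
    proof (rule ccontr)
      assume "\<not> n2 > 0"
      then have *: "f x = 0" if "f \<in> V2" for f x using e2(3)[OF that] by simp
      have "c \<in> W" if c: "c \<in> carrier_vec n" for c
      proof -
        have "comb c \<in> V" unfolding comb_def by (rule VI)
        from *[OF decomp[OF this]] have "comb c = (\<lambda>x. \<Sum>i<n1. ip (comb c) (e1 i) * e1 i x)"
          by (auto simp: fun_eq_iff)
        also have "\<dots> \<in> V1" using e1(2) by (intro subspace_intros[OF V1sub]) auto
        finally obtain w where "w \<in> W" "comb c = comb w" unfolding V1_def by blast
        then show ?thesis using comb_inj[OF c WC] by metis
      qed
      then show False using W(4) WC by blast
    qed
    with \<open>n1 + n2 \<le> n\<close> \<open>n1 > 0\<close> have lt: "n1 < n" "n2 < n" by auto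
    have rep1: "e1 i \<in> representative_funs" if "i < n1" for i
    proof (rule less.IH[OF lt(1) e1(1) _ that])
      show "e1 j (g + h) = (\<Sum>i<n1. ip (\<lambda>x. e1 j (x + h)) (e1 i) * e1 i g)" if "j < n1" for j g h
        using e1(3)[OF V1inv[OF e1(2)[OF that]]] .
    qed
    have rep2: "e2 i \<in> representative_funs" if "i < n2" for i
    proof (rule less.IH[OF lt(2) e2(1) _ that])
      show "e2 j (g + h) = (\<Sum>i<n2. ip (\<lambda>x. e2 j (x + h)) (e2 i) * e2 i g)" if "j < n2" for j g h
        using e2(3)[OF V2inv[OF e2(2)[OF that]]] .
    qed
    define p where "p = (\<lambda>x. \<Sum>i<n1. ip (e j) (e1 i) * e1 i x)"
    have "e j \<in> V"
      using less.prems(3) VI[of "\<lambda>i. if i = j then 1 else 0"] by (simp add: if_distrib[of "\<lambda>a. a * _"] cong: if_cong)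
    then have "(\<lambda>x. e j x - p x) \<in> V2" unfolding p_def by (rule decomp)
    from e2(3)[OF this] have "e j = (\<lambda>x. p x + (\<Sum>i<n2. ip (\<lambda>x. e j x - p x) (e2 i) * e2 i x))"
      unfolding diff_eq_eq by (intro ext) (metis add.commute)
    also have "\<dots> \<in> representative_funs"
      unfolding p_def using rep1 rep2 by (intro sub) auto
    finally show ?thesis .
  qed
qed

text \<open>The span of all right translates of \<open>H\<close> is invariant by construction, and
  finite-dimensional because every translate is a combination of the finitely many left factors in
  \<open>T\<close>. Taking a set \<open>H\<close> instead of one function provides a common basis
  for several functions.\<close>

lemma right_invariant_basis:
  assumes H: "finite H" "H \<subseteq> RF"
  obtains n e where "orthonormal n e"
    "\<And>j g h. j < n \<Longrightarrow> e j (g + h) = (\<Sum>i<n. ip (\<lambda>x. e j (x + h)) (e i) * e i g)"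
    "\<And>f x. f \<in> H \<Longrightarrow> f x = (\<Sum>i<n. ip f (e i) * e i x)"
proof -
  have "\<forall>f\<in>H. \<exists>ps. (\<forall>p\<in>set ps. fst p \<in> C \<and> snd p \<in> C) \<and> (\<forall>g h. f (g + h) = (\<Sum>p\<leftarrow>ps. fst p g * snd p h))"
    using H(2) unfolding RF_def by blast
  then obtain P where P: "\<forall>f\<in>H. (\<forall>p\<in>set (P f). fst p \<in> C \<and> snd p \<in> C) \<and>
      (\<forall>g h. f (g + h) = (\<Sum>p\<leftarrow>P f. fst p g * snd p h))"
    unfolding bchoice_iff ..
  define A where "A = {\<lambda>x. f (x + h) | f h. f \<in> H}"
  define T where "T = (\<Union>f\<in>H. fst ` set (P f))"
  have A: "(\<lambda>x. a (x + h)) \<in> A" if "a \<in> A" for a h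
  proof -
    from that obtain f k where "f \<in> H" "a = (\<lambda>x. f (x + k))" unfolding A_def by blast
    then have "f \<in> H" "(\<lambda>x. a (x + h)) = (\<lambda>x. f (x + (h + k)))" by (auto simp: add.assoc)
    then show ?thesis unfolding A_def by blast
  qed
  have AC: "cfun.span A \<subseteq> C"
    by (rule cfun.span_minimal) (use H(2) RF_sub_C in \<open>auto simp: A_def subspace_cont_funs intro!: C_translate\<close>)
  have "(\<lambda>x. f (x + h)) \<in> cfun.span T" if "f \<in> H" for f h
  proof -
    have "(\<lambda>x. f (x + h)) = (\<lambda>x. \<Sum>p\<leftarrow>P f. snd p h * fst p x)"
      using bspec[OF P that] by (simp add: mult.commute)
    also have "\<dots> \<in> cfun.span T"
      using that by (intro span_linear_combination cfun.span_base) (auto simp: T_def)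
    finally show ?thesis .
  qed
  then have AT: "cfun.span A \<subseteq> cfun.span T"
    by (intro cfun.span_minimal cfun.subspace_span) (auto simp: A_def)
  have T: "finite T" using H(1) by (auto simp: T_def)
  obtain n e where e: "orthonormal n e" "\<And>i. i < n \<Longrightarrow> e i \<in> cfun.span A"
    "\<And>f x. f \<in> cfun.span A \<Longrightarrow> f x = (\<Sum>i<n. ip f (e i) * e i x)"
    using orthonormal_basis_span[OF cfun.subspace_span AC T AT] by auto
  show thesis
  proof (rule that[OF e(1)])
    show "e j (g + h) = (\<Sum>i<n. ip (\<lambda>x. e j (x + h)) (e i) * e i g)" if "j < n" for j g h
      using e(3)[OF span_closed_under_substitution[OF e(2)[OF that] A]] .
    fix f x assume "f \<in> H"
    then have "f \<in> A" unfolding A_def by (intro CollectI exI[of _ f] exI[of _ 0]) simp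
    then show "f x = (\<Sum>i<n. ip f (e i) * e i x)" by (intro e(3) cfun.span_base)
  qed
qed

lemma RF_eq_representative_funs: "RF = representative_funs"
proof
  show "RF \<subseteq> representative_funs"
  proof
    fix f assume f: "f \<in> RF"
    obtain n e where e: "orthonormal n e"
      "\<And>j g h. j < n \<Longrightarrow> e j (g + h) = (\<Sum>i<n. ip (\<lambda>x. e j (x + h)) (e i) * e i g)"
      "\<And>k x. k \<in> {f} \<Longrightarrow> k x = (\<Sum>i<n. ip k (e i) * e i x)"
      by (rule right_invariant_basis[of "{f}"]) (use f in auto)
    have "f = (\<lambda>x. \<Sum>i<n. ip f (e i) * e i x)" using e(3)[of f] by (intro ext) simp
    also have "\<dots> \<in> representative_funs"
      using invariant_orthonormal_sub_representative_funs[OF e(1,2)]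
      by (intro subspace_intros[OF subspace_representative_funs]) auto
    finally show "f \<in> representative_funs" .
  qed
qed (rule representative_funs_sub_RF)

text \<open>Inversion turns a right invariant space into a left invariant one. The matrix becomes
  the transpose of \<open>\<rho>\<close> at the inverse: inversion reverses products and
  transposition restores their order.\<close>

lemma left_invariant_basis:
  assumes H: "finite H" "H \<subseteq> RF"
  obtains n r l where "orthonormal n r" "matrix_rep n l"
    "\<And>j g h. j < n \<Longrightarrow> r j (g + h) = (\<Sum>i<n. l j i g * r i h)"
    "\<And>f x. f \<in> H \<Longrightarrow> f x = (\<Sum>i<n. ip f (r i) * r i x)"
proof -
  let ?refl = "\<lambda>f x. f (- x) :: complex"
  have H': "finite (?refl ` H)" "?refl ` H \<subseteq> RF" using H by (auto intro: RF_reflect)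
  obtain n e where e: "orthonormal n e"
    and inv: "\<And>j g h. j < n \<Longrightarrow> e j (g + h) = (\<Sum>i<n. ip (\<lambda>x. e j (x + h)) (e i) * e i g)"
    and ex: "\<And>f x. f \<in> ?refl ` H \<Longrightarrow> f x = (\<Sum>i<n. ip f (e i) * e i x)"
    by (rule right_invariant_basis[OF H']) (rule that)
  define \<rho> where "\<rho> = (\<lambda>i j h. ip (\<lambda>x. e j (x + h)) (e i))"
  have \<rho>: "matrix_rep n \<rho>" unfolding \<rho>_def by (rule right_matrix_rep[OF e inv])
  have eC: "e i \<in> C" if "i < n" for i using e that by (auto simp: orthonormal_def)
  have ip_refl: "ip (?refl f) (?refl k) = ip f k" if "f \<in> C" "k \<in> C" for f k
    unfolding ip_def by (rule haar_reflect) (intro C_intros that)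
  show thesis
  proof (rule that[of n "\<lambda>i. ?refl (e i)" "\<lambda>j i g. \<rho> i j (- g)"])
    show "orthonormal n (\<lambda>i. ?refl (e i))"
      using e eC by (auto simp: orthonormal_def ip_refl intro: C_translate)
    show "matrix_rep n (\<lambda>j i g. \<rho> i j (- g))"
      unfolding matrix_rep_def
    proof (intro conjI allI impI)
      fix j i assume ij: "j < n" "i < n"
      show "(\<lambda>g. \<rho> i j (- g)) \<in> C" "\<rho> i j (- 0) = (if j = i then 1 else 0)"
        using \<rho> ij by (auto simp: matrix_rep_def intro: C_translate)
      fix g h
      have "\<rho> i j (- h + - g) = (\<Sum>k<n. \<rho> i k (- h) * \<rho> k j (- g))"
        using \<rho> ij unfolding matrix_rep_def by blast
      then show "\<rho> i j (- (g + h)) = (\<Sum>k<n. \<rho> k j (- g) * \<rho> i k (- h))"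
        by (simp only: minus_add mult.commute)
    qed
    show "?refl (e j) (g + h) = (\<Sum>i<n. \<rho> i j (- g) * ?refl (e i) h)" if "j < n" for j g h
      using inv[OF that, of "- h" "- g"] by (simp add: \<rho>_def minus_add)
    fix f x assume f: "f \<in> H"
    then have fC: "f \<in> C" using H(2) RF_sub_C by blast
    have "f x = (\<Sum>i<n. ip (?refl f) (e i) * ?refl (e i) x)" using ex[of "?refl f" "- x"] f by auto
    also have "\<dots> = (\<Sum>i<n. ip f (?refl (e i)) * ?refl (e i) x)"
      using ip_refl[OF C_translate(3)[OF fC] eC] by simp
    finally show "f x = (\<Sum>i<n. ip f (?refl (e i)) * ?refl (e i) x)" .
  qed
qed

end

section \<open>Equivariant frames of a free action\<close>

lemma continuous_on_det:
  fixes M :: "'x::topological_space \<Rightarrow> complex mat"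
  assumes "\<And>x. M x \<in> carrier_mat m m" "\<And>i j. i < m \<Longrightarrow> j < m \<Longrightarrow> continuous_on X (\<lambda>x. M x $$ (i, j))"
  shows "continuous_on X (\<lambda>x. Determinant.det (M x))"
proof -
  have "Determinant.det (M x) = (\<Sum>p | p permutes {0..<m}. of_int (sign p) * (\<Prod>i = 0..<m. M x $$ (i, p i)))" for x
    using assms(1)[of x] by (simp add: Determinant.det_def)
  moreover have "p i < m" if "p permutes {0..<m}" "i < m" for p i
    using permutes_in_image[OF that(1), of i] that(2) by simp
  ultimately show ?thesis
    by (auto intro!: continuous_on_sum continuous_on_mult continuous_on_prod continuous_on_const assms(2))
qed

text \<open>The largest entry of a kernel vector would be bounded by \<open>n * e < 1\<close> times
  itself, so the matrix is invertible at each point. Cramer's rule writes the inverse through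
  determinants, and these depend continuously on the point.\<close>

lemma near_identity_inverse:
  fixes E :: "nat \<Rightarrow> nat \<Rightarrow> 'x::topological_space \<Rightarrow> complex"
  assumes cont: "\<And>i j. i < n \<Longrightarrow> j < n \<Longrightarrow> continuous_on X (E i j)"
    and near: "\<And>i j x. i < n \<Longrightarrow> j < n \<Longrightarrow> x \<in> X \<Longrightarrow> norm (E i j x - (if i = j then 1 else 0)) \<le> e"
    and e: "real n * e < 1"
  obtains B where "\<And>i j. i < n \<Longrightarrow> j < n \<Longrightarrow> continuous_on X (B i j)"
    "\<And>i j x. i < n \<Longrightarrow> j < n \<Longrightarrow> x \<in> X \<Longrightarrow> (\<Sum>k<n. B i k x * E k j x) = (if i = j then 1 else 0)"
proof -
  define A where "A = (\<lambda>x. mat n n (\<lambda>(i, j). E i j x))"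
  have A: "A x \<in> carrier_mat n n" for x by (simp add: A_def)
  have det: "Determinant.det (A x) \<noteq> 0" if x: "x \<in> X" for x
  proof
    assume "Determinant.det (A x) = 0"
    then obtain v where v: "v \<in> carrier_vec n" "v \<noteq> 0\<^sub>v n" "A x *\<^sub>v v = 0\<^sub>v n"
      using det_0_iff_vec_prod_zero[OF A] by blast
    define S where "S = (\<lambda>i. norm (vec_index v i)) ` {..<n}"
    have "n \<noteq> 0" using v by (auto intro!: eq_vecI)
    then have S: "finite S" "S \<noteq> {}" by (auto simp: S_def)
    \<comment> \<open>Row \<open>i\<close> of the equation, for the index of a largest entry of
      \<open>v\<close>, yields the contradiction.\<close>
    obtain i where i: "i < n" "norm (vec_index v i) = Max S" using Max_in[OF S] by (auto simp: S_def)
    have max: "norm (vec_index v j) \<le> norm (vec_index v i)" if "j < n" for j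
      unfolding i(2) using that by (intro Max_ge S(1)) (auto simp: S_def)
    have "(\<Sum>j<n. E i j x * vec_index v j) = 0"
    proof -
      have "vec_index (A x *\<^sub>v v) i = (\<Sum>j<n. E i j x * vec_index v j)"
        using i(1) v(1) by (simp add: A_def scalar_prod_def atLeast0LessThan)
      then show ?thesis using v(3) i(1) by simp
    qed
    then have "vec_index v i = - (\<Sum>j<n. (E i j x - (if i = j then 1 else 0)) * vec_index v j)"
      using i(1) by (simp add: left_diff_distrib sum_subtractf if_distrib[of "\<lambda>a. a * _"] cong: if_cong)
    then have "norm (vec_index v i) = norm (\<Sum>j<n. (E i j x - (if i = j then 1 else 0)) * vec_index v j)"
      by (metis norm_minus_cancel)
    also have "\<dots> \<le> (\<Sum>j<n. e * norm (vec_index v i))"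
    proof (rule sum_norm_le)
      fix j assume "j \<in> {..<n}"
      then have "norm (E i j x - (if i = j then 1 else 0)) * norm (vec_index v j) \<le> e * norm (vec_index v i)"
        using near[OF i(1) _ x, of j] max[of j]
        by (intro mult_mono) (auto intro: order_trans[OF norm_ge_zero])
      then show "norm ((E i j x - (if i = j then 1 else 0)) * vec_index v j) \<le> e * norm (vec_index v i)"
        by (simp only: norm_mult)
    qed
    also have "\<dots> = real n * e * norm (vec_index v i)" by simp
    finally have "norm (vec_index v i) * (1 - real n * e) \<le> 0" by (simp add: algebra_simps)
    then have "norm (vec_index v i) \<le> 0" using e by (simp add: mult_le_0_iff)
    then have "vec_index v j = 0" if "j < n" for j using max[OF that] by (metis norm_le_zero_iff order_trans)
    then have "v = 0\<^sub>v n" using v(1) by (intro eq_vecI) auto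
    then show False using v(2) by simp
  qed
  define B where "B = (\<lambda>i j x. adj_mat (A x) $$ (i, j) / Determinant.det (A x))"
  show thesis
  proof (rule that[of B])
    fix i j assume ij: "i < n" "j < n"
    have detA: "continuous_on X (\<lambda>x. Determinant.det (A x))"
      by (rule continuous_on_det[OF A]) (simp add: A_def cont)
    have D: "mat_delete (A x) j i \<in> carrier_mat (n - 1) (n - 1)" for x
      using mat_delete_carrier[OF A] .
    have "continuous_on X (\<lambda>x. Determinant.det (mat_delete (A x) j i))"
    proof (rule continuous_on_det[OF D])
      fix a b assume ab: "a < n - 1" "b < n - 1"
      then show "continuous_on X (\<lambda>x. mat_delete (A x) j i $$ (a, b))"
        by (simp add: mat_delete_def A_def cont)
    qed
    then show "continuous_on X (B i j)"
      unfolding B_def using ij det detA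
      by (auto simp: adj_mat_def cofactor_def A_def intro!: continuous_intros)
    fix x assume x: "x \<in> X"
    have "(\<Sum>k<n. B i k x * E k j x) = (\<Sum>k<n. adj_mat (A x) $$ (i, k) * A x $$ (k, j)) / Determinant.det (A x)"
      using ij by (simp add: B_def sum_divide_distrib A_def)
    also have "(\<Sum>k<n. adj_mat (A x) $$ (i, k) * A x $$ (k, j)) = (adj_mat (A x) * A x) $$ (i, j)"
      using ij adj_mat(1)[OF A[of x]] A[of x] by (simp add: scalar_prod_def atLeast0LessThan)
    also have "\<dots> = Determinant.det (A x) * (if i = j then 1 else 0)"
      unfolding adj_mat(3)[OF A] using ij by simp
    finally show "(\<Sum>k<n. B i k x * E k j x) = (if i = j then 1 else 0)" using det[OF x] by simp
  qed
qed

context compact_group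
begin

lemma haar_sum_cmult:
  "(\<And>i. i \<in> I \<Longrightarrow> v i \<in> C) \<Longrightarrow> haar (\<lambda>x. \<Sum>i\<in>I. c i * v i x) = (\<Sum>i\<in>I. c i * haar (v i))"
  by (subst haar_sum) (auto intro!: C_basic haar_cmult sum.cong)

text \<open>A factor \<open>w\<close> of modulus 1 rotates the mean of \<open>f\<close> onto the
  positive axis, which reduces the estimate to monotonicity for real parts.\<close>

lemma haar_norm_le:
  assumes f: "f \<in> C" and v: "v \<in> C" and le: "\<And>x. norm (f x) \<le> Re (v x)"
  shows "norm (haar f) \<le> Re (haar v)"
proof (cases "haar f = 0")
  case True
  then show ?thesis using haar_ge[OF v, of 0] order_trans[OF norm_ge_zero le] by simp
next
  case False
  define w where "w = cnj (haar f) / norm (haar f)"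
  have w: "norm w = 1" "w * haar f = norm (haar f)"
  proof -
    show "norm w = 1" using False by (simp add: w_def norm_divide)
    have "w * haar f = (haar f * cnj (haar f)) / norm (haar f)" by (simp add: w_def)
    then show "w * haar f = norm (haar f)"
      unfolding complex_norm_square[symmetric] using False by (simp add: power2_eq_square)
  qed
  have "Re (w * f x) \<le> Re (v x)" for x
    using complex_Re_le_cmod[of "w * f x"] le[of x] w(1) by (simp add: norm_mult)
  then have "0 \<le> Re (haar (\<lambda>x. v x - w * f x))"
    using f v by (intro haar_ge C_intros) auto
  also have "haar (\<lambda>x. v x - w * f x) = haar v - norm (haar f)"
    using f v w(2) by (simp add: haar_diff haar_cmult C_intros)
  finally show ?thesis by simp
qed

end

section \<open>Actions of a compact group and frames for matrix representations\<close>

locale compact_group_action = compact_group G for G :: "'g::{topological_group_add,t2_space} itself" +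
  fixes X :: "'x::t2_space set" and act :: "'x \<Rightarrow> 'g \<Rightarrow> 'x"
  assumes compact_X: "compact X" and action: "continuous_right_action X act"
begin

lemma act_in [simp]: "x \<in> X \<Longrightarrow> act x g \<in> X"
  and act_0 [simp]: "x \<in> X \<Longrightarrow> act x 0 = x"
  and act_act: "x \<in> X \<Longrightarrow> act (act x g) h = act x (g + h)"
  and continuous_on_act: "continuous_on (X \<times> UNIV) (\<lambda>p. act (fst p) (snd p))"
  using action by (auto simp: continuous_right_action_def case_prod_unfold)

lemma continuous_on_act_comp:
  "continuous_on X a \<Longrightarrow> continuous_on (X \<times> UNIV) (\<lambda>p. a (act (fst p) (snd p)))"
  by (rule continuous_on_compose2[OF _ continuous_on_act]) auto

lemma C_orbit: "continuous_on X a \<Longrightarrow> x \<in> X \<Longrightarrow> (\<lambda>g. a (act x g)) \<in> C"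
  using C_slice[OF continuous_on_act_comp, of a x] by simp

text \<open>
  The function \<open>v\<close> approximates the point mass at \<open>0\<close>. Freeness makes \<open>(x, g) \<mapsto> (x, act x g)\<close>
  injective, so \<open>v g\<close> is close to a sum of products \<open>a x * b (act x g)\<close>.
\<close>

lemma approximate_frame:
  assumes free: "free_action X act" and l: "matrix_rep n l" and e: "e > 0"
  shows "\<exists>ps. (\<forall>p\<in>set ps. continuous_on X (fst p) \<and> continuous_on X (snd p)) \<and>
    (\<forall>x\<in>X. \<forall>i<n. \<forall>j<n. norm ((\<Sum>p\<leftarrow>ps. fst p x * haar (\<lambda>g. snd p (act x g) * l i j (- g)))
       - (if i = j then 1 else 0)) \<le> e)"
proof -
  have lC: "l i j \<in> C" if "i < n" "j < n" for i j using l that by (auto simp: matrix_rep_def)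
  have lC': "(\<lambda>g. l i j (- g)) \<in> C" if "i < n" "j < n" for i j using lC[OF that] by (rule C_translate)
  \<comment> \<open>\<open>d g\<close> dominates every entry of \<open>l (- g)\<close> minus the
    identity. Hence \<open>u\<close> is a bump function that vanishes unless all these entries are
    within \<open>e / 2\<close>; \<open>v\<close> is \<open>u\<close> divided by its mean
    \<open>c\<close>.\<close>
  define d where "d = (\<lambda>g. \<Sum>i<n. \<Sum>j<n. norm (l i j (- g) - (if i = j then 1 else 0)))"
  define u where "u = (\<lambda>g. max 0 (e / 2 - d g))"
  have "continuous_on UNIV d" unfolding d_def
    by (intro continuous_intros lC'[THEN CD]) auto
  then have uC: "(\<lambda>g. complex_of_real (u g)) \<in> C"
    unfolding C_iff u_def by (intro continuous_intros)
  have d_ge: "norm (l i j (- g) - (if i = j then 1 else 0)) \<le> d g" if "i < n" "j < n" for i j g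
  proof -
    have "norm (l i j (- g) - (if i = j then 1 else 0)) \<le> (\<Sum>j<n. norm (l i j (- g) - (if i = j then 1 else 0)))"
      using that by (intro member_le_sum) auto
    also have "\<dots> \<le> d g" unfolding d_def using that
      by (intro member_le_sum[where f = "\<lambda>i. \<Sum>j<n. norm (l i j (- g) - (if i = j then 1 else 0))"]) (auto intro: sum_nonneg)
    finally show ?thesis .
  qed
  have "d 0 = 0" unfolding d_def using l by (simp add: matrix_rep_def)
  then have u0: "u 0 > 0" using e by (simp add: u_def)
  define c where "c = Re (haar (\<lambda>g. complex_of_real (u g)))"
  have c: "c > 0" unfolding c_def using u0 by (intro haar_pos[OF uC, of 0]) (auto simp: u_def)
  have hc: "haar (\<lambda>g. complex_of_real (u g)) = complex_of_real c"
    using haar_cnj[OF uC] by (auto simp: c_def complex_eq_iff)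
  define v where "v = (\<lambda>g. complex_of_real (u g) / complex_of_real c)"
  have vC: "v \<in> C" unfolding v_def by (intro C_intros uC)
  have hv: "haar v = 1"
    using haar_cmult[OF uC, of "inverse (complex_of_real c)"] hc c by (simp add: v_def divide_inverse mult.commute)
  have v_near: "norm (haar (\<lambda>g. v g * l i j (- g)) - (if i = j then 1 else 0)) \<le> e / 2" if ij: "i < n" "j < n" for i j
  proof -
    let ?\<delta> = "if i = j then 1 else 0 :: complex"
    have "haar (\<lambda>g. v g * (l i j (- g) - ?\<delta>)) = haar (\<lambda>g. v g * l i j (- g)) - ?\<delta>"
      using vC lC'[OF ij] haar_cmult[OF vC, of ?\<delta>] hv
      by (simp add: right_diff_distrib haar_diff C_intros mult.commute)
    moreover have "norm (haar (\<lambda>g. v g * (l i j (- g) - ?\<delta>))) \<le> Re (haar (\<lambda>g. (e / 2) * v g))"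
    proof (rule haar_norm_le)
      show "(\<lambda>g. v g * (l i j (- g) - ?\<delta>)) \<in> C" "(\<lambda>g. complex_of_real (e / 2) * v g) \<in> C"
        by (intro C_intros vC lC' ij)+
      fix g
      have vn: "norm (v g) = u g / c" using c by (simp add: v_def norm_divide u_def)
      have "u g * norm (l i j (- g) - ?\<delta>) \<le> u g * (e / 2)"
      proof (cases "u g = 0")
        case False
        then have "d g \<le> e / 2" "u g \<ge> 0" by (auto simp: u_def max_def split: if_splits)
        then show ?thesis using d_ge[OF ij, of g] by (intro mult_left_mono) auto
      qed simp
      then have "norm (v g * (l i j (- g) - ?\<delta>)) \<le> u g * (e / 2) / c"
        unfolding norm_mult vn times_divide_eq_left using c by (intro divide_right_mono) auto
      also have "\<dots> = Re (complex_of_real (e / 2) * v g)" by (simp add: v_def mult.commute flip: of_real_divide)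
      finally show "norm (v g * (l i j (- g) - ?\<delta>)) \<le> Re (complex_of_real (e / 2) * v g)" .
    qed
    moreover have "haar (\<lambda>g. complex_of_real (e / 2) * v g) = complex_of_real (e / 2)"
      using haar_cmult[OF vC, of "complex_of_real (e / 2)"] hv by simp
    ultimately show ?thesis by (simp only: Re_complex_of_real)
  qed
  have "\<exists>L>0. \<forall>i<n. \<forall>j<n. \<forall>g. norm (l i j g) \<le> L"
  proof -
    have "\<exists>B>0. \<forall>g. norm (l i j g) \<le> B" if "i < n" "j < n" for i j
      using C_bounded[OF lC[OF that]] by metis
    then obtain B where B: "\<And>i j. i < n \<Longrightarrow> j < n \<Longrightarrow> B i j > 0 \<and> (\<forall>g. norm (l i j g) \<le> B i j)" by metis
    have Bnn: "B i j \<ge> 0" if "i < n" "j < n" for i j using B[OF that] by simp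
    \<comment> \<open>The summand 1 keeps the bound positive even for \<open>n = 0\<close>.\<close>
    have "norm (l i j g) \<le> 1 + (\<Sum>i<n. \<Sum>j<n. B i j)" if "i < n" "j < n" for i j g
    proof -
      have "norm (l i j g) \<le> B i j" using B[OF that] by blast
      also have "\<dots> \<le> (\<Sum>j<n. B i j)" using that Bnn by (intro member_le_sum) auto
      also have "\<dots> \<le> (\<Sum>i<n. \<Sum>j<n. B i j)" using that Bnn
        by (intro member_le_sum[where f = "\<lambda>i. \<Sum>j<n. B i j"]) (auto intro!: sum_nonneg)
      finally show ?thesis by simp
    qed
    moreover have "1 + (\<Sum>i<n. \<Sum>j<n. B i j) > 0" using Bnn by (intro add_pos_nonneg sum_nonneg) auto
    ultimately show ?thesis by blast
  qed
  then obtain L where L: "L > 0" "\<And>i j g. i < n \<Longrightarrow> j < n \<Longrightarrow> norm (l i j g) \<le> L" by blast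
  \<comment> \<open>Multiplication by an entry of \<open>l\<close> enlarges the error by a factor of
    at most \<open>L\<close>, so this tolerance leaves \<open>e / 2\<close>; the other half is spent
    in \<open>v_near\<close>.\<close>
  have "\<exists>ps. (\<forall>(a, b)\<in>set ps. continuous_on X a \<and> continuous_on X b) \<and>
    (\<forall>z\<in>X \<times> UNIV. norm (v (snd z) - (\<Sum>(a, b)\<leftarrow>ps. a (fst z) * b (act (fst z) (snd z)))) < e / (2 * L))"
  proof (rule product_functions_dense)
    show "compact (X \<times> (UNIV :: 'g set))" by (intro compact_Times compact_X compact_UNIV)
    show "continuous_on (X \<times> UNIV) (\<lambda>z. v (snd z))"
      by (intro C_parts[OF vC] continuous_intros)
    show "z = w" if "z \<in> X \<times> UNIV" "w \<in> X \<times> UNIV" "fst z = fst w"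
      "act (fst z) (snd z) = act (fst w) (snd w)" for z w
    proof -
      have x: "fst w \<in> X" using that by auto
      have "act (fst w) (snd z + - snd w) = act (act (fst w) (snd z)) (- snd w)" using x by (simp add: act_act)
      also have "\<dots> = act (act (fst w) (snd w)) (- snd w)" using that by simp
      also have "\<dots> = fst w" using x by (simp add: act_act)
      finally have "snd z + - snd w = 0" using free x unfolding free_action_def by blast
      then show ?thesis using that(3) by (simp add: prod_eq_iff)
    qed
  qed (use compact_X continuous_on_act e L in \<open>auto intro: continuous_on_fst\<close>)
  then obtain ps where ps: "\<forall>(a, b)\<in>set ps. continuous_on X a \<and> continuous_on X b"
    "\<forall>z\<in>X \<times> UNIV. norm (v (snd z) - (\<Sum>(a, b)\<leftarrow>ps. a (fst z) * b (act (fst z) (snd z)))) < e / (2 * L)"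
    by blast
  have ps1: "continuous_on X (fst p)" "continuous_on X (snd p)" if "p \<in> set ps" for p using ps(1) that by auto
  have "norm ((\<Sum>p\<leftarrow>ps. fst p x * haar (\<lambda>g. snd p (act x g) * l i j (- g))) - (if i = j then 1 else 0)) \<le> e"
    if x: "x \<in> X" and ij: "i < n" "j < n" for x i j
  proof -
    have C1: "(\<lambda>g. snd p (act x g) * l i j (- g)) \<in> C" if "p \<in> set ps" for p
      by (intro C_intros C_orbit lC' ij x ps1 that)
    define s where "s = (\<lambda>g. \<Sum>p\<leftarrow>ps. fst p x * (snd p (act x g) * l i j (- g)))"
    have s: "haar s = (\<Sum>p\<leftarrow>ps. fst p x * haar (\<lambda>g. snd p (act x g) * l i j (- g)))"
      unfolding s_def by (rule haar_linear_combination[OF C1])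
    have sC: "s \<in> C" unfolding s_def by (intro C_intros C1)
    have "norm (v g * l i j (- g) - s g) \<le> e / 2" for g
    proof -
      have "s g = (\<Sum>p\<leftarrow>ps. fst p x * snd p (act x g)) * l i j (- g)"
        unfolding s_def by (simp add: mult.assoc flip: sum_list_mult_const)
      then have "norm (v g * l i j (- g) - s g) = norm (v g - (\<Sum>p\<leftarrow>ps. fst p x * snd p (act x g))) * norm (l i j (- g))"
        by (simp add: norm_mult left_diff_distrib flip: norm_mult)
      also have "\<dots> \<le> e / (2 * L) * L"
        using bspec[OF ps(2), of "(x, g)"] x L ij e
        by (intro mult_mono) (auto simp: case_prod_unfold intro: less_imp_le)
      also have "\<dots> = e / 2" using L(1) by simp
      finally show ?thesis .
    qed
    then have "norm (haar (\<lambda>g. v g * l i j (- g)) - haar s) \<le> e / 2"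
      by (intro haar_diff_le sC C_intros vC lC' ij)
    with v_near[OF ij] show ?thesis
      unfolding s[symmetric]
      using norm_triangle_ineq4[of "haar (\<lambda>g. v g * l i j (- g)) - (if i = j then 1 else 0)"
          "haar (\<lambda>g. v g * l i j (- g)) - haar s"] by simp
  qed
  then show ?thesis using ps1 by blast
qed

text \<open>\<open>\<Psi>\<close> is an \<open>n\<close> by \<open>K\<close> matrix and
  \<open>\<Phi>\<close> a \<open>K\<close> by \<open>n\<close> matrix of functions. The identity is
  demanded at a single point only: \<open>\<Psi>(x) \<Phi>(x g) = l(g)\<close> follows from the
  equivariance of \<open>\<Phi>\<close>. In the other order the product is a matrix of invariant
  functions that is a projection at each point of \<open>X\<close>, the one describing the vector
  bundle associated with \<open>l\<close>.\<close>

definition frame ::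
  "nat \<Rightarrow> (nat \<Rightarrow> nat \<Rightarrow> 'g \<Rightarrow> complex) \<Rightarrow> 'k set \<Rightarrow>
    (nat \<Rightarrow> 'k \<Rightarrow> 'x \<Rightarrow> complex) \<Rightarrow> ('k \<Rightarrow> nat \<Rightarrow> 'x \<Rightarrow> complex) \<Rightarrow> bool"
  where "frame n l K \<Psi> \<Phi> \<longleftrightarrow> finite K \<and>
    (\<forall>i<n. \<forall>k\<in>K. \<Psi> i k \<in> cont_funs X \<and> \<Phi> k i \<in> cont_funs X) \<and>
    (\<forall>i<n. \<forall>k\<in>K. \<forall>x\<in>X. \<forall>g. \<Psi> i k (act x g) = (\<Sum>m<n. l i m (- g) * \<Psi> m k x)) \<and>
    (\<forall>j<n. \<forall>k\<in>K. \<forall>x\<in>X. \<forall>g. \<Phi> k j (act x g) = (\<Sum>m<n. \<Phi> k m x * l m j g)) \<and>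
    (\<forall>i<n. \<forall>j<n. \<forall>x\<in>X. (\<Sum>k\<in>K. \<Psi> i k x * \<Phi> k j x) = (if i = j then 1 else 0))"

lemma frameD:
  assumes "frame n l K \<Psi> \<Phi>"
  shows "finite K"
    "\<And>i k. i < n \<Longrightarrow> k \<in> K \<Longrightarrow> \<Psi> i k \<in> cont_funs X"
    "\<And>k j. k \<in> K \<Longrightarrow> j < n \<Longrightarrow> \<Phi> k j \<in> cont_funs X"
    "\<And>i k x g. i < n \<Longrightarrow> k \<in> K \<Longrightarrow> x \<in> X \<Longrightarrow> \<Psi> i k (act x g) = (\<Sum>m<n. l i m (- g) * \<Psi> m k x)"
    "\<And>k j x g. k \<in> K \<Longrightarrow> j < n \<Longrightarrow> x \<in> X \<Longrightarrow> \<Phi> k j (act x g) = (\<Sum>m<n. \<Phi> k m x * l m j g)"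
    "\<And>i j x. i < n \<Longrightarrow> j < n \<Longrightarrow> x \<in> X \<Longrightarrow> (\<Sum>k\<in>K. \<Psi> i k x * \<Phi> k j x) = (if i = j then 1 else 0)"
  using assms by (auto simp: frame_def)

text \<open>
  The matrix of the approximate frame is inverted pointwise; averaging over the group then makes the
  left factor equivariant and keeps the product equal to the identity.
\<close>

lemma ex_frame:
  assumes free: "free_action X act" and l: "matrix_rep n l"
  shows "\<exists>(K :: (nat \<times> nat) set) \<Psi> \<Phi>. frame n l K \<Psi> \<Phi>"
proof -
  have lC: "l i j \<in> C" if "i < n" "j < n" for i j using l that by (auto simp: matrix_rep_def)
  have lC': "(\<lambda>g. l i j (- g)) \<in> C" if "i < n" "j < n" for i j using lC[OF that] by (rule C_translate)
  have l_add: "l i j (g + h) = (\<Sum>k<n. l i k g * l k j h)" if "i < n" "j < n" for i j g h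
    using l that by (auto simp: matrix_rep_def)
  \<comment> \<open>Chosen to satisfy \<open>n * e < 1\<close>, as inverting the matrix requires;
    the denominator is positive also for \<open>n = 0\<close>.\<close>
  define e where "e = 1 / (real n + 1)"
  have e: "e > 0" "real n * e < 1" by (auto simp: e_def)
  obtain ps where ps: "\<And>p. p \<in> set ps \<Longrightarrow> continuous_on X (fst p)" "\<And>p. p \<in> set ps \<Longrightarrow> continuous_on X (snd p)"
    "\<And>x i j. x \<in> X \<Longrightarrow> i < n \<Longrightarrow> j < n \<Longrightarrow> norm ((\<Sum>p\<leftarrow>ps. fst p x * haar (\<lambda>g. snd p (act x g) * l i j (- g)))
       - (if i = j then 1 else 0)) \<le> e"
    using approximate_frame[OF free l e(1)] by blast
  \<comment> \<open>Averaging \<open>snd p (act x g)\<close> against \<open>l (- g)\<close> produces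
    equivariant rows: \<open>T p i\<close> is multiplied by \<open>l h\<close> on the right when
    \<open>x\<close> moves to \<open>act x h\<close>.\<close>
  define T where "T = (\<lambda>(p :: ('x \<Rightarrow> complex) \<times> ('x \<Rightarrow> complex)) i j x. haar (\<lambda>g. snd p (act x g) * l i j (- g)))"
  have TC: "continuous_on X (T p i j)" if "p \<in> set ps" "i < n" "j < n" for p i j
  proof -
    have "continuous_on (X \<times> UNIV) (\<lambda>z. snd p (act (fst z) (snd z)) * l i j (- snd z))"
      by (intro continuous_on_mult continuous_on_act_comp ps that C_parts[OF lC] continuous_intros)
    from continuous_on_haar[OF this] show ?thesis by (simp add: T_def)
  qed
  have T_act: "T p i j (act x h) = (\<Sum>m<n. T p i m x * l m j h)" if p: "p \<in> set ps" "i < n" "j < n" "x \<in> X" for p i j x h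
  proof -
    have C1: "(\<lambda>g. snd p (act x g) * l i m (- g)) \<in> C" if "m < n" for m
      by (intro C_intros C_orbit lC' that ps p)
    have "T p i j (act x h) = haar (\<lambda>g. snd p (act x (h + g)) * l i j (- (h + g) + h))"
      using p by (simp add: T_def act_act minus_add add.assoc)
    also have "\<dots> = haar (\<lambda>g. snd p (act x g) * l i j (- g + h))"
      by (rule haar_left_translate[of "\<lambda>g. snd p (act x g) * l i j (- g + h)"])
        (intro C_intros C_orbit CI C_parts[OF lC] continuous_intros p ps)
    also have "\<dots> = haar (\<lambda>g. \<Sum>m<n. l m j h * (snd p (act x g) * l i m (- g)))"
      using p by (simp add: l_add sum_distrib_left mult_ac)
    also have "\<dots> = (\<Sum>m<n. l m j h * T p i m x)"
      unfolding T_def using C1 by (intro haar_sum_cmult) auto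
    finally show ?thesis by (simp add: mult.commute)
  qed
  define E where "E = (\<lambda>i j x. \<Sum>p\<leftarrow>ps. fst p x * T p i j x)"
  have EC: "continuous_on X (E i j)" if "i < n" "j < n" for i j
    unfolding E_def by (intro continuous_on_sum_list continuous_on_mult ps TC that)
  obtain B where B: "\<And>i j. i < n \<Longrightarrow> j < n \<Longrightarrow> continuous_on X (B i j)"
    "\<And>i j x. i < n \<Longrightarrow> j < n \<Longrightarrow> x \<in> X \<Longrightarrow> (\<Sum>k<n. B i k x * E k j x) = (if i = j then 1 else 0)"
    by (rule near_identity_inverse[of n X E e]) (use EC ps(3) e in \<open>auto simp: E_def T_def\<close>)
  \<comment> \<open>An index \<open>(q, m)\<close> stands for row \<open>m\<close> of the
    \<open>q\<close>-th summand of \<open>E\<close>. This rewrites \<open>B\<close> times the sum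
    \<open>E\<close> as the product of an \<open>n\<close> by \<open>K\<close> matrix and a
    \<open>K\<close> by \<open>n\<close> matrix with equivariant rows.\<close>
  define K where "K = {..<length ps} \<times> {..<n}"
  define \<Psi>0 where "\<Psi>0 = (\<lambda>m k x. B m (snd k) x * fst (ps ! fst k) x)"
  define F where "F = (\<lambda>k j x. T (ps ! fst k) (snd k) j x)"
  define P where "P = (\<lambda>i k x. haar (\<lambda>g. \<Sum>m<n. l i m g * \<Psi>0 m k (act x g)))"
  have K: "ps ! fst k \<in> set ps" "snd k < n" if "k \<in> K" for k using that by (auto simp: K_def)
  have \<Psi>0C: "continuous_on X (\<Psi>0 m k)" if "m < n" "k \<in> K" for m k
    unfolding \<Psi>0_def by (intro continuous_on_mult B(1) ps K that)
  have FC: "continuous_on X (F k j)" if "k \<in> K" "j < n" for k j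
    unfolding F_def by (intro TC K that)
  have PC: "continuous_on X (P i k)" if "i < n" "k \<in> K" for i k
  proof -
    have "continuous_on (X \<times> UNIV) (\<lambda>z. \<Sum>m<n. l i m (snd z) * \<Psi>0 m k (act (fst z) (snd z)))"
      using that by (intro continuous_on_sum continuous_on_mult continuous_on_act_comp \<Psi>0C C_parts[OF lC] continuous_intros) auto
    from continuous_on_haar[OF this] show ?thesis by (simp add: P_def)
  qed
  have inv0: "(\<Sum>k\<in>K. \<Psi>0 i k x * F k j x) = (if i = j then 1 else 0)" if "i < n" "j < n" "x \<in> X" for i j x
  proof -
    have "(\<Sum>k\<in>K. \<Psi>0 i k x * F k j x) = (\<Sum>q<length ps. \<Sum>m<n. B i m x * fst (ps ! q) x * T (ps ! q) m j x)"
      unfolding K_def by (simp add: sum.cartesian_product case_prod_unfold \<Psi>0_def F_def)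
    also have "\<dots> = (\<Sum>m<n. B i m x * (\<Sum>q<length ps. fst (ps ! q) x * T (ps ! q) m j x))"
      by (subst sum.swap) (simp add: sum_distrib_left mult.assoc)
    also have "\<dots> = (\<Sum>m<n. B i m x * E m j x)"
      by (simp add: E_def sum_list_sum_nth atLeast0LessThan)
    finally show ?thesis using B(2)[OF that] by simp
  qed
  have F_act: "F k j (act x g) = (\<Sum>m<n. F k m x * l m j g)" if "k \<in> K" "j < n" "x \<in> X" for k j x g
    unfolding F_def using K that by (intro T_act) auto
  have P_act: "P i k (act x h) = (\<Sum>m<n. l i m (- h) * P m k x)" if i: "i < n" "k \<in> K" "x \<in> X" for i k x h
  proof -
    have C1: "(\<lambda>g. \<Sum>m<n. l r m g * \<Psi>0 m k (act x g)) \<in> C" if "r < n" for r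
      using that i by (intro C_intros C_orbit lC \<Psi>0C) auto
    have "P i k (act x h) = haar (\<lambda>g. \<Sum>m<n. l i m (- h + (h + g)) * \<Psi>0 m k (act x (h + g)))"
      using i by (simp add: P_def act_act flip: add.assoc)
    also have "\<dots> = haar (\<lambda>g. \<Sum>m<n. l i m (- h + g) * \<Psi>0 m k (act x g))"
      by (rule haar_left_translate[of "\<lambda>g. \<Sum>m<n. l i m (- h + g) * \<Psi>0 m k (act x g)"])
        (use i in \<open>auto intro!: CI continuous_intros C_orbit[THEN CD] \<Psi>0C C_parts[OF lC]\<close>)
    also have "\<dots> = haar (\<lambda>g. \<Sum>m<n. \<Sum>r<n. l i r (- h) * (l r m g * \<Psi>0 m k (act x g)))"
      using i by (simp add: l_add sum_distrib_right mult.assoc)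
    also have "\<dots> = haar (\<lambda>g. \<Sum>r<n. l i r (- h) * (\<Sum>m<n. l r m g * \<Psi>0 m k (act x g)))"
      by (subst sum.swap) (simp add: sum_distrib_left)
    also have "\<dots> = (\<Sum>r<n. l i r (- h) * P r k x)"
      unfolding P_def using C1 by (intro haar_sum_cmult) auto
    finally show ?thesis .
  qed
  have inv: "(\<Sum>k\<in>K. P i k x * F k j x) = (if i = j then 1 else 0)" if ij: "i < n" "j < n" and x: "x \<in> X" for i j x
  proof -
    have C1: "(\<lambda>g. \<Sum>m<n. l i m g * \<Psi>0 m k (act x g)) \<in> C" if "k \<in> K" for k
      using that ij x by (intro C_intros C_orbit lC \<Psi>0C) auto
    \<comment> \<open>The integrand is already the identity for each \<open>g\<close>: by
      equivariance \<open>F(x) = F(x g) l(-g)\<close>, so it equals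
      \<open>l(g) \<Psi>0(x g) F(x g) l(-g) = l(g) l(-g)\<close>.\<close>
    have pt: "(\<Sum>k\<in>K. F k j x * (\<Sum>m<n. l i m g * \<Psi>0 m k (act x g))) = (if i = j then 1 else 0)" for g
    proof -
      have Feq: "F k j x = (\<Sum>r<n. F k r (act x g) * l r j (- g))" if "k \<in> K" for k
        using F_act[OF that ij(2) act_in[OF x], of g "- g"] x by (simp add: act_act)
      have "(\<Sum>k\<in>K. F k j x * (\<Sum>m<n. l i m g * \<Psi>0 m k (act x g)))
        = (\<Sum>k\<in>K. \<Sum>r<n. \<Sum>m<n. l i m g * l r j (- g) * (\<Psi>0 m k (act x g) * F k r (act x g)))"
        by (intro sum.cong refl) (simp only: Feq sum_product, intro sum.cong refl, simp only: mult_ac)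
      also have "\<dots> = (\<Sum>r<n. \<Sum>k\<in>K. \<Sum>m<n. l i m g * l r j (- g) * (\<Psi>0 m k (act x g) * F k r (act x g)))"
        by (rule sum.swap)
      also have "\<dots> = (\<Sum>r<n. \<Sum>m<n. \<Sum>k\<in>K. l i m g * l r j (- g) * (\<Psi>0 m k (act x g) * F k r (act x g)))"
        by (intro sum.cong refl sum.swap)
      also have "\<dots> = (\<Sum>r<n. \<Sum>m<n. l i m g * l r j (- g) * (if m = r then 1 else 0))"
        using inv0 x by (intro sum.cong refl) (simp flip: sum_distrib_left)
      also have "\<dots> = (\<Sum>r<n. l i r g * l r j (- g))"
        by (intro sum.cong refl) (simp add: if_distrib[of "\<lambda>a. _ * a"] cong: if_cong)
      also have "\<dots> = l i j (g + - g)" by (rule l_add[OF ij, symmetric])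
      also have "\<dots> = (if i = j then 1 else 0)" using l ij by (simp add: matrix_rep_def)
      finally show ?thesis .
    qed
    have "(\<Sum>k\<in>K. P i k x * F k j x) = haar (\<lambda>g. \<Sum>k\<in>K. F k j x * (\<Sum>m<n. l i m g * \<Psi>0 m k (act x g)))"
      unfolding P_def using C1 by (subst haar_sum_cmult) (auto simp: mult.commute)
    then show ?thesis unfolding pt by simp
  qed
  \<comment> \<open>Elements of \<open>cont_funs X\<close> vanish outside \<open>X\<close>; the
    functions constructed so far are only controlled on \<open>X\<close>.\<close>
  let ?ext = "\<lambda>a x. if x \<in> X then a x else 0"
  have ext: "?ext a \<in> cont_funs X" if "continuous_on X a" for a
    using that by (auto simp: cont_funs_def cong: continuous_on_cong)
  have "finite K" by (simp add: K_def)
  then have "frame n l K (\<lambda>i k. ?ext (P i k)) (\<lambda>k j. ?ext (F k j))"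
    unfolding frame_def using PC FC P_act F_act inv ext by auto
  then show ?thesis by blast
qed

end

section \<open>The canonical map of a free action\<close>

lemma sum_fun_apply: "(\<Sum>i\<in>I. f i) x = (\<Sum>i\<in>I. f i x)" for f :: "'i \<Rightarrow> 'a \<Rightarrow> 'b::comm_monoid_add"
  by (induction I rule: infinite_finite_induct) auto

lemma tensor_funs_iff:
  assumes A: "cfun.subspace A"
  shows "u \<in> tensor_funs A H \<longleftrightarrow>
    (\<exists>ps. (\<forall>p\<in>set ps. fst p \<in> A \<and> snd p \<in> H) \<and> u = (\<lambda>z. \<Sum>p\<leftarrow>ps. fst p (fst z) * snd p (snd z)))"
proof
  assume "u \<in> tensor_funs A H"
  then show "\<exists>ps. (\<forall>p\<in>set ps. fst p \<in> A \<and> snd p \<in> H) \<and> u = (\<lambda>z. \<Sum>p\<leftarrow>ps. fst p (fst z) * snd p (snd z))"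
    unfolding tensor_funs_def
  proof (induction rule: cfun.span_induct_alt)
    case base
    show ?case by (rule exI[of _ "[]"]) (simp add: zero_fun_def)
  next
    case (step c v w)
    then obtain a h ps where v: "v = simple_tensor a h" "a \<in> A" "h \<in> H"
      and ps: "\<forall>p\<in>set ps. fst p \<in> A \<and> snd p \<in> H" "w = (\<lambda>z. \<Sum>p\<leftarrow>ps. fst p (fst z) * snd p (snd z))"
      by blast
    have "fscale c v + w = (\<lambda>z. \<Sum>p\<leftarrow>(fscale c a, h) # ps. fst p (fst z) * snd p (snd z))"
      by (auto simp: v ps fscale_def simple_tensor_def fun_eq_iff)
    moreover have "fscale c a \<in> A" using v A by (intro cfun.subspace_scale)
    ultimately show ?case using v ps by (intro exI[of _ "(fscale c a, h) # ps"]) auto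
  qed
next
  assume "\<exists>ps. (\<forall>p\<in>set ps. fst p \<in> A \<and> snd p \<in> H) \<and> u = (\<lambda>z. \<Sum>p\<leftarrow>ps. fst p (fst z) * snd p (snd z))"
  then obtain ps where "\<forall>p\<in>set ps. fst p \<in> A \<and> snd p \<in> H" "u = (\<lambda>z. \<Sum>p\<leftarrow>ps. fst p (fst z) * snd p (snd z))"
    by blast
  then show "u \<in> tensor_funs A H"
  proof (induction ps arbitrary: u)
    case Nil
    have "u = 0" using Nil by (simp add: zero_fun_def)
    then show ?case by (simp only: tensor_funs_def cfun.span_zero)
  next
    case (Cons p ps)
    have "simple_tensor (fst p) (snd p) + (\<lambda>z. \<Sum>p\<leftarrow>ps. fst p (fst z) * snd p (snd z)) \<in> tensor_funs A H"
      unfolding tensor_funs_def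
    proof (rule cfun.span_add[OF cfun.span_base])
      show "(\<lambda>z. \<Sum>p\<leftarrow>ps. fst p (fst z) * snd p (snd z)) \<in> cfun.span {simple_tensor a h |a h. a \<in> A \<and> h \<in> H}"
        using Cons by (auto simp: tensor_funs_def)
    qed (use Cons in auto)
    also have "simple_tensor (fst p) (snd p) + (\<lambda>z. \<Sum>p\<leftarrow>ps. fst p (fst z) * snd p (snd z)) = u"
      using Cons.prems by (auto simp: simple_tensor_def fun_eq_iff)
    finally show ?case .
  qed
qed

context compact_group_action
begin

abbreviation CX where "CX \<equiv> cont_funs X"
abbreviation PW where "PW \<equiv> peter_weyl X act"

lemmas CX_intros = subspace_intros[OF subspace_cont_funs[of X]]
lemmas PW_intros = subspace_intros[OF subspace_peter_weyl[of X act]]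

lemma CX_zero: "a \<in> CX \<Longrightarrow> x \<notin> X \<Longrightarrow> a x = 0"
  by (simp add: cont_funs_def)

lemma CX_mult: "a \<in> CX \<Longrightarrow> b \<in> CX \<Longrightarrow> (\<lambda>x. a x * b x) \<in> CX"
  using cont_funs_mult[of a X b] by (simp add: times_fun_def)

lemma PW_sub_CX: "a \<in> PW \<Longrightarrow> a \<in> CX"
  by (simp add: peter_weyl_def)

text \<open>Outside \<open>X\<close> both sides of the expansion vanish, so only points of
  \<open>X\<close> remain to be tested. Representative functions appear as \<open>RF\<close>, for
  which products and inversion are available.\<close>

lemma PW_iff:
  "a \<in> PW \<longleftrightarrow> a \<in> CX \<and> (\<exists>ps. (\<forall>p\<in>set ps. fst p \<in> CX \<and> snd p \<in> RF) \<and>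
    (\<forall>x\<in>X. \<forall>g. a (act x g) = (\<Sum>p\<leftarrow>ps. fst p x * snd p g)))"
proof -
  have "coaction X act a = (\<lambda>z. \<Sum>p\<leftarrow>ps. fst p (fst z) * snd p (snd z)) \<longleftrightarrow>
      (\<forall>x\<in>X. \<forall>g. a (act x g) = (\<Sum>p\<leftarrow>ps. fst p x * snd p g))"
    if "\<forall>p\<in>set ps. fst p \<in> CX \<and> snd p \<in> RF" for ps
  proof -
    have "(\<Sum>p\<leftarrow>ps. fst p x * snd p g) = 0" if "x \<notin> X" for x g
    proof -
      have "(\<Sum>p\<leftarrow>ps. fst p x * snd p g) = (\<Sum>p\<leftarrow>ps. 0)"
        using \<open>\<forall>p\<in>set ps. _\<close> that by (intro arg_cong[of _ _ sum_list] map_cong) (auto simp: CX_zero)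
      then show ?thesis by simp
    qed
    then show ?thesis by (auto simp: coaction_def fun_eq_iff)
  qed
  then show ?thesis
    unfolding peter_weyl_def mem_Collect_eq tensor_funs_iff[OF subspace_cont_funs] RF_eq_representative_funs[symmetric]
    by blast
qed

lemma PW_I:
  fixes n :: nat
  assumes "a \<in> CX" "\<And>i. i < n \<Longrightarrow> c i \<in> CX" "\<And>i. i < n \<Longrightarrow> h i \<in> RF"
    "\<And>x g. x \<in> X \<Longrightarrow> a (act x g) = (\<Sum>i<n. c i x * h i g)"
  shows "a \<in> PW"
  unfolding PW_iff
  by (intro conjI exI[of _ "map (\<lambda>i. (c i, h i)) [0..<n]"])
    (use assms in \<open>auto simp: o_def sum_list_distinct_conv_sum_set atLeast0LessThan\<close>)

lemma PW_mult: assumes "a \<in> PW" "b \<in> PW" shows "(\<lambda>x. a x * b x) \<in> PW"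
proof -
  obtain ps where ps: "a \<in> CX" "\<forall>p\<in>set ps. fst p \<in> CX \<and> snd p \<in> RF"
    "\<And>x g. x \<in> X \<Longrightarrow> a (act x g) = (\<Sum>p\<leftarrow>ps. fst p x * snd p g)" using assms(1) unfolding PW_iff by blast
  obtain qs where qs: "b \<in> CX" "\<forall>p\<in>set qs. fst p \<in> CX \<and> snd p \<in> RF"
    "\<And>x g. x \<in> X \<Longrightarrow> b (act x g) = (\<Sum>p\<leftarrow>qs. fst p x * snd p g)" using assms(2) unfolding PW_iff by blast
  let ?rs = "map (\<lambda>p. (\<lambda>x. fst (fst p) x * fst (snd p) x, \<lambda>x. snd (fst p) x * snd (snd p) x)) (List.product ps qs)"
  have "\<forall>p\<in>set ?rs. fst p \<in> CX \<and> snd p \<in> RF"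
    using ps(2) qs(2) by (auto intro!: CX_mult RF_mult)
  moreover have "a (act x g) * b (act x g) = (\<Sum>p\<leftarrow>?rs. fst p x * snd p g)" if "x \<in> X" for x g
    unfolding ps(3)[OF that] qs(3)[OF that] sum_list_times_sum_list by (simp add: o_def mult_ac)
  ultimately show ?thesis unfolding PW_iff using CX_mult[OF ps(1) qs(1)] by blast
qed

text \<open>All second factors occurring for \<open>B\<close> are written in one left invariant
  basis \<open>r\<close>. Linear independence of \<open>r\<close> permits comparing coefficients in
  \<open>b (act x (g + h))\<close>, and the resulting transformation law puts the coefficients in
  \<open>PW\<close>. This is the restriction of the coaction to the Peter-Weyl subalgebra, in
  coordinates.\<close>

lemma comodule_expansion:
  assumes B: "finite B" "B \<subseteq> PW"
  obtains n r l co where "orthonormal n r" "matrix_rep n l"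
    "\<And>j g h. j < n \<Longrightarrow> r j (g + h) = (\<Sum>i<n. l j i g * r i h)"
    "\<And>b i. b \<in> B \<Longrightarrow> co b i \<in> CX"
    "\<And>b i. b \<in> B \<Longrightarrow> i < n \<Longrightarrow> co b i \<in> PW"
    "\<And>b x g. b \<in> B \<Longrightarrow> x \<in> X \<Longrightarrow> b (act x g) = (\<Sum>i<n. co b i x * r i g)"
    "\<And>b i x g. b \<in> B \<Longrightarrow> i < n \<Longrightarrow> x \<in> X \<Longrightarrow> co b i (act x g) = (\<Sum>m<n. co b m x * l m i g)"
proof -
  have "\<forall>b\<in>B. \<exists>ps. (\<forall>p\<in>set ps. fst p \<in> CX \<and> snd p \<in> RF) \<and>
    (\<forall>x\<in>X. \<forall>g. b (act x g) = (\<Sum>p\<leftarrow>ps. fst p x * snd p g))"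
    using B(2) unfolding PW_iff subset_iff by blast
  then obtain P where P: "\<forall>b\<in>B. (\<forall>p\<in>set (P b). fst p \<in> CX \<and> snd p \<in> RF) \<and>
    (\<forall>x\<in>X. \<forall>g. b (act x g) = (\<Sum>p\<leftarrow>P b. fst p x * snd p g))"
    unfolding bchoice_iff ..
  have P1: "fst p \<in> CX" "snd p \<in> RF" if "b \<in> B" "p \<in> set (P b)" for b p using P that by auto
  have P2: "b (act x g) = (\<Sum>p\<leftarrow>P b. fst p x * snd p g)" if "b \<in> B" "x \<in> X" for b x g using P that by auto
  define H where "H = (\<Union>b\<in>B. snd ` set (P b))"
  have H: "finite H" "H \<subseteq> RF" using B(1) P1 by (auto simp: H_def)
  obtain n r l where r: "orthonormal n r" and l: "matrix_rep n l"
    and inv: "\<And>j g h. j < n \<Longrightarrow> r j (g + h) = (\<Sum>i<n. l j i g * r i h)"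
    and ex: "\<And>f x. f \<in> H \<Longrightarrow> f x = (\<Sum>i<n. ip f (r i) * r i x)"
    by (rule left_invariant_basis[OF H]) blast
  define co where "co = (\<lambda>b i x. \<Sum>p\<leftarrow>P b. fst p x * ip (snd p) (r i))"
  have coC: "co b i \<in> CX" if "b \<in> B" for b i
  proof -
    have "(\<lambda>x. \<Sum>p\<leftarrow>ps. fst p x * ip (snd p) (r i)) \<in> CX" if "\<forall>p\<in>set ps. fst p \<in> CX" for ps
      using that
    proof (induction ps)
      case Nil show ?case using cfun.subspace_0[OF subspace_cont_funs, of X] by (simp add: zero_fun_def)
    next
      case (Cons p ps)
      then show ?case using CX_intros(2)[of "fst p" "ip (snd p) (r i)"] by (auto intro!: CX_intros(1) simp: mult.commute)
    qed
    then show ?thesis unfolding co_def using P1 that by blast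
  qed
  have expand: "b (act x g) = (\<Sum>i<n. co b i x * r i g)" if b: "b \<in> B" "x \<in> X" for b x g
  proof -
    have "snd p \<in> H" if "p \<in> set (P b)" for p using b(1) that by (auto simp: H_def)
    then have "(\<Sum>p\<leftarrow>P b. fst p x * snd p g) = (\<Sum>p\<leftarrow>P b. \<Sum>i<n. fst p x * ip (snd p) (r i) * r i g)"
      by (intro arg_cong[of _ _ sum_list] map_cong refl) (subst ex, auto simp: sum_distrib_left mult.assoc)
    also have "\<dots> = (\<Sum>i<n. co b i x * r i g)"
    proof -
      have "(\<Sum>p\<leftarrow>ps. \<Sum>i<n. fst p x * ip (snd p) (r i) * r i g) = (\<Sum>i<n. (\<Sum>p\<leftarrow>ps. fst p x * ip (snd p) (r i)) * r i g)"
        for ps :: "(('x \<Rightarrow> complex) \<times> ('g \<Rightarrow> complex)) list"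
        by (induction ps) (auto simp: sum.distrib distrib_right)
      then show ?thesis by (simp add: co_def)
    qed
    finally show ?thesis unfolding P2[OF b] .
  qed
  have co_act: "co b i (act x g) = (\<Sum>m<n. co b m x * l m i g)" if b: "b \<in> B" "i < n" "x \<in> X" for b i x g
  proof -
    have "(\<Sum>i<n. co b i (act x g) * r i h) = (\<Sum>i<n. (\<Sum>m<n. co b m x * l m i g) * r i h)" for h
    proof -
      have "(\<Sum>i<n. co b i (act x g) * r i h) = b (act x (g + h))"
        using expand[OF b(1) act_in[OF b(3)], of g h] b(3) by (simp add: act_act)
      also have "\<dots> = (\<Sum>m<n. co b m x * r m (g + h))" by (rule expand[OF b(1,3)])
      also have "\<dots> = (\<Sum>m<n. \<Sum>i<n. co b m x * l m i g * r i h)"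
        by (intro sum.cong refl) (simp add: inv sum_distrib_left mult.assoc)
      also have "\<dots> = (\<Sum>i<n. \<Sum>m<n. co b m x * l m i g * r i h)" by (rule sum.swap)
      finally show ?thesis by (simp add: sum_distrib_right)
    qed
    from orthonormal_unique[OF r this b(2)] show ?thesis .
  qed
  show thesis
  proof (rule that[OF r l inv coC _ expand co_act])
    show "co b i \<in> PW" if "b \<in> B" "i < n" for b i
      using coC[OF that(1)] matrix_rep_RF[OF l] that co_act[OF that]
      by (intro PW_I[where n = n and c = "co b" and h = "\<lambda>m. l m i"]) auto
  qed
qed

abbreviation can_bil where "can_bil \<equiv> (\<lambda>x y. simple_tensor x 1 * coaction X act y)"

lemma can_bil_apply: "x \<in> X \<Longrightarrow> can_bil a b (x, g) = a x * b (act x g)"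
  by (simp add: simple_tensor_def coaction_def)

lemma can_bil_zero: "x \<notin> X \<Longrightarrow> can_bil a b (x, g) = 0"
  by (simp add: coaction_def)

lemma basis_RF:
  assumes "orthonormal n r" "matrix_rep n l" "\<And>j g h. j < n \<Longrightarrow> r j (g + h) = (\<Sum>i<n. l j i g * r i h)" "j < n"
  shows "r j \<in> RF"
  by (rule RF_sumI[where n = n and a = "l j" and b = r]) (use assms in \<open>auto simp: orthonormal_def matrix_rep_def\<close>)

text \<open>Here the coefficients \<open>co b i\<close> have to lie in \<open>PW\<close> and not
  merely in \<open>CX\<close>.\<close>

lemma can_bil_in:
  assumes a: "a \<in> PW" and b: "b \<in> PW"
  shows "can_bil a b \<in> tensor_funs PW representative_funs"
proof -
  obtain n r l co where r: "orthonormal n r" and l: "matrix_rep n l"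
    and inv: "\<And>j g h. j < n \<Longrightarrow> r j (g + h) = (\<Sum>i<n. l j i g * r i h)"
    and co: "\<And>c i. c \<in> {b} \<Longrightarrow> i < n \<Longrightarrow> co c i \<in> PW"
      "\<And>c x g. c \<in> {b} \<Longrightarrow> x \<in> X \<Longrightarrow> c (act x g) = (\<Sum>i<n. co c i x * r i g)"
    by (rule comodule_expansion[of "{b}"]) (use b in auto)
  have "can_bil a b = (\<lambda>z. \<Sum>p\<leftarrow>map (\<lambda>i. (\<lambda>x. a x * co b i x, r i)) [0..<n]. fst p (fst z) * snd p (snd z))"
  proof
    fix z :: "'x \<times> 'g"
    show "can_bil a b z = (\<Sum>p\<leftarrow>map (\<lambda>i. (\<lambda>x. a x * co b i x, r i)) [0..<n]. fst p (fst z) * snd p (snd z))"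
    proof (cases "fst z \<in> X")
      case True
      then show ?thesis using co(2)[of b "fst z" "snd z"] can_bil_apply[of "fst z" a b "snd z"]
        by (simp add: o_def sum_list_distinct_conv_sum_set atLeast0LessThan sum_distrib_left mult.assoc)
    next
      case False
      then show ?thesis using CX_zero[OF PW_sub_CX[OF a], of "fst z"] can_bil_zero[of "fst z" a b "snd z"]
        by (simp add: o_def)
    qed
  qed
  moreover have "\<forall>p\<in>set (map (\<lambda>i. (\<lambda>x. a x * co b i x, r i)) [0..<n]). fst p \<in> PW \<and> snd p \<in> representative_funs"
    using PW_mult[OF a co(1)] basis_RF[OF r l inv] by (auto simp flip: RF_eq_representative_funs)
  ultimately show ?thesis unfolding tensor_funs_iff[OF subspace_peter_weyl] by blast
qed

text \<open>The equivariance formulas are themselves finite expansions with second factors in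
  \<open>RF\<close>.\<close>

lemma frame_PW:
  assumes fr: "frame n l K \<Psi> \<Phi>" and l: "matrix_rep n l"
  shows "\<And>i k. i < n \<Longrightarrow> k \<in> K \<Longrightarrow> \<Psi> i k \<in> PW" "\<And>k j. k \<in> K \<Longrightarrow> j < n \<Longrightarrow> \<Phi> k j \<in> PW"
proof -
  note K = frameD[OF fr]
  show "\<Psi> i k \<in> PW" if "i < n" "k \<in> K" for i k
    using that K RF_reflect[OF matrix_rep_RF[OF l]]
    by (intro PW_I[where n = n and c = "\<lambda>m. \<Psi> m k" and h = "\<lambda>m g. l i m (- g)"]) (auto simp: mult.commute)
  show "\<Phi> k j \<in> PW" if "k \<in> K" "j < n" for k j
    using that K matrix_rep_RF[OF l]
    by (intro PW_I[where n = n and c = "\<Phi> k" and h = "\<lambda>m. l m j"]) auto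
qed

text \<open>With \<open>\<eta>\<close> the row of coefficients of \<open>h\<close> in the basis
  \<open>r\<close>, \<open>h(g) = \<eta> r(g) = \<eta> l(g) r(0) = \<eta> \<Psi>(x) \<Phi>(x g)
  r(0)\<close>. Splitting this product between \<open>x\<close> and \<open>x g\<close> gives
  \<open>A = a \<eta> \<Psi>\<close> and \<open>B = \<Phi> r(0)\<close>.\<close>

lemma simple_tensor_in_range:
  assumes free: "free_action X act" and a: "a \<in> PW" and h: "h \<in> RF"
  obtains K :: "(nat \<times> nat) set" and A B where "finite K" "\<And>k. k \<in> K \<Longrightarrow> A k \<in> PW" "\<And>k. k \<in> K \<Longrightarrow> B k \<in> PW"
    "simple_tensor a h = (\<Sum>k\<in>K. can_bil (A k) (B k))"
proof -
  obtain n r l where r: "orthonormal n r" and l: "matrix_rep n l"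
    and inv: "\<And>j g h. j < n \<Longrightarrow> r j (g + h) = (\<Sum>i<n. l j i g * r i h)"
    and ex: "\<And>f x. f \<in> {h} \<Longrightarrow> f x = (\<Sum>i<n. ip f (r i) * r i x)"
    by (rule left_invariant_basis[of "{h}"]) (use h in auto)
  obtain K :: "(nat \<times> nat) set" and \<Psi> \<Phi> where fr: "frame n l K \<Psi> \<Phi>"
    using ex_frame[OF free l] by blast
  note K = frameD(1)[OF fr] frame_PW[OF fr l] frameD(4-6)[OF fr]
  define A where "A = (\<lambda>k x. a x * (\<Sum>i<n. ip h (r i) * \<Psi> i k x))"
  define B where "B = (\<lambda>k x. \<Sum>j<n. r j 0 * \<Phi> k j x)"
  have l_eq: "(\<Sum>k\<in>K. \<Psi> i k x * \<Phi> k j (act x g)) = l i j g" if "i < n" "j < n" "x \<in> X" for i j x g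
  proof -
    have "(\<Sum>k\<in>K. \<Psi> i k x * \<Phi> k j (act x g)) = (\<Sum>k\<in>K. \<Sum>m<n. \<Psi> i k x * \<Phi> k m x * l m j g)"
      using that by (intro sum.cong refl) (simp add: K(5) sum_distrib_left mult.assoc)
    also have "\<dots> = (\<Sum>m<n. \<Sum>k\<in>K. \<Psi> i k x * \<Phi> k m x * l m j g)" by (rule sum.swap)
    also have "\<dots> = (\<Sum>m<n. (if i = m then 1 else 0) * l m j g)"
      using that K(6) by (intro sum.cong refl) (simp flip: sum_distrib_right)
    also have "\<dots> = (\<Sum>m<n. if i = m then l m j g else 0)" by (intro sum.cong) auto
    finally show ?thesis using that by simp
  qed
  have "simple_tensor a h z = (\<Sum>k\<in>K. can_bil (A k) (B k)) z" for z
  proof (cases "fst z \<in> X")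
    case True
    obtain x g where z: "z = (x, g)" by fastforce
    have x: "x \<in> X" using True z by simp
    have "(\<Sum>k\<in>K. can_bil (A k) (B k)) z = (\<Sum>k\<in>K. A k x * B k (act x g))"
      unfolding sum_fun_apply z using can_bil_apply[OF x] by simp
    also have "\<dots> = (\<Sum>k\<in>K. \<Sum>i<n. \<Sum>j<n. a x * ip h (r i) * r j 0 * (\<Psi> i k x * \<Phi> k j (act x g)))"
      unfolding A_def B_def by (intro sum.cong refl) (simp only: mult.assoc sum_product, simp only: sum_distrib_left, intro sum.cong refl, simp only: mult_ac)
    also have "\<dots> = (\<Sum>i<n. \<Sum>k\<in>K. \<Sum>j<n. a x * ip h (r i) * r j 0 * (\<Psi> i k x * \<Phi> k j (act x g)))"
      by (rule sum.swap)
    also have "\<dots> = (\<Sum>i<n. \<Sum>j<n. \<Sum>k\<in>K. a x * ip h (r i) * r j 0 * (\<Psi> i k x * \<Phi> k j (act x g)))"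
      by (intro sum.cong refl sum.swap)
    also have "\<dots> = (\<Sum>i<n. \<Sum>j<n. a x * ip h (r i) * r j 0 * l i j g)"
      using x by (intro sum.cong refl) (simp add: l_eq flip: sum_distrib_left)
    also have "\<dots> = (\<Sum>i<n. a x * ip h (r i) * (\<Sum>j<n. l i j g * r j 0))"
      by (simp add: sum_distrib_left mult_ac)
    also have "\<dots> = (\<Sum>i<n. a x * ip h (r i) * r i g)"
      using inv[of _ g 0] by (intro sum.cong refl) simp
    also have "\<dots> = a x * h g" using ex[of h g] by (simp add: sum_distrib_left mult.assoc)
    finally show ?thesis by (simp add: z simple_tensor_def)
  next
    case False
    then show ?thesis using CX_zero[OF PW_sub_CX[OF a], of "fst z"]
      unfolding sum_fun_apply by (cases z) (simp add: simple_tensor_def coaction_def)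
  qed
  moreover have "A k \<in> PW" "B k \<in> PW" if "k \<in> K" for k
    unfolding A_def B_def using that K(2,3) by (intro PW_mult a PW_intros(5); simp)+
  ultimately show thesis using that[OF K(1)] by blast
qed

section \<open>The relations of the balanced tensor product and injectivity\<close>

abbreviation IF where "IF \<equiv> invariant_funs X act"
abbreviation FA where "FA \<equiv> free_Abelian_group (PW \<times> PW)"
abbreviation NT where "NT \<equiv> tensor_null IF (*) (*) PW PW"

context
  notes [simp del] = plus_fun_apply zero_fun_apply minus_apply uminus_apply times_fun_apply one_fun_apply
begin

lemma NT_subgroup: "subgroup NT FA"
  by (intro normal_imp_subgroup tensor_null_normal module_closed_peter_weyl)

lemma NT_keys: "t \<in> NT \<Longrightarrow> Poly_Mapping.keys t \<subseteq> PW \<times> PW"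
  using subsetD[OF subgroup.subset[OF NT_subgroup], of t]
  by (simp only: carrier_free_Abelian_group_iff)

lemma NT_add: "s \<in> NT \<Longrightarrow> t \<in> NT \<Longrightarrow> s + t \<in> NT"
  using subgroup.m_closed[OF NT_subgroup, of s t] by simp

lemma NT_minus: "t \<in> NT \<Longrightarrow> - t \<in> NT"
  using subgroup.m_inv_closed[OF NT_subgroup, of t] by (simp add: NT_keys)

lemma NT_diff: "s \<in> NT \<Longrightarrow> t \<in> NT \<Longrightarrow> s - t \<in> NT"
  using NT_add[of s "- t"] NT_minus[of t] by simp

lemma NT_0: "0 \<in> NT"
  unfolding tensor_null_def using generate.one[of FA] by simp

lemma NT_sum: "(\<And>i. i \<in> I \<Longrightarrow> t i \<in> NT) \<Longrightarrow> (\<Sum>i\<in>I. t i) \<in> NT"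
  by (induction I rule: infinite_finite_induct) (auto simp: NT_0 intro: NT_add)

lemma NT_rels:
  "a \<in> PW \<Longrightarrow> b \<in> PW \<Longrightarrow> h \<in> PW \<Longrightarrow> frag_of (a + b, h) - frag_of (a, h) - frag_of (b, h) \<in> NT"
  "a \<in> PW \<Longrightarrow> h \<in> PW \<Longrightarrow> k \<in> PW \<Longrightarrow> frag_of (a, h + k) - frag_of (a, h) - frag_of (a, k) \<in> NT"
  "c \<in> IF \<Longrightarrow> a \<in> PW \<Longrightarrow> h \<in> PW \<Longrightarrow> frag_of (c * a, h) - frag_of (a, c * h) \<in> NT"
  unfolding tensor_null_def tensor_relations_def by (rule generate.incl; blast)+

lemma PW_0: "0 \<in> PW"
  by (rule cfun.subspace_0[OF subspace_peter_weyl])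

lemma PW_sum: "(\<And>i. i \<in> I \<Longrightarrow> f i \<in> PW) \<Longrightarrow> (\<Sum>i\<in>I. f i) \<in> PW"
  by (rule cfun.subspace_sum[OF subspace_peter_weyl])

lemma NT_zero_left: "h \<in> PW \<Longrightarrow> frag_of (0, h) \<in> NT"
  using NT_minus[OF NT_rels(1)[of 0 0 h]] PW_0 by simp

lemma NT_zero_right: "a \<in> PW \<Longrightarrow> frag_of (a, 0) \<in> NT"
  using NT_minus[OF NT_rels(2)[of a 0 0]] PW_0 by simp

lemma NT_sum_left:
  assumes "h \<in> PW" "\<And>i. i \<in> I \<Longrightarrow> f i \<in> PW" "finite I"
  shows "frag_of (\<Sum>i\<in>I. f i, h) - (\<Sum>i\<in>I. frag_of (f i, h)) \<in> NT"
  using assms(3,2)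
proof (induction I)
  case empty
  show ?case using NT_zero_left[OF assms(1)] by simp
next
  case (insert i I)
  have "(frag_of (f i + (\<Sum>i\<in>I. f i), h) - frag_of (f i, h) - frag_of (\<Sum>i\<in>I. f i, h)) +
      (frag_of (\<Sum>i\<in>I. f i, h) - (\<Sum>i\<in>I. frag_of (f i, h))) \<in> NT"
    using insert by (intro NT_add NT_rels PW_sum assms(1)) auto
  then show ?case using insert.hyps by (simp add: algebra_simps)
qed

lemma NT_sum_right:
  assumes "a \<in> PW" "\<And>i. i \<in> I \<Longrightarrow> f i \<in> PW" "finite I"
  shows "frag_of (a, \<Sum>i\<in>I. f i) - (\<Sum>i\<in>I. frag_of (a, f i)) \<in> NT"
  using assms(3,2)
proof (induction I)
  case empty
  show ?case using NT_zero_right[OF assms(1)] by simp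
next
  case (insert i I)
  have "(frag_of (a, f i + (\<Sum>i\<in>I. f i)) - frag_of (a, f i) - frag_of (a, \<Sum>i\<in>I. f i)) +
      (frag_of (a, \<Sum>i\<in>I. f i) - (\<Sum>i\<in>I. frag_of (a, f i))) \<in> NT"
    using insert by (intro NT_add NT_rels PW_sum assms(1)) auto
  then show ?case using insert.hyps by (simp add: algebra_simps)
qed

text \<open>Modulo the relations a negative coefficient can be absorbed as a sign of the first
  factor, so every element is a plain sum of elementary tensors.\<close>

lemma NT_list_representation:
  assumes "Poly_Mapping.keys t \<subseteq> PW \<times> PW"
  shows "\<exists>ps. set ps \<subseteq> PW \<times> PW \<and> t - sum_list (map frag_of ps) \<in> NT"
  using assms
proof (induction t rule: frag_induction)
  case zero
  show ?case by (rule exI[of _ "[]"]) (simp add: NT_0)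
next
  case (one p)
  then show ?case by (intro exI[of _ "[p]"]) (simp add: NT_0)
next
  case (diff s t)
  then obtain ps qs where
    ps: "set ps \<subseteq> PW \<times> PW" "s - sum_list (map frag_of ps) \<in> NT" and
    qs: "set qs \<subseteq> PW \<times> PW" "t - sum_list (map frag_of qs) \<in> NT"
    by blast
  let ?neg = "\<lambda>p. (- fst p, snd p)"
  have neg: "- a \<in> PW" if "a \<in> PW" for a by (rule cfun.subspace_neg[OF subspace_peter_weyl that])
  have "sum_list (map frag_of qs) + sum_list (map (frag_of \<circ> ?neg) qs) \<in> NT"
    using qs(1)
  proof (induction qs)
    case Nil show ?case by (simp add: NT_0)
  next
    case (Cons p qs)
    obtain a h where p: "p = (a, h)" by fastforce
    have "a \<in> PW" "h \<in> PW" "- a \<in> PW" using Cons.prems neg by (auto simp: p)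
    then have "frag_of (a, h) + frag_of (- a, h) \<in> NT"
      using NT_diff[OF NT_zero_left[of h] NT_rels(1)[of a "- a" h]] by (simp add: algebra_simps)
    moreover have "sum_list (map frag_of qs) + sum_list (map (frag_of \<circ> ?neg) qs) \<in> NT"
      using Cons by (simp add: o_def)
    ultimately have "(frag_of (a, h) + frag_of (- a, h)) +
        (sum_list (map frag_of qs) + sum_list (map (frag_of \<circ> ?neg) qs)) \<in> NT"
      by (rule NT_add)
    then show ?case by (simp add: p o_def algebra_simps)
  qed
  from NT_diff[OF NT_diff[OF ps(2) qs(2)] this]
  have "s - t - sum_list (map frag_of (ps @ map ?neg qs)) \<in> NT"
    by (simp add: algebra_simps)
  moreover have "set (ps @ map ?neg qs) \<subseteq> PW \<times> PW"
    using ps(1) qs(1) neg by auto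
  ultimately show ?case by blast
qed

text \<open>
  Each \<open>b s\<close> is a combination of the functions \<open>\<phi> k\<close>, which do not depend on \<open>s\<close>, with invariant
  coefficients \<open>c s k\<close>. Moving the coefficients across the tensor sign leaves the tensors of
  \<open>\<Sum>s<N. c s k * a s\<close> and \<open>\<phi> k\<close>, and the first factors vanish because the \<open>r i\<close> are linearly
  independent.
\<close>

lemma can_bil_kernel_sum:
  fixes N :: nat
  assumes free: "free_action X act"
    and ab: "\<And>s. s < N \<Longrightarrow> a s \<in> PW" "\<And>s. s < N \<Longrightarrow> b s \<in> PW"
    and zero: "\<And>x g. x \<in> X \<Longrightarrow> (\<Sum>s<N. a s x * b s (act x g)) = 0"
  shows "(\<Sum>s<N. frag_of (a s, b s)) \<in> NT"
proof -
  obtain n r l co where r: "orthonormal n r" and l: "matrix_rep n l"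
    and inv: "\<And>j g h. j < n \<Longrightarrow> r j (g + h) = (\<Sum>i<n. l j i g * r i h)"
    and coC: "\<And>c i. c \<in> b ` {..<N} \<Longrightarrow> co c i \<in> CX"
    and co: "\<And>c x g. c \<in> b ` {..<N} \<Longrightarrow> x \<in> X \<Longrightarrow> c (act x g) = (\<Sum>i<n. co c i x * r i g)"
      "\<And>c i x g. c \<in> b ` {..<N} \<Longrightarrow> i < n \<Longrightarrow> x \<in> X \<Longrightarrow> co c i (act x g) = (\<Sum>m<n. co c m x * l m i g)"
    by (rule comodule_expansion[of "b ` {..<N}"]) (use ab(2) in auto)
  obtain K :: "(nat \<times> nat) set" and \<Psi> \<Phi> where fr: "frame n l K \<Psi> \<Phi>"
    using ex_frame[OF free l] by blast
  note K = frameD(1)[OF fr] frame_PW[OF fr l] frameD(4-6)[OF fr]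
  define \<phi> where "\<phi> = (\<lambda>k x. \<Sum>j<n. r j 0 * \<Phi> k j x)"
  define c where "c = (\<lambda>s k x. \<Sum>i<n. co (b s) i x * \<Psi> i k x)"
  have \<phi>: "\<phi> k \<in> PW" if "k \<in> K" for k unfolding \<phi>_def using that K(3) by (intro PW_intros(5)) auto
  have cI: "c s k \<in> IF" if s: "s < N" "k \<in> K" for s k
    unfolding invariant_funs_iff
  proof (intro conjI ballI allI)
    have "(\<lambda>x. \<Sum>i<n. 1 * (co (b s) i x * \<Psi> i k x)) \<in> CX"
      using s by (intro CX_intros(5) CX_mult coC PW_sub_CX K) auto
    then show "c s k \<in> CX" by (simp add: c_def)
    fix x g assume x: "x \<in> X"
    have "c s k (act x g) = (\<Sum>i<n. (\<Sum>m<n. co (b s) m x * l m i g) * (\<Sum>q<n. l i q (- g) * \<Psi> q k x))"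
      unfolding c_def using s x by (intro sum.cong refl) (simp add: co K)
    also have "\<dots> = (\<Sum>i<n. \<Sum>m<n. \<Sum>q<n. co (b s) m x * \<Psi> q k x * (l m i g * l i q (- g)))"
      by (intro sum.cong refl) (simp only: sum_product, intro sum.cong refl, simp only: mult_ac)
    also have "\<dots> = (\<Sum>m<n. \<Sum>i<n. \<Sum>q<n. co (b s) m x * \<Psi> q k x * (l m i g * l i q (- g)))"
      by (rule sum.swap)
    also have "\<dots> = (\<Sum>m<n. \<Sum>q<n. \<Sum>i<n. co (b s) m x * \<Psi> q k x * (l m i g * l i q (- g)))"
      by (intro sum.cong refl sum.swap)
    also have "\<dots> = (\<Sum>m<n. \<Sum>q<n. co (b s) m x * \<Psi> q k x * (if m = q then 1 else 0))"
    proof (intro sum.cong refl)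
      fix m q assume "m \<in> {..<n}" "q \<in> {..<n}"
      then have mq: "m < n" "q < n" by auto
      have "(\<Sum>i<n. l m i g * l i q (- g)) = l m q (g + - g)"
        using l mq unfolding matrix_rep_def by presburger
      also have "\<dots> = (if m = q then 1 else 0)" using l mq by (simp add: matrix_rep_def)
      finally show "(\<Sum>i<n. co (b s) m x * \<Psi> q k x * (l m i g * l i q (- g))) =
          co (b s) m x * \<Psi> q k x * (if m = q then 1 else 0)"
        by (simp flip: sum_distrib_left)
    qed
    also have "\<dots> = c s k x"
      unfolding c_def by (intro sum.cong refl) (simp add: if_distrib[of "\<lambda>a. _ * a"] cong: if_cong)
    finally show "c s k (act x g) = c s k x" .
  qed
  \<comment> \<open>Insert \<open>\<Psi> \<Phi> = 1\<close> into the expansion of \<open>b s\<close>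
    at the group element 0.\<close>
  have b_eq: "b s = (\<Sum>k\<in>K. c s k * \<phi> k)" if s: "s < N" for s
  proof
    fix x
    show "b s x = (\<Sum>k\<in>K. c s k * \<phi> k) x"
    proof (cases "x \<in> X")
      case True
      have "(\<Sum>k\<in>K. c s k * \<phi> k) x = (\<Sum>k\<in>K. \<Sum>i<n. \<Sum>j<n. co (b s) i x * r j 0 * (\<Psi> i k x * \<Phi> k j x))"
        unfolding sum_fun_apply times_fun_apply c_def \<phi>_def
        by (intro sum.cong refl) (simp only: sum_product, intro sum.cong refl, simp only: mult_ac)
      also have "\<dots> = (\<Sum>i<n. \<Sum>k\<in>K. \<Sum>j<n. co (b s) i x * r j 0 * (\<Psi> i k x * \<Phi> k j x))"
        by (rule sum.swap)
      also have "\<dots> = (\<Sum>i<n. \<Sum>j<n. \<Sum>k\<in>K. co (b s) i x * r j 0 * (\<Psi> i k x * \<Phi> k j x))"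
        by (intro sum.cong refl sum.swap)
      also have "\<dots> = (\<Sum>i<n. \<Sum>j<n. co (b s) i x * r j 0 * (if i = j then 1 else 0))"
        using True K(6) by (intro sum.cong refl) (simp flip: sum_distrib_left)
      also have "\<dots> = (\<Sum>i<n. co (b s) i x * r i 0)"
        by (intro sum.cong refl) (simp add: if_distrib[of "\<lambda>a. _ * a"] cong: if_cong)
      also have "\<dots> = b s x" using co(1)[of "b s" x 0] s True by simp
      finally show ?thesis by simp
    next
      case False
      have "c s k x = 0" if "k \<in> K" for k
        using CX_zero[of "c s k" x] cI[OF s that] False by (simp add: invariant_funs_iff)
      then show ?thesis unfolding sum_fun_apply times_fun_apply
        using CX_zero[OF PW_sub_CX[OF ab(2)[OF s]] False] by simp
    qed
  qed
  have ca: "c s k * a s \<in> PW" "c s k * \<phi> k \<in> PW" if "s < N" "k \<in> K" for s k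
    using that by (intro peter_weyl_invariant_mult cI ab \<phi>; simp)+
  have one: "frag_of (a s, b s) - (\<Sum>k\<in>K. frag_of (c s k * a s, \<phi> k)) \<in> NT" if s: "s < N" for s
  proof -
    have "(frag_of (a s, \<Sum>k\<in>K. c s k * \<phi> k) - (\<Sum>k\<in>K. frag_of (a s, c s k * \<phi> k)))
      - (\<Sum>k\<in>K. frag_of (c s k * a s, \<phi> k) - frag_of (a s, c s k * \<phi> k)) \<in> NT"
      using s by (intro NT_diff NT_sum_right NT_sum NT_rels ab ca cI \<phi> K(1)) auto
    then show ?thesis unfolding b_eq[OF s, symmetric] by (simp add: sum_subtractf)
  qed
  have csum: "(\<Sum>s<N. c s k * a s) = 0" if k: "k \<in> K" for k
  proof
    fix x
    show "(\<Sum>s<N. c s k * a s) x = 0 x"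
    proof (cases "x \<in> X")
      case True
      \<comment> \<open>For fixed \<open>x\<close> the hypothesis \<open>zero\<close> is a linear
        relation among the functions \<open>r i\<close> of the variable \<open>g\<close>, so each of
        its coefficients vanishes.\<close>
      have co0: "(\<Sum>s<N. a s x * co (b s) i x) = 0" if "i < n" for i
      proof -
        have "(\<Sum>i<n. (\<Sum>s<N. a s x * co (b s) i x) * r i g) = (\<Sum>i<n. 0 * r i g)" for g
        proof -
          have "(\<Sum>i<n. (\<Sum>s<N. a s x * co (b s) i x) * r i g) = (\<Sum>i<n. \<Sum>s<N. a s x * (co (b s) i x * r i g))"
            by (simp add: sum_distrib_right mult.assoc)
          also have "\<dots> = (\<Sum>s<N. \<Sum>i<n. a s x * (co (b s) i x * r i g))" by (rule sum.swap)
          also have "\<dots> = (\<Sum>s<N. a s x * b s (act x g))"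
            using co(1) True by (intro sum.cong refl) (simp flip: sum_distrib_left)
          finally show ?thesis using zero[OF True] by simp
        qed
        from orthonormal_unique[OF r this that] show ?thesis .
      qed
      have "(\<Sum>s<N. c s k * a s) x = (\<Sum>s<N. \<Sum>i<n. a s x * co (b s) i x * \<Psi> i k x)"
        unfolding sum_fun_apply times_fun_apply c_def
        by (intro sum.cong refl) (simp only: sum_distrib_right, intro sum.cong refl, simp only: mult_ac)
      also have "\<dots> = (\<Sum>i<n. \<Sum>s<N. a s x * co (b s) i x * \<Psi> i k x)" by (rule sum.swap)
      also have "\<dots> = (\<Sum>i<n. (\<Sum>s<N. a s x * co (b s) i x) * \<Psi> i k x)" by (simp add: sum_distrib_right)
      also have "\<dots> = 0" by (intro sum.neutral) (simp add: co0)
      finally show ?thesis by (simp add: zero_fun_apply)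
    next
      case False
      have "(\<Sum>s<N. c s k * a s) \<in> PW" using k by (intro PW_sum ca) auto
      from CX_zero[OF PW_sub_CX[OF this] False] show ?thesis by (simp add: zero_fun_apply)
    qed
  qed
  have col: "(\<Sum>s<N. frag_of (c s k * a s, \<phi> k)) \<in> NT" if k: "k \<in> K" for k
  proof -
    have "frag_of (\<Sum>s<N. c s k * a s, \<phi> k) - (\<Sum>s<N. frag_of (c s k * a s, \<phi> k)) \<in> NT"
      using k by (intro NT_sum_left \<phi> ca) auto
    from NT_diff[OF NT_zero_left[OF \<phi>[OF k]] this] show ?thesis unfolding csum[OF k] by simp
  qed
  have "(\<Sum>s<N. frag_of (a s, b s) - (\<Sum>k\<in>K. frag_of (c s k * a s, \<phi> k))) +
      (\<Sum>k\<in>K. \<Sum>s<N. frag_of (c s k * a s, \<phi> k)) \<in> NT"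
    using one col by (intro NT_add[OF NT_sum NT_sum]) auto
  also have "(\<Sum>k\<in>K. \<Sum>s<N. frag_of (c s k * a s, \<phi> k)) = (\<Sum>s<N. \<Sum>k\<in>K. frag_of (c s k * a s, \<phi> k))"
    by (rule sum.swap)
  finally show ?thesis by (simp add: sum_subtractf)
qed

lemma free_lift_sum: "free_lift \<phi> (\<Sum>i\<in>I. t i) = (\<Sum>i\<in>I. free_lift \<phi> (t i))"
  by (induction I rule: infinite_finite_induct) (auto simp: free_lift_add)

lemma can_bil_kernel:
  assumes free: "free_action X act" and t: "Poly_Mapping.keys t \<subseteq> PW \<times> PW" "free_lift can_bil t = 0"
  shows "t \<in> NT"
proof -
  obtain ps where ps: "set ps \<subseteq> PW \<times> PW" "t - sum_list (map frag_of ps) \<in> NT"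
    using NT_list_representation[OF t(1)] by blast
  define a where "a = (\<lambda>s. fst (ps ! s))"
  define b where "b = (\<lambda>s. snd (ps ! s))"
  have ab: "a s \<in> PW" "b s \<in> PW" if "s < length ps" for s
    using ps(1) nth_mem[OF that] by (auto simp: a_def b_def)
  have eq: "sum_list (map frag_of ps) = (\<Sum>s<length ps. frag_of (a s, b s))"
    by (simp add: sum_list_sum_nth atLeast0LessThan a_def b_def)
  have "free_lift can_bil (\<Sum>s<length ps. frag_of (a s, b s)) = 0"
    using free_lift_tensor_null[OF module_closed_peter_weyl module_closed_peter_weyl balanced_can ps(2)] t(2)
    by (simp add: free_lift_diff eq)
  then have z: "(\<Sum>s<length ps. can_bil (a s) (b s)) = 0" by (simp add: free_lift_sum)
  have "(\<Sum>s<length ps. a s x * b s (act x g)) = 0" if "x \<in> X" for x g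
    using fun_cong[OF z, of "(x, g)"] can_bil_apply[OF that] unfolding sum_fun_apply by (simp add: zero_fun_apply)
  from can_bil_kernel_sum[OF free ab this] have "(\<Sum>s<length ps. frag_of (a s, b s)) \<in> NT" .
  from NT_add[OF ps(2)[unfolded eq] this] show ?thesis by simp
qed

lemma carrier_PW_tensor: "carrier (peter_weyl_tensor X act) = (\<lambda>t. NT #>\<^bsub>FA\<^esub> t) ` carrier FA"
  unfolding peter_weyl_tensor_def tensor_product_def FactGroup_def RCOSETS_def by auto

lemma can_map_coset: "can_map X act (NT #>\<^bsub>FA\<^esub> t) = free_lift can_bil t"
  unfolding can_map_def
  by (rule tensor_lift_coset[OF module_closed_peter_weyl module_closed_peter_weyl balanced_can])

text \<open>Both halves are checked on representatives in the free group:
  \<open>can_bil_kernel\<close> gives injectivity, and surjectivity reduces to simple tensors by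
  additivity.\<close>

lemma can_map_bij:
  assumes free: "free_action X act"
  shows "bij_betw (can_map X act) (carrier (peter_weyl_tensor X act)) (tensor_funs PW representative_funs)"
proof -
  interpret N: normal NT FA
    by (rule tensor_null_normal[OF module_closed_peter_weyl module_closed_peter_weyl])
  have "inj_on (can_map X act) (carrier (peter_weyl_tensor X act))"
    unfolding carrier_PW_tensor
  proof (rule inj_onI)
    fix c d
    assume "c \<in> (\<lambda>t. NT #>\<^bsub>FA\<^esub> t) ` carrier FA" "d \<in> (\<lambda>t. NT #>\<^bsub>FA\<^esub> t) ` carrier FA"
      and cd: "can_map X act c = can_map X act d"
    then obtain s t where st: "s \<in> carrier FA" "t \<in> carrier FA" "c = NT #>\<^bsub>FA\<^esub> s" "d = NT #>\<^bsub>FA\<^esub> t"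
      by blast
    have "s - t \<in> NT"
      using st(1,2) cd keys_diff[of s t] unfolding st(3,4) can_map_coset
      by (intro can_bil_kernel free) (auto simp: free_lift_diff)
    then have "s \<in> NT #>\<^bsub>FA\<^esub> t"
      unfolding r_coset_def by (auto intro!: bexI[of _ "s - t"])
    then show "c = d" unfolding st(3,4) using st(2) by (metis N.repr_independence N.is_subgroup)
  qed
  moreover have "free_lift can_bil ` carrier FA = tensor_funs PW representative_funs"
  proof
    have "free_lift can_bil t \<in> tensor_funs PW representative_funs" if "Poly_Mapping.keys t \<subseteq> PW \<times> PW" for t
      using that
    proof (induction t rule: frag_induction)
      case zero
      show ?case unfolding tensor_funs_def free_lift_0 by (rule cfun.span_zero)
    next
      case (one p)
      then show ?case using can_bil_in by (cases p) auto
    next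
      case (diff s t)
      then show ?case unfolding free_lift_diff tensor_funs_def by (intro cfun.span_diff)
    qed
    then show "free_lift can_bil ` carrier FA \<subseteq> tensor_funs PW representative_funs" by auto
    show "tensor_funs PW representative_funs \<subseteq> free_lift can_bil ` carrier FA"
    proof
      fix u assume "u \<in> tensor_funs PW (representative_funs :: ('g \<Rightarrow> complex) set)"
      then obtain ps where ps: "\<forall>p\<in>set ps. fst p \<in> PW \<and> snd p \<in> RF"
        "u = (\<lambda>z. \<Sum>p\<leftarrow>ps. fst p (fst z) * snd p (snd z))"
        unfolding tensor_funs_iff[OF subspace_peter_weyl] RF_eq_representative_funs by blast
      have "(\<lambda>z. \<Sum>p\<leftarrow>ps. fst p (fst z) * snd p (snd z)) \<in> free_lift can_bil ` carrier FA"
        using ps(1)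
      proof (induction ps)
        case Nil
        show ?case by (rule image_eqI[of _ _ 0]) (auto simp: zero_fun_def)
      next
        case (Cons p ps)
        then obtain t where t: "Poly_Mapping.keys t \<subseteq> PW \<times> PW"
          "(\<lambda>z. \<Sum>p\<leftarrow>ps. fst p (fst z) * snd p (snd z)) = free_lift can_bil t" by auto
        obtain K :: "(nat \<times> nat) set" and A B where K: "finite K" "\<And>k. k \<in> K \<Longrightarrow> A k \<in> PW" "\<And>k. k \<in> K \<Longrightarrow> B k \<in> PW"
          "simple_tensor (fst p) (snd p) = (\<Sum>k\<in>K. can_bil (A k) (B k))"
          by (rule simple_tensor_in_range[OF free, of "fst p" "snd p"]) (use Cons.prems in auto)
        have keysK: "Poly_Mapping.keys (\<Sum>k\<in>K. frag_of (A k, B k)) \<subseteq> PW \<times> PW"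
          using keys_sum[of "\<lambda>k. frag_of (A k, B k)" K] K(2,3) by auto
        have "(\<lambda>z. \<Sum>p\<leftarrow>p # ps. fst p (fst z) * snd p (snd z)) =
            simple_tensor (fst p) (snd p) + (\<lambda>z. \<Sum>p\<leftarrow>ps. fst p (fst z) * snd p (snd z))"
          by (auto simp: simple_tensor_def fun_eq_iff plus_fun_apply)
        also have "\<dots> = free_lift can_bil ((\<Sum>k\<in>K. frag_of (A k, B k)) + t)"
          unfolding K(4) t(2) free_lift_add free_lift_sum by simp
        finally show ?case
          using keysK t(1) keys_add[of "\<Sum>k\<in>K. frag_of (A k, B k)" t]
          by (intro image_eqI[of _ _ "(\<Sum>k\<in>K. frag_of (A k, B k)) + t"]) auto
      qed
      then show "u \<in> free_lift can_bil ` carrier FA" using ps(2) by simp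
    qed
  qed
  then have "can_map X act ` carrier (peter_weyl_tensor X act) = tensor_funs PW representative_funs"
    unfolding carrier_PW_tensor image_image can_map_coset .
  ultimately show ?thesis by (simp add: bij_betw_def)
qed

end

end

section \<open>Representative functions separate points\<close>

context compact_group
begin

text \<open>Arzela-Ascoli without a metric on the group: for each \<open>m\<close> finitely many
  points \<open>D m\<close> control all \<open>f n\<close> up to \<open>1 / (m + 1)\<close>, and a
  diagonal subsequence converges at the countably many points obtained in this way.\<close>

lemma equicontinuous_subsequence:
  fixes f :: "nat \<Rightarrow> 'g \<Rightarrow> complex"
  assumes bound: "\<And>n x. norm (f n x) \<le> B"
    and equi: "\<And>x e. e > 0 \<Longrightarrow> \<exists>U. open U \<and> x \<in> U \<and> (\<forall>n. \<forall>y\<in>U. norm (f n y - f n x) < e)"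
    and cont: "\<And>n. f n \<in> C"
  obtains k y where "strict_mono k" "y \<in> C" "uniform_limit UNIV (\<lambda>n. f (k n)) y sequentially"
proof -
  have "\<exists>D. finite D \<and> (\<forall>x. \<exists>d\<in>D. \<forall>n. norm (f n x - f n d) < inverse (real (Suc m)))" for m
  proof -
    have "\<forall>x. \<exists>U. open U \<and> x \<in> U \<and> (\<forall>n. \<forall>y\<in>U. norm (f n y - f n x) < inverse (real (Suc m)))"
      by (intro allI equi) simp
    then obtain U where U: "\<And>x. open (U x)" "\<And>x. x \<in> U x"
      "\<And>x n y. y \<in> U x \<Longrightarrow> norm (f n y - f n x) < inverse (real (Suc m))"
      unfolding choice_iff by blast
    have "UNIV \<subseteq> (\<Union>x. U x)" using U(2) by blast
    then obtain D where D: "finite D" "UNIV \<subseteq> (\<Union>x\<in>D. U x)"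
      using compactE_image[OF compact_UNIV, of UNIV U] U(1) by (metis (no_types, lifting))
    have "\<exists>d\<in>D. \<forall>n. norm (f n x - f n d) < inverse (real (Suc m))" for x
    proof -
      obtain d where "d \<in> D" "x \<in> U d" using D(2) by blast
      then show ?thesis using U(3) by blast
    qed
    then show ?thesis using D(1) by blast
  qed
  then obtain D where D: "\<And>m. finite (D m)"
    "\<And>m x. \<exists>d\<in>D m. \<forall>n. norm (f n x - f n d) < inverse (real (Suc m))" by metis
  have "countable (\<Union>m. D m)" using D(1) by (intro countable_UN) (auto intro: countable_finite)
  from function_convergent_subsequence[OF this, of f B]
  obtain k where k: "strict_mono k" "\<And>x. x \<in> (\<Union>m. D m) \<Longrightarrow> \<exists>l. (\<lambda>n. f (k n) x) \<longlonglongrightarrow> l"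
    using bound by blast
  have "uniformly_Cauchy_on UNIV (\<lambda>n. f (k n))"
  proof (rule uniformly_Cauchy_onI)
    fix e :: real assume e: "e > 0"
    then obtain m where m: "inverse (real (Suc m)) < e / 3" using reals_Archimedean[of "e/3"] by auto
    have "\<forall>d\<in>D m. \<exists>N. \<forall>i\<ge>N. \<forall>j\<ge>N. norm (f (k i) d - f (k j) d) < e / 3"
    proof
      fix d assume "d \<in> D m"
      then have "convergent (\<lambda>n. f (k n) d)" using k(2) by (auto simp: convergent_def)
      then have "Cauchy (\<lambda>n. f (k n) d)" by (rule convergent_Cauchy)
      then show "\<exists>N. \<forall>i\<ge>N. \<forall>j\<ge>N. norm (f (k i) d - f (k j) d) < e / 3"
        using e unfolding Cauchy_iff by (metis divide_pos_pos zero_less_numeral)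
    qed
    then obtain N where N: "\<forall>d\<in>D m. \<forall>i\<ge>N d. \<forall>j\<ge>N d. norm (f (k i) d - f (k j) d) < e / 3"
      unfolding bchoice_iff ..
    define M where "M = Max (insert 0 (N ` D m))"
    have "dist (f (k i) x) (f (k j) x) < e" if ij: "i \<ge> M" "j \<ge> M" for i j x
    proof -
      obtain d where d: "d \<in> D m" "\<And>n. norm (f n x - f n d) < inverse (real (Suc m))" using D(2)[of m x] by blast
      have "N d \<le> M" unfolding M_def using d(1) D(1)[of m] by (intro Max_ge) auto
      then have "norm (f (k i) d - f (k j) d) < e / 3" using N d(1) ij by auto
      moreover have "norm (f (k i) x - f (k i) d) < e / 3" "norm (f (k j) x - f (k j) d) < e / 3"
        using d(2)[of "k i"] d(2)[of "k j"] m by auto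
      ultimately show ?thesis unfolding dist_norm
        using norm_triangle_ineq[of "f (k i) x - f (k i) d" "f (k i) d - f (k j) d"]
          norm_triangle_ineq4[of "f (k i) x - f (k j) d" "f (k j) x - f (k j) d"] by simp
    qed
    then show "\<exists>M. \<forall>x\<in>UNIV. \<forall>m\<ge>M. \<forall>n\<ge>M. dist (f (k m) x) (f (k n) x) < e" by blast
  qed
  then obtain y where y: "uniform_limit UNIV (\<lambda>n. f (k n)) y sequentially"
    using Cauchy_uniformly_convergent uniformly_convergent_on_def by blast
  have "continuous_on UNIV y"
    by (rule uniform_limit_theorem[OF _ y]) (use cont in \<open>auto simp: C_iff\<close>)
  then show thesis using that[OF k(1) CI y] by blast
qed

section \<open>Convolution operators with a symmetric kernel and their eigenvectors\<close>

definition conv :: "('g \<Rightarrow> real) \<Rightarrow> ('g \<Rightarrow> complex) \<Rightarrow> 'g \<Rightarrow> complex"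
  where "conv k f = (\<lambda>x. haar (\<lambda>y. complex_of_real (k (x - y)) * f y))"

context
  fixes k :: "'g \<Rightarrow> real" and B :: real
  assumes k: "continuous_on UNIV k" and sym: "\<And>x. k (- x) = k x" and B: "\<And>x. \<bar>k x\<bar> \<le> B"
begin

private abbreviation ker where "ker x \<equiv> (\<lambda>y. complex_of_real (k (x - y)))"

private lemma kC: "(\<lambda>x. complex_of_real (k x)) \<in> C"
  unfolding C_iff by (intro continuous_intros k)

private lemma kerC: "ker x \<in> C"
  using C_translate(5)[OF kC] .

private lemma conv_ip: "conv k f x = ip f (ker x)"
  by (simp add: conv_def ip_def mult.commute)

private lemma B0: "B \<ge> 0"
  using order_trans[OF abs_ge_zero B] .

private lemma sqnorm_ker: "sqnorm (ker x) \<le> B\<^sup>2"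
  using kerC B by (intro sqnorm_le) auto

text \<open>The operator turns bounds in the square norm into uniform bounds. Together with the
  equicontinuity below, this is its compactness.\<close>

private lemma conv_bound: "f \<in> C \<Longrightarrow> norm (conv k f x) \<le> B * sqrt (sqnorm f)"
proof -
  assume f: "f \<in> C"
  have "(norm (conv k f x))\<^sup>2 \<le> sqnorm f * B\<^sup>2"
    unfolding conv_ip using Cauchy_Schwarz[OF f kerC[of x]] sqnorm_ker[of x] sqnorm_nonneg[OF f]
    by (meson mult_left_mono order_trans)
  also have "\<dots> = (B * sqrt (sqnorm f))\<^sup>2" using sqnorm_nonneg[OF f] by (simp add: power_mult_distrib)
  finally show ?thesis by (rule power2_le_imp_le) (simp add: B0 sqnorm_nonneg[OF f])
qed

private lemma conv_C: "f \<in> C \<Longrightarrow> conv k f \<in> C"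
proof -
  assume f: "f \<in> C"
  have "continuous_on (UNIV \<times> UNIV) (\<lambda>p. complex_of_real (k (fst p - snd p)) * f (snd p))"
    by (intro continuous_intros C_parts[OF f] continuous_on_parts[OF k])
  from continuous_on_haar[OF this] show ?thesis by (simp add: conv_def C_iff)
qed

private lemma conv_diff: "f \<in> C \<Longrightarrow> h \<in> C \<Longrightarrow> conv k (\<lambda>x. f x - h x) = (\<lambda>x. conv k f x - conv k h x)"
  by (simp add: fun_eq_iff conv_ip ip_diff_left kerC)

private lemma conv_cmult: "f \<in> C \<Longrightarrow> conv k (\<lambda>x. c * f x) = (\<lambda>x. c * conv k f x)"
  by (simp add: fun_eq_iff conv_ip ip_cmult_left kerC)

private lemma conv_add: "f \<in> C \<Longrightarrow> h \<in> C \<Longrightarrow> conv k (\<lambda>x. f x + h x) = (\<lambda>x. conv k f x + conv k h x)"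
  by (simp add: fun_eq_iff conv_ip ip_add_left kerC)

private lemma conv_zero: "conv k (\<lambda>_. 0) = (\<lambda>_. 0)"
  by (simp add: conv_def)

text \<open>The kernel is unchanged when both variables are translated on the right, as
  \<open>x + h - (y + h) = x - y\<close>. Consequently eigenspaces are right invariant.\<close>

private lemma conv_translate: "f \<in> C \<Longrightarrow> conv k (\<lambda>x. f (x + h)) = (\<lambda>x. conv k f (x + h))"
proof
  fix x assume f: "f \<in> C"
  have "conv k f (x + h) = haar (\<lambda>y. complex_of_real (k (x + h - (y + h))) * f (y + h))"
    unfolding conv_def
    by (rule haar_right_translate[of "\<lambda>y. complex_of_real (k (x + h - y)) * f y" h, symmetric]) (intro C_intros f kerC)
  also have "(\<lambda>y. complex_of_real (k (x + h - (y + h))) * f (y + h)) = (\<lambda>y. complex_of_real (k (x - y)) * f (y + h))"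
    by (simp add: diff_add_eq_diff_diff_swap)
  finally show "conv k (\<lambda>x. f (x + h)) x = conv k f (x + h)" by (simp add: conv_def)
qed

text \<open>Fubini together with \<open>k (y - x) = k (x - y)\<close>, an instance of
  \<open>sym\<close>; that \<open>k\<close> is real takes care of the conjugation.\<close>

private lemma conv_self_adjoint:
  assumes f: "f \<in> C" and h: "h \<in> C"
  shows "ip (conv k f) h = ip f (conv k h)"
proof -
  let ?F = "\<lambda>p. complex_of_real (k (fst p - snd p)) * f (snd p) * cnj (h (fst p))"
  have F: "continuous_on UNIV ?F"
    by (intro continuous_intros C_parts[OF f] C_parts[OF h] continuous_on_parts[OF k])
  have "ip (conv k f) h = haar (\<lambda>x. haar (\<lambda>y. ?F (x, y)))"
    unfolding ip_def conv_def
  proof (rule arg_cong[of _ _ haar], rule ext)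
    fix x
    show "haar (\<lambda>y. complex_of_real (k (x - y)) * f y) * cnj (h x) = haar (\<lambda>y. ?F (x, y))"
      using haar_cmult[of "\<lambda>y. complex_of_real (k (x - y)) * f y" "cnj (h x)"] f kerC[of x]
      by (simp add: C_intros mult_ac)
  qed
  also have "\<dots> = haar (\<lambda>y. haar (\<lambda>x. ?F (x, y)))" by (rule haar_Fubini[OF F])
  also have "\<dots> = ip f (conv k h)"
    unfolding ip_def
  proof (rule arg_cong[of _ _ haar], rule ext)
    fix y
    have "k (y - x) = k (x - y)" for x using sym[of "x - y"] by simp
    then have "cnj (conv k h y) = haar (\<lambda>x. complex_of_real (k (x - y)) * cnj (h x))"
      unfolding conv_def using h kerC[of y]
      by (subst haar_cnj[symmetric]) (auto intro!: C_intros)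
    moreover have "(\<lambda>x. complex_of_real (k (x - y)) * cnj (h x)) \<in> C"
      by (intro C_intros h C_translate(4)[OF kC])
    ultimately show "haar (\<lambda>x. ?F (x, y)) = f y * cnj (conv k h y)"
      using haar_cmult[of "\<lambda>x. complex_of_real (k (x - y)) * cnj (h x)" "f y"] by (simp add: mult_ac)
  qed
  finally show ?thesis .
qed

text \<open>The difference of two values is the inner product of \<open>f\<close> with
  \<open>ker y - ker x\<close>, which is uniformly small for \<open>y\<close> near \<open>x\<close>;
  by Cauchy-Schwarz one neighbourhood serves the whole unit ball.\<close>

private lemma conv_equicontinuous:
  assumes "e > 0"
  obtains U where "open U" "x \<in> U" "\<And>f y. f \<in> C \<Longrightarrow> sqnorm f \<le> 1 \<Longrightarrow> y \<in> U \<Longrightarrow> norm (conv k f y - conv k f x) < e"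
proof -
  have c: "continuous_on (UNIV \<times> UNIV) (\<lambda>(a, b). k (a - b))"
    unfolding split_beta by (intro continuous_intros continuous_on_parts[OF k])
  obtain U where U: "x \<in> U" "open U" "\<forall>a\<in>U \<inter> UNIV. \<forall>b\<in>UNIV. dist (k (a - b)) (k (x - b)) \<le> e / 2"
    by (rule continuous_on_prod_compactE[OF c compact_UNIV, of x "e/2"]) (use assms in auto)
  have "norm (conv k f y - conv k f x) < e" if f: "f \<in> C" "sqnorm f \<le> 1" and y: "y \<in> U" for f y
  proof -
    have D: "(\<lambda>b. ker y b - ker x b) \<in> C" by (intro C_intros kerC)
    have "norm (ker y b - ker x b) \<le> e / 2" for b
      using U(3) y by (simp add: dist_real_def flip: of_real_diff)
    then have n: "sqnorm (\<lambda>b. ker y b - ker x b) \<le> (e / 2)\<^sup>2" by (intro sqnorm_le D)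
    have "conv k f y - conv k f x = ip f (\<lambda>b. ker y b - ker x b)"
      unfolding conv_ip by (simp add: ip_diff_right kerC f)
    then have "(norm (conv k f y - conv k f x))\<^sup>2 \<le> sqnorm f * sqnorm (\<lambda>b. ker y b - ker x b)"
      using Cauchy_Schwarz[OF f(1) D] by simp
    also have "\<dots> \<le> 1 * (e / 2)\<^sup>2" using f n sqnorm_nonneg[OF D] by (intro mult_mono) auto
    finally have "(norm (conv k f y - conv k f x))\<^sup>2 \<le> (e / 2)\<^sup>2" by simp
    then have "norm (conv k f y - conv k f x) \<le> e / 2" by (rule power2_le_imp_le) (use assms in simp)
    then show ?thesis using assms by linarith
  qed
  then show thesis using that[OF U(2,1)] by blast
qed

text \<open>
  Bessel's inequality for the kernel of the squared operator bounds the dimension of the eigenspace,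
  which is invariant under right translations.
\<close>

private lemma eigenspace_RF:
  assumes y: "y \<in> C" and eig: "conv k (conv k y) = (\<lambda>x. c * y x)" and c: "c \<noteq> 0"
  shows "y \<in> RF"
proof -
  define S where "S = {f \<in> C. conv k (conv k f) = (\<lambda>x. c * f x)}"
  have S: "cfun.subspace S"
    unfolding cfun.subspace_def S_def plus_fun_def zero_fun_def fscale_def
    by (auto simp: C_basic conv_add conv_cmult conv_C algebra_simps conv_zero)
  have SC: "S \<subseteq> C" by (auto simp: S_def)
  \<comment> \<open>\<open>c * e i x\<close> is the inner product of \<open>e i\<close> with
    \<open>conv k (ker x)\<close>, whose square norm is at most \<open>B ^ 4\<close>. Bessel bounds
    the sum over \<open>i\<close> at each \<open>x\<close>, and the mean over \<open>x\<close> turns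
    this into \<open>n * (norm c)\<^sup>2 \<le> B ^ 4\<close>.\<close>
  have bound: "n \<le> nat \<lceil>B ^ 4 / (norm c)\<^sup>2\<rceil>" if e: "orthonormal n e" "\<forall>i<n. e i \<in> S" for n e
  proof -
    have eC: "e i \<in> C" if "i < n" for i using e(1) that by (auto simp: orthonormal_def)
    have pt: "(\<Sum>i<n. (norm c)\<^sup>2 * (norm (e i x))\<^sup>2) \<le> B ^ 4" for x
    proof -
      have cc: "conv k (ker x) \<in> C" by (intro conv_C kerC)
      have "c * e i x = ip (e i) (conv k (ker x))" if "i < n" for i
      proof -
        have "c * e i x = conv k (conv k (e i)) x" using e(2) that by (simp add: S_def)
        also have "\<dots> = ip (conv k (e i)) (ker x)" by (rule conv_ip)
        also have "\<dots> = ip (e i) (conv k (ker x))" by (rule conv_self_adjoint[OF eC[OF that] kerC])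
        finally show ?thesis .
      qed
      then have "(norm c)\<^sup>2 * (norm (e i x))\<^sup>2 = (norm (ip (conv k (ker x)) (e i)))\<^sup>2" if "i < n" for i
        using that cnj_ip[OF eC[OF that] cc] by (metis complex_mod_cnj norm_mult power_mult_distrib)
      then have "(\<Sum>i<n. (norm c)\<^sup>2 * (norm (e i x))\<^sup>2) = (\<Sum>i<n. (norm (ip (conv k (ker x)) (e i)))\<^sup>2)"
        by (intro sum.cong) auto
      also have "\<dots> \<le> sqnorm (conv k (ker x))" by (rule Bessel[OF e(1) cc])
      also have "\<dots> \<le> (B * B)\<^sup>2"
      proof (rule sqnorm_le[OF cc])
        fix z
        have "norm (conv k (ker x) z) \<le> B * sqrt (sqnorm (ker x))" by (rule conv_bound[OF kerC])
        also have "\<dots> \<le> B * B" using B0 sqnorm_ker[of x] real_le_lsqrt by (intro mult_left_mono) auto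
        finally show "norm (conv k (ker x) z) \<le> B * B" .
      qed
      also have "\<dots> = B ^ 4" by (simp add: power2_eq_square power4_eq_xxxx)
      finally show ?thesis .
    qed
    have sq: "complex_of_real ((norm (e i x))\<^sup>2) = e i x * cnj (e i x)" for i x by (rule complex_norm_square)
    define F where "F = (\<lambda>x. \<Sum>i<n. complex_of_real ((norm c)\<^sup>2) * (e i x * cnj (e i x)))"
    have Feq: "F x = complex_of_real (\<Sum>i<n. (norm c)\<^sup>2 * (norm (e i x))\<^sup>2)" for x
      unfolding F_def sq[symmetric] by simp
    have "F \<in> C" unfolding F_def by (intro C_intros eC) auto
    moreover have "norm (F x) \<le> B ^ 4" for x
      unfolding Feq norm_of_real using pt[of x] by (simp add: sum_nonneg)
    ultimately have "norm (haar F) \<le> B ^ 4" by (rule haar_le)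
    moreover have "haar F = (\<Sum>i<n. complex_of_real ((norm c)\<^sup>2) * ip (e i) (e i))"
      unfolding F_def ip_def by (rule haar_sum_cmult) (intro C_intros eC, auto)
    then have "haar F = complex_of_real (real n * (norm c)\<^sup>2)"
      using orthonormalD[OF e(1)] by simp
    ultimately have "real n * (norm c)\<^sup>2 \<le> B ^ 4" by (simp only: norm_of_real abs_of_nonneg)
    then have "real n \<le> B ^ 4 / (norm c)\<^sup>2" using c by (simp add: pos_le_divide_eq)
    then show ?thesis by linarith
  qed
  obtain n e where e: "orthonormal n e" "\<And>i. i < n \<Longrightarrow> e i \<in> S"
    "\<And>f x. f \<in> S \<Longrightarrow> f x = (\<Sum>i<n. ip f (e i) * e i x)"
  proof -
    have "\<exists>n\<le>nat \<lceil>B ^ 4 / (norm c)\<^sup>2\<rceil>. \<exists>e. orthonormal n e \<and> (\<forall>i<n. e i \<in> S) \<and>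
        (\<forall>f\<in>S. \<forall>x. f x = (\<Sum>i<n. ip f (e i) * e i x))"
      by (rule orthonormal_basis[OF S SC]) (rule bound)
    then show thesis using that by blast
  qed
  have eC: "e i \<in> C" if "i < n" for i using e(1) that by (auto simp: orthonormal_def)
  have trans: "(\<lambda>x. y (x + h)) \<in> S" for h
    unfolding S_def using C_translate(1)[OF y] conv_translate[OF y] conv_translate[OF conv_C[OF y]] eig
    by simp
  show ?thesis
  proof (rule RF_sumI[where n = n and a = e and b = "\<lambda>i h. ip (\<lambda>x. y (x + h)) (e i)"])
    show "y (g + h) = (\<Sum>i<n. e i g * ip (\<lambda>x. y (x + h)) (e i))" for g h
      using e(3)[OF trans[of h], of g] by (simp add: mult.commute)
  qed (use y eC C_ip_right_translate in auto)
qed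

private definition iter where "iter w n = (conv k ^^ n) w"

private lemma iter_Suc: "iter w (Suc n) = conv k (iter w n)"
  by (simp add: iter_def)

private lemma iter_C: "w \<in> C \<Longrightarrow> iter w n \<in> C"
  by (induction n) (auto simp: iter_def conv_C)

private lemma sqrt_sqnorm_conv: "f \<in> C \<Longrightarrow> sqrt (sqnorm (conv k f)) \<le> B * sqrt (sqnorm f)"
proof -
  assume f: "f \<in> C"
  have "sqnorm (conv k f) \<le> (B * sqrt (sqnorm f))\<^sup>2" by (intro sqnorm_le conv_C f conv_bound)
  then show ?thesis using B0 sqnorm_nonneg[OF f] by (intro real_le_lsqrt) auto
qed

private lemma sqnorm_cmult: "f \<in> C \<Longrightarrow> sqnorm (\<lambda>x. c * f x) = (norm c)\<^sup>2 * sqnorm f"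
  using C_basic(4)[of "\<lambda>_. c" f]
  by (auto simp: sqnorm_def ip_cmult_left ip_cmult_right C_basic complex_norm_square[symmetric] mult.assoc[symmetric] simp del: of_real_power)

private lemma sqnorm_scale: "f \<in> C \<Longrightarrow> sqnorm (\<lambda>x. complex_of_real c * f x) = c\<^sup>2 * sqnorm f"
  unfolding sqnorm_cmult norm_of_real power2_abs ..

text \<open>
  Power iteration: by the Cauchy-Schwarz inequality the quotients \<open>q n\<close> of successive norms
  increase, which makes the normalised iterates \<open>u n\<close> approximate eigenvectors of the square of the
  operator; compactness of the operator gives an exact one.
\<close>

lemma conv_square_eigenvector:
  assumes w: "w \<in> C" and nz: "conv k w x0 \<noteq> 0"
  obtains y c where "y \<in> C" "c \<noteq> 0" "conv k (conv k y) = (\<lambda>x. c * y x)" "\<exists>x. y x \<noteq> 0"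
    "\<forall>v\<in>C. (\<forall>n. ip (iter w n) v = 0) \<longrightarrow> ip y v = 0"
proof -
  define a where "a = (\<lambda>n. sqrt (sqnorm (iter w n)))"
  have wC: "iter w n \<in> C" for n by (rule iter_C[OF w])
  have a_sq: "(a n)\<^sup>2 = sqnorm (iter w n)" for n using sqnorm_nonneg[OF wC] by (simp add: a_def)
  have a_nn: "a n \<ge> 0" for n using sqnorm_nonneg[OF wC] by (simp add: a_def)
  have a_le: "a (Suc n) \<le> B * a n" for n unfolding a_def iter_Suc by (rule sqrt_sqnorm_conv[OF wC])
  have a_conv: "(a (Suc n))\<^sup>2 \<le> a n * a (Suc (Suc n))" for n
  proof -
    have "ip (iter w (Suc n)) (iter w (Suc n)) = ip (iter w n) (iter w (Suc (Suc n)))"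
      unfolding iter_Suc by (intro conv_self_adjoint conv_C wC)
    then have "(a (Suc n))\<^sup>2 \<le> norm (ip (iter w n) (iter w (Suc (Suc n))))"
      unfolding a_sq sqnorm_def using complex_Re_le_cmod by metis
    also have "\<dots> \<le> a n * a (Suc (Suc n))"
    proof (rule power2_le_imp_le)
      show "(norm (ip (iter w n) (iter w (Suc (Suc n)))))\<^sup>2 \<le> (a n * a (Suc (Suc n)))\<^sup>2"
        unfolding power_mult_distrib a_sq by (rule Cauchy_Schwarz[OF wC wC])
    qed (simp add: a_nn)
    finally show ?thesis .
  qed
  have a1: "a 1 > 0"
    using sqnorm_pos[of "conv k w" x0] nz conv_C[OF w] by (simp add: a_def iter_def)
  have a0: "a 0 > 0"
  proof (rule ccontr)
    assume "\<not> a 0 > 0"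
    then have "a 0 = 0" using a_nn[of 0] by simp
    then show False using a_le[of 0] a1 by simp
  qed
  \<comment> \<open>Log-convexity of the norms keeps the iterates from ever vanishing, so the
    quotients below make sense.\<close>
  have a_pos: "a n > 0 \<and> a (Suc n) > 0" for n
  proof (induction n)
    case 0 show ?case using a0 a1 by simp
  next
    case (Suc n)
    then have "0 < (a (Suc n))\<^sup>2" by simp
    also have "\<dots> \<le> a n * a (Suc (Suc n))" by (rule a_conv)
    finally have "a (Suc (Suc n)) > 0" using Suc by (simp add: zero_less_mult_iff)
    then show ?case using Suc by simp
  qed
  define q where "q = (\<lambda>n. a (Suc n) / a n)"
  have q_pos: "q n > 0" for n using a_pos[of n] by (simp add: q_def)
  have q_mono: "q n \<le> q (Suc n)" for n
    using a_conv[of n] a_pos[of n] a_pos[of "Suc n"] by (simp add: q_def field_simps power2_eq_square)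
  have q_le: "q n \<le> B" for n using a_le[of n] a_pos[of n] by (simp add: q_def field_simps)
  have q_inc: "incseq q" using q_mono by (rule incseq_SucI)
  obtain \<mu> where \<mu>: "q \<longlonglongrightarrow> \<mu>" "\<And>n. q n \<le> \<mu>" using incseq_convergent[OF q_inc, of B] q_le by blast
  have \<mu>0: "\<mu> > 0" using \<mu>(2)[of 0] q_pos[of 0] by linarith
  define u where "u = (\<lambda>n x. complex_of_real (inverse (a n)) * iter w n x)"
  have uC: "u n \<in> C" for n unfolding u_def by (intro C_intros wC)
  have Tu: "conv k (u n) = (\<lambda>x. complex_of_real (inverse (a n)) * iter w (Suc n) x)" for n
    unfolding u_def iter_Suc by (rule conv_cmult[OF wC])
  have TTu: "conv k (conv k (u n)) = (\<lambda>x. complex_of_real (inverse (a n)) * iter w (Suc (Suc n)) x)" for n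
    unfolding Tu by (subst conv_cmult[OF wC]) (simp add: iter_Suc)
  have nrm_u: "sqnorm (u n) = 1" for n
    unfolding u_def sqnorm_scale[OF wC] a_sq[symmetric]
    using a_pos[of n] by (simp add: power_inverse)
  have nrm_Tu: "sqnorm (conv k (u n)) = (q n)\<^sup>2" for n
    unfolding Tu sqnorm_scale[OF wC] a_sq[symmetric] using a_pos[of n] by (simp add: q_def power_divide power_inverse field_simps)
  have nrm_TTu: "sqnorm (conv k (conv k (u n))) = (q n * q (Suc n))\<^sup>2" for n
    unfolding TTu sqnorm_scale[OF wC] a_sq[symmetric] using a_pos[of n] a_pos[of "Suc n"]
    by (simp add: q_def power_mult_distrib power_divide power_inverse field_simps)
  define d where "d = (\<lambda>n x. conv k (conv k (u n)) x - complex_of_real (\<mu>\<^sup>2) * u n x)"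
  have dC: "d n \<in> C" for n unfolding d_def by (intro C_intros conv_C uC)
  \<comment> \<open>By self-adjointness the mixed inner products are \<open>(q n)\<^sup>2\<close>.
    As \<open>q n\<close> tends to \<open>\<mu>\<close>, the whole expression tends to
    \<open>\<mu> ^ 4 - 2 * \<mu> ^ 4 + \<mu> ^ 4 = 0\<close>.\<close>
  have nrm_d: "sqnorm (d n) = (q n * q (Suc n))\<^sup>2 - 2 * \<mu>\<^sup>2 * (q n)\<^sup>2 + \<mu> ^ 4" for n
  proof -
    let ?t = "conv k (conv k (u n))" and ?m = "complex_of_real (\<mu>\<^sup>2)"
    have t: "?t \<in> C" by (intro conv_C uC)
    have m: "(\<lambda>x. ?m * u n x) \<in> C" by (intro C_intros uC)
    have tu: "ip ?t (u n) = complex_of_real ((q n)\<^sup>2)"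
      using conv_self_adjoint[OF conv_C[OF uC] uC, of n n] ip_self[OF conv_C[OF uC], of n] nrm_Tu[of n] by simp
    have ut: "ip (u n) ?t = complex_of_real ((q n)\<^sup>2)"
      using cnj_ip[OF t uC, of n] tu by simp
    have "ip (d n) (d n) = (ip ?t ?t - ip ?t (\<lambda>x. ?m * u n x)) - (ip (\<lambda>x. ?m * u n x) ?t - ip (\<lambda>x. ?m * u n x) (\<lambda>x. ?m * u n x))"
      using dC[of n] unfolding d_def by (simp only: ip_diff_left[OF t m] ip_diff_right[OF t m t] ip_diff_right[OF t m m])
    also have "\<dots> = ip ?t ?t - ?m * ip ?t (u n) - ?m * ip (u n) ?t + ?m * ?m * ip (u n) (u n)"
      using t m uC[of n] by (simp add: ip_cmult_left ip_cmult_right del: of_real_power)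
    also have "\<dots> = complex_of_real ((q n * q (Suc n))\<^sup>2 - 2 * \<mu>\<^sup>2 * (q n)\<^sup>2 + \<mu> ^ 4)"
      unfolding tu ut ip_self[OF t] ip_self[OF uC] nrm_TTu nrm_u
      by (simp add: power2_eq_square power4_eq_xxxx)
    finally show ?thesis by (simp add: sqnorm_def)
  qed
  have "(\<lambda>n. sqnorm (d n)) \<longlonglongrightarrow> (\<mu> * \<mu>)\<^sup>2 - 2 * \<mu>\<^sup>2 * \<mu>\<^sup>2 + \<mu> ^ 4"
    unfolding nrm_d using \<mu>(1) LIMSEQ_Suc[OF \<mu>(1)] by (intro tendsto_intros)
  moreover have "(\<mu> * \<mu>)\<^sup>2 - 2 * \<mu>\<^sup>2 * \<mu>\<^sup>2 + \<mu> ^ 4 = 0" by (simp add: power2_eq_square power4_eq_xxxx)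
  ultimately have "(\<lambda>n. sqnorm (d n)) \<longlonglongrightarrow> 0" by simp
  from tendsto_mult_right_zero[OF tendsto_real_sqrt[OF this, simplified]]
  have d0: "(\<lambda>n. B * sqrt (sqnorm (d n))) \<longlonglongrightarrow> 0" .
  \<comment> \<open>The \<open>u n\<close> are bounded only in the square norm. One more application
    of the operator makes them equicontinuous and keeps them approximate eigenvectors.\<close>
  define f where "f = (\<lambda>n. conv k (u n))"
  have fC: "f n \<in> C" for n unfolding f_def by (intro conv_C uC)
  have f_eig: "conv k (conv k (f n)) x - complex_of_real (\<mu>\<^sup>2) * f n x = conv k (d n) x" for n x
    unfolding f_def d_def by (simp add: conv_diff conv_cmult conv_C uC C_basic)
  obtain \<kappa> y where \<kappa>: "strict_mono \<kappa>" and yC: "y \<in> C" and lim: "uniform_limit UNIV (\<lambda>n. f (\<kappa> n)) y sequentially"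
  proof (rule equicontinuous_subsequence[of f B])
    show "norm (f n x) \<le> B" for n x
      using conv_bound[OF uC[of n], of x] nrm_u[of n] by (simp add: f_def)
    show "\<exists>U. open U \<and> x \<in> U \<and> (\<forall>n. \<forall>y\<in>U. norm (f n y - f n x) < e)" if e: "e > 0" for x e
    proof -
      obtain U where "open U" "x \<in> U" "\<And>f y. f \<in> C \<Longrightarrow> sqnorm f \<le> 1 \<Longrightarrow> y \<in> U \<Longrightarrow> norm (conv k f y - conv k f x) < e"
        by (rule conv_equicontinuous[OF e, of x]) (rule that)
      then show ?thesis using uC nrm_u unfolding f_def by (intro exI[of _ U]) simp
    qed
  qed (use fC in auto)
  have near: "\<forall>\<^sub>F n in sequentially. \<forall>x. norm (f (\<kappa> n) x - y x) < e" if "e > 0" for e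
    using uniform_limitD[OF lim that] by (simp add: dist_norm)
  have eig: "conv k (conv k y) x - complex_of_real (\<mu>\<^sup>2) * y x = 0" for x
  proof -
    have "norm (conv k (conv k y) x - complex_of_real (\<mu>\<^sup>2) * y x) \<le> 0"
    proof (rule field_le_epsilon)
      fix e :: real assume e: "e > 0"
      \<comment> \<open>The denominator collects the three errors: \<open>B * B\<close> from
        applying the operator twice to \<open>f (\<kappa> n) - y\<close>, 1 from the defect
        \<open>d\<close>, and \<open>\<mu>\<^sup>2\<close> from the eigenvalue term.\<close>
      define \<eta> where "\<eta> = e / (B * B + 1 + \<mu>\<^sup>2)"
      have den: "B * B + 1 + \<mu>\<^sup>2 > 0" using B0 by (intro add_nonneg_pos add_pos_nonneg) auto
      have \<eta>: "\<eta> > 0" unfolding \<eta>_def using e den by (rule divide_pos_pos)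
      have "(\<lambda>n. B * sqrt (sqnorm (d (\<kappa> n)))) \<longlonglongrightarrow> 0"
        using LIMSEQ_subseq_LIMSEQ[OF d0 \<kappa>] by (simp add: o_def)
      then have "\<forall>\<^sub>F n in sequentially. B * sqrt (sqnorm (d (\<kappa> n))) < \<eta>" using \<eta> by (rule order_tendstoD)
      from eventually_conj[OF this near[OF \<eta>]] obtain n where
        n: "B * sqrt (sqnorm (d (\<kappa> n))) < \<eta>" "\<And>x. norm (f (\<kappa> n) x - y x) < \<eta>"
        by (auto dest: eventually_happens)
      define g where "g = (\<lambda>x. f (\<kappa> n) x - y x)"
      have gC: "g \<in> C" unfolding g_def by (intro C_intros fC yC)
      have "sqnorm g \<le> \<eta>\<^sup>2" unfolding g_def using n(2) by (intro sqnorm_le) (auto intro: less_imp_le C_basic fC yC)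
      then have g1: "sqrt (sqnorm g) \<le> \<eta>" using \<eta> by (intro real_le_lsqrt sqnorm_nonneg gC) auto
      have "norm (conv k (conv k g) x) \<le> B * sqrt (sqnorm (conv k g))" by (intro conv_bound conv_C gC)
      also have "\<dots> \<le> B * (B * sqrt (sqnorm g))" by (intro mult_left_mono sqrt_sqnorm_conv gC B0)
      also have "\<dots> \<le> B * (B * \<eta>)" by (intro mult_left_mono g1 B0)
      finally have g2: "norm (conv k (conv k g) x) \<le> B * B * \<eta>" by (simp add: mult.assoc)
      have d1: "norm (conv k (d (\<kappa> n)) x) \<le> \<eta>" using conv_bound[OF dC, of "\<kappa> n" x] n(1) by linarith
      have g3: "norm (complex_of_real (\<mu>\<^sup>2) * g x) \<le> \<mu>\<^sup>2 * \<eta>"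
        unfolding norm_mult norm_of_real abs_power2 g_def using n(2)[of x] by (intro mult_mono) (auto intro: less_imp_le)
      have "conv k (conv k g) x = conv k (conv k (f (\<kappa> n))) x - conv k (conv k y) x"
        unfolding g_def by (simp add: conv_diff fC yC conv_C)
      then have "conv k (conv k y) x - complex_of_real (\<mu>\<^sup>2) * y x =
          (conv k (d (\<kappa> n)) x - conv k (conv k g) x) + complex_of_real (\<mu>\<^sup>2) * g x"
        unfolding f_eig[symmetric] g_def by (simp add: algebra_simps)
      also have "norm \<dots> \<le> (\<eta> + B * B * \<eta>) + \<mu>\<^sup>2 * \<eta>"
        by (intro order_trans[OF norm_triangle_ineq] order_trans[OF norm_triangle_ineq4] add_mono d1 g2 g3)
      also have "\<dots> = (B * B + 1 + \<mu>\<^sup>2) * \<eta>" by (simp add: algebra_simps)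
      also have "\<dots> = e" unfolding \<eta>_def using den by simp
      finally show "norm (conv k (conv k y) x - complex_of_real (\<mu>\<^sup>2) * y x) \<le> 0 + e" by simp
    qed
    then show ?thesis by simp
  qed
  \<comment> \<open>The square norm of \<open>f n\<close> is \<open>(q n)\<^sup>2\<close>, and
    \<open>q\<close> increases from the positive \<open>q 0\<close>; a uniform limit cannot be
    zero.\<close>
  have y0: "\<exists>x. y x \<noteq> 0"
  proof (rule ccontr)
    assume "\<nexists>x. y x \<noteq> 0"
    then have y: "y x = 0" for x by simp
    have "q 0 / 2 > 0" using q_pos[of 0] by simp
    from eventually_happens[OF near[OF this]] obtain n where "\<And>x. norm (f (\<kappa> n) x) < q 0 / 2" by (auto simp: y)
    then have "sqnorm (f (\<kappa> n)) \<le> (q 0 / 2)\<^sup>2" by (intro sqnorm_le fC less_imp_le)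
    then have "(q (\<kappa> n))\<^sup>2 \<le> (q 0 / 2)\<^sup>2" by (simp add: f_def nrm_Tu)
    then have "q (\<kappa> n) \<le> q 0 / 2" by (rule power2_le_imp_le) (use q_pos[of 0] in simp)
    moreover have "q 0 \<le> q (\<kappa> n)" using q_inc by (simp add: incseq_def)
    ultimately show False using q_pos[of 0] by linarith
  qed
  \<comment> \<open>Each \<open>f n\<close> is a multiple of the iterate with index
    \<open>n + 1\<close>, so orthogonality passes to the uniform limit.\<close>
  have perp: "ip y v = 0" if v: "v \<in> C" "\<forall>n. ip (iter w n) v = 0" for v
  proof -
    have fv: "ip (f n) v = 0" for n
      unfolding f_def Tu using ip_cmult_left[OF wC v(1)] v(2) by simp
    have "norm (ip y v) \<le> 0"
    proof (rule field_le_epsilon)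
      fix e :: real assume e: "e > 0"
      define \<eta> where "\<eta> = e / (sqrt (sqnorm v) + 1)"
      have den: "sqrt (sqnorm v) + 1 > 0" using sqnorm_nonneg[OF v(1)] by (intro add_nonneg_pos) auto
      have \<eta>: "\<eta> > 0" unfolding \<eta>_def using e den by (rule divide_pos_pos)
      from eventually_happens[OF near[OF \<eta>]] obtain n where n: "\<And>x. norm (f (\<kappa> n) x - y x) < \<eta>" by auto
      define g where "g = (\<lambda>x. f (\<kappa> n) x - y x)"
      have gC: "g \<in> C" unfolding g_def by (intro C_intros fC yC)
      have "sqnorm g \<le> \<eta>\<^sup>2" unfolding g_def using n by (intro sqnorm_le) (auto intro: less_imp_le C_basic fC yC)
      then have g1: "sqrt (sqnorm g) \<le> \<eta>" using \<eta> by (intro real_le_lsqrt sqnorm_nonneg gC) auto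
      have "norm (ip y v) = norm (ip g v)"
        unfolding g_def ip_diff_left[OF fC yC v(1)] fv by simp
      also have "\<dots> \<le> sqrt (sqnorm g) * sqrt (sqnorm v)"
        by (rule power2_le_imp_le)
          (use Cauchy_Schwarz[OF gC v(1)] in \<open>auto simp: power_mult_distrib sqnorm_nonneg gC v(1)\<close>)
      also have "\<dots> \<le> \<eta> * (sqrt (sqnorm v) + 1)"
        using g1 \<eta> sqnorm_nonneg[OF v(1)] by (intro mult_mono) auto
      also have "\<dots> = e" unfolding \<eta>_def using den by simp
      finally show "norm (ip y v) \<le> 0 + e" by simp
    qed
    then show ?thesis by simp
  qed
  show thesis
    by (rule that[OF yC _ _ y0, of "complex_of_real (\<mu>\<^sup>2)"]) (use \<mu>0 eig perp in auto)
qed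

text \<open>
  An eigenvector in the closed span of the iterates of \<open>w\<close> is a representative function, hence
  invariant under right translation by \<open>g0\<close>, and therefore orthogonal to all differences of
  translates by \<open>g0\<close>, among them the iterates.
\<close>

lemma conv_fixed_zero:
  assumes fixed: "\<And>f. f \<in> RF \<Longrightarrow> f g0 = f 0" and f: "f \<in> C"
  shows "conv k (\<lambda>x. f (x + g0) - f x) x0 = 0"
proof (rule ccontr)
  assume nz: "conv k (\<lambda>x. f (x + g0) - f x) x0 \<noteq> 0"
  define w where "w = (\<lambda>x. f (x + g0) - f x)"
  have wC: "w \<in> C" unfolding w_def by (intro C_intros C_translate f)
  obtain y c where y: "y \<in> C" "c \<noteq> 0" "conv k (conv k y) = (\<lambda>x. c * y x)" "\<exists>x. y x \<noteq> 0"
    "\<forall>v\<in>C. (\<forall>n. ip (iter w n) v = 0) \<longrightarrow> ip y v = 0"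
    by (rule conv_square_eigenvector[OF wC nz[folded w_def]]) (rule that)
  have "y \<in> RF" by (rule eigenspace_RF[OF y(1,3,2)])
  then have yfix: "y (x + g0) = y x" for x using fixed[OF RF_left_translate, of y x] by simp
  have it: "iter w n = (\<lambda>x. iter f n (x + g0) - iter f n x)" for n
  proof (induction n)
    case 0 show ?case by (simp add: iter_def w_def)
  next
    case (Suc n)
    show ?case unfolding iter_Suc Suc
      by (subst conv_diff) (auto intro: C_translate iter_C f simp: conv_translate iter_C f)
  qed
  have "ip (iter w n) y = 0" for n
  proof -
    have "ip (iter w n) y = ip (\<lambda>x. iter f n (x + g0)) (\<lambda>x. y (x + g0)) - ip (iter f n) y"
      unfolding it by (subst ip_diff_left) (auto intro: C_translate iter_C f y(1) simp: yfix)
    then show ?thesis using ip_right_translate[OF iter_C[OF f] y(1)] by simp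
  qed
  with y(1,5) have "ip y y = 0" by blast
  then have "sqnorm y = 0" by (simp add: sqnorm_def)
  then show False using y(4) sqnorm_pos[OF y(1)] by fastforce
qed

end

text \<open>Choose the kernel \<open>k\<close> supported in a neighbourhood \<open>U\<close> of 0 so
  small that \<open>U + U\<close> misses \<open>g0\<close>. Then \<open>k\<close> and its translate
  by \<open>g0\<close> have disjoint supports, and convolving their difference with \<open>k\<close>
  gives minus the mean of the square of \<open>k\<close> at 0, which is negative and contradicts
  \<open>conv_fixed_zero\<close>.\<close>

theorem representative_funs_separate:
  assumes "\<And>f. f \<in> RF \<Longrightarrow> f g0 = f (0 :: 'g)"
  shows "g0 = 0"
proof (rule ccontr)
  assume g0: "g0 \<noteq> 0"
  have "\<exists>U. open U \<and> 0 \<in> U \<and> (\<forall>x\<in>U. \<forall>y\<in>U. x + y \<noteq> g0)"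
  proof -
    have "continuous_on UNIV (\<lambda>p :: 'g \<times> 'g. fst p + snd p)" by (intro continuous_intros)
    then have "open ((\<lambda>p :: 'g \<times> 'g. fst p + snd p) -` (- {g0}))" by (intro open_vimage) auto
    moreover have "(0, 0) \<in> (\<lambda>p :: 'g \<times> 'g. fst p + snd p) -` (- {g0})" using g0 by simp
    ultimately obtain U V where "open U" "open V" "(0, 0) \<in> U \<times> V"
      "U \<times> V \<subseteq> (\<lambda>p :: 'g \<times> 'g. fst p + snd p) -` (- {g0})"
      by (rule open_prod_elim)
    then show ?thesis by (intro exI[of _ "U \<inter> V"]) auto
  qed
  then obtain U where U: "open U" "0 \<in> U" "\<And>x y. x \<in> U \<Longrightarrow> y \<in> U \<Longrightarrow> x + y \<noteq> g0" by blast
  obtain h where h: "continuous_on UNIV h" "\<And>x. x \<in> U \<or> h x = 0" "h 0 = 1" "\<And>x::'g. 0 \<le> h x \<and> h x \<le> (1::real)"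
  proof -
    have "closedin (top_of_set UNIV) (- U)" "closedin (top_of_set UNIV) {0::'g}"
      using U(1) by (auto simp: closed_def)
    moreover have "disjnt (- U) {0}" using U(2) by (auto simp: disjnt_def)
    ultimately obtain h where "continuous_map (top_of_set UNIV) (top_of_set {0..1::real}) h" "h ` (- U) \<subseteq> {0}" "h ` {0} \<subseteq> {1}"
      using Urysohn_lemma[OF normal_space_compact[OF compact_UNIV], of "- U" "{0}" 0 1] by auto
    then have h: "continuous_on UNIV h" "\<And>x. h x \<in> {0..1}" "\<And>x. x \<in> U \<or> h x = 0" "h 0 = 1"
      by (auto simp: continuous_map_in_subtopology)
    show thesis by (rule that[OF h(1,3,4)]) (use h(2) in auto)
  qed
  \<comment> \<open>The product with the reflection is symmetric and vanishes unless both
    \<open>x\<close> and \<open>- x\<close> lie in \<open>U\<close>.\<close>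
  define k where "k = (\<lambda>x. h x * h (- x))"
  have k: "continuous_on UNIV k" unfolding k_def
    by (intro continuous_intros h(1) continuous_on_parts[OF h(1)])
  have ksym: "k (- x) = k x" for x by (simp add: k_def)
  have kB: "\<bar>k x\<bar> \<le> 1" for x using h(4) by (simp add: k_def abs_mult mult_le_one)
  have kU: "x \<in> U \<and> - x \<in> U" if "k x \<noteq> 0" for x using h(2)[of x] h(2)[of "- x"] that by (auto simp: k_def)
  let ?k = "\<lambda>x. complex_of_real (k x)"
  have kC: "?k \<in> C" unfolding C_iff by (intro continuous_intros k)
  have "conv k (\<lambda>x. ?k (x + g0) - ?k x) 0 = 0"
    by (rule conv_fixed_zero[of k 1 g0 ?k 0, OF k ksym kB assms kC])
  moreover have "k (0 - y) * (k (y + g0) - k y) = - (k y)\<^sup>2" for y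
  proof (cases "k y = 0")
    case False
    have "k (y + g0) = 0"
    proof (rule ccontr)
      assume "k (y + g0) \<noteq> 0"
      then have "y + g0 \<in> U" "- y \<in> U" using kU[of "y + g0"] kU[OF False] by auto
      then show False using U(3)[of "- y" "y + g0"] by simp
    qed
    then show ?thesis by (simp add: ksym power2_eq_square)
  qed (simp add: ksym)
  then have "?k (0 - y) * (?k (y + g0) - ?k y) = - (?k y * ?k y)" for y
    by (metis of_real_diff of_real_minus of_real_mult power2_eq_square)
  then have "conv k (\<lambda>x. ?k (x + g0) - ?k x) 0 = haar (\<lambda>y. - 1 * (?k y * ?k y))"
    unfolding conv_def by simp
  also have "\<dots> = - haar (\<lambda>y. ?k y * ?k y)" using haar_cmult[OF C_basic(4)[OF kC kC], of "-1"] by simp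
  moreover have "Re (haar (\<lambda>y. ?k y * ?k y)) > 0"
    by (rule haar_pos[of _ 0]) (use C_basic(4)[OF kC kC] h(3) in \<open>auto simp: k_def\<close>)
  ultimately show False by simp
qed

end

section \<open>Freeness and bijectivity of the canonical map\<close>

lemma (in compact_group_action) free_lift_can_bil_stabilizer:
  assumes "x \<in> X" "act x g = x"
  shows "free_lift can_bil t (x, g) = free_lift can_bil t (x, 0)"
  using subset_UNIV[of "Poly_Mapping.keys t"]
proof (induction t rule: frag_induction)
  case (one p)
  show ?case using assms by (cases p) (simp add: simple_tensor_def coaction_def)
next
  case (diff s t)
  then show ?case by (simp only: free_lift_diff minus_apply)
qed simp_all

theorem theorem1:
  fixes X :: "'x::t2_space set"
    and act :: "'x \<Rightarrow> 'g::{topological_group_add, t2_space} \<Rightarrow> 'x"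
  assumes "compact X"
    and "compact (UNIV :: 'g set)"
    and "continuous_right_action X act"
  shows "free_action X act \<longleftrightarrow>
    bij_betw (can_map X act) (carrier (peter_weyl_tensor X act))
      (tensor_funs (peter_weyl X act) representative_funs)"
proof -
  interpret compact_group_action "TYPE('g)" X act
    by unfold_locales fact+
  show ?thesis
  proof
    assume bij: "bij_betw (can_map X act) (carrier (peter_weyl_tensor X act)) (tensor_funs PW representative_funs)"
    show "free_action X act"
      unfolding free_action_def
    proof (intro ballI allI impI)
      fix x g assume x: "x \<in> X" "act x g = x"
      \<comment> \<open>The unit of \<open>C(X)\<close>: under extension by zero the constant 1 has
        to be cut off outside \<open>X\<close>.\<close>
      define a :: "'x \<Rightarrow> complex" where "a = (\<lambda>x. if x \<in> X then 1 else 0)"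
      have "a \<in> IF"
        by (auto simp: invariant_funs_iff a_def cont_funs_def cong: continuous_on_cong)
      then have a: "a \<in> PW" by (simp add: invariant_funs_def)
      have "f g = f 0" if "f \<in> RF" for f
      proof -
        have "simple_tensor a f \<in> tensor_funs PW representative_funs"
          unfolding tensor_funs_def using a that by (intro cfun.span_base) (auto simp: RF_eq_representative_funs)
        then obtain t where "simple_tensor a f = free_lift can_bil t"
          using bij unfolding bij_betw_def carrier_PW_tensor image_image can_map_coset by blast
        then have "simple_tensor a f (x, g) = simple_tensor a f (x, 0)"
          using free_lift_can_bil_stabilizer[OF x] by metis
        then show ?thesis using x(1) by (simp add: simple_tensor_def a_def)
      qed
      then show "g = 0" by (rule representative_funs_separate)
    qed
  qed (rule can_map_bij)
qed

end
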